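(* Let $m\ge 1$, let $\lambda\in\mathbb{C}^m$ be generic, let $\alpha\in\mathbb{Z}_{\ge 0}^m$, and put $\beta=(1,\alpha)$, $\tau=(-\lambda\cdot\alpha,\lambda)$. For every $s$ in the Weyl group $W$ of $Q_m$, the reflection map $\mathcal{R}_s:\mathfrak{M}^\tau(Q_m,\beta)\to\mathfrak{M}^{s\cdot\tau}(Q_m,s(\beta))$ is $G_\omega$-equivariant.
   Context: $Q_m$ is the quiver with vertex set $I_\infty=\{\infty,0,1,\dots,m-1\}$ (indices $0,\dots,m-1$ read in $\mathbb{Z}/m\mathbb{Z}$) and arrows $a_i:i+1\to i$ ($i\in\mathbb{Z}/m\mathbb{Z}$) and $a_\infty:\infty\to 0$. $\tilde A_{m-1}$ is the subquiver on $0,\dots,m-1$ with arrows $a_0,\dots,a_{m-1}$. Vectors in $\mathbb{C}^{m+1},\mathbb{Z}^{m+1}$ are indexed in the order $\infty,0,\dots,m-1$. $\lambda\in\mathbb{C}^m$ is generic if $\lambda\cdot\gamma\neq0$ for every (real or imaginary) root $\gamma$ of $\tilde A_{m-1}$. The double $\bar Q_m$ is obtained by adding an opposite arrow $a^*$ for each arrow $a$ of $Q_m$, with $(a^* )^*:=a$; $h(a)$ and $t(a)$ are the head and tail of an arrow; paths in the path algebra $\mathbb{C}\bar Q_m$ compose right to left; $S=\bigoplus_i\mathbb{C}e_i$ is spanned by the trivial paths; $\omega=\sum_a[a,a^*]$ (sum over arrows of $Q_m$); $\Pi^\tau(Q_m)=\mathbb{C}\bar Q_m/(\omega-\sum_i\tau_ie_i)$.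 $\mathfrak{M}^\tau(Q_m,\beta)=\mathrm{Rep}(\Pi^\tau(Q_m),\beta)/\!/G(\beta)$, $G(\beta)=(\prod_i\mathrm{GL}(\beta_i,\mathbb{C}))/\mathbb{C}^\times$; its points are isomorphism classes of semisimple $\Pi^\tau(Q_m)$-modules of dimension vector $\beta$. $G_\omega=G_\omega(Q_m)$ is the group of $S$-algebra automorphisms of $\mathbb{C}\bar Q_m$ fixing $\omega$; these descend to $\Pi^\tau(Q_m)$ for all $\tau$, and so $G_\omega$ acts on all the varieties $\mathfrak{M}^\tau(Q_m,\beta)$ by twisting modules. Let $(\ ,\ )$ be the symmetrization of the Ringel form $\langle\alpha,\beta\rangle=\sum_i\alpha_i\beta_i-\sum_{a}\alpha_{t(a)}\beta_{h(a)}$ of $Q_m$ (sum over arrows $a$ of $Q_m$), and $\epsilon_i$ the coordinate vectors. $W$ is the group of automorphisms of $\mathbb{Z}^{m+1}$ generated by the simple reflections $s_i(\beta)=\beta-(\beta,\epsilon_i)\epsilon_i$ at all loop-free vertices $i$ of $Q_m$ (the vertex $\infty$ included). It acts on parameters by the dual reflections $(r_i\tau)_j=\tau_j-(\epsilon_i,\epsilon_j)\tau_i$. For $s=s_{i_1}\cdots s_{i_k}$ one puts $\mathcal{R}_s:=\mathcal{R}_{i_1}\circ\cdots\circ\mathcal{R}_{i_k}$ and $s\cdot\tau=r_{i_1}\cdots r_{i_k}\tau$, where for a loop-free vertex $i$ and a parameter $\tau$ with $\tau_i\ne0$ (a condition required at each step of the composition) $\mathcal{R}_i:\mathfrak{M}^\tau(Q_m,\beta)\to\mathfrak{M}^{r_i\tau}(Q_m,s_i(\beta))$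 is the bijection induced by the following reflection functor. Let a $\Pi^\tau(Q_m)$-module be given by spaces $V_j$ and maps $V_a:V_{t(a)}\to V_{h(a)}$ for the arrows $a$ of $\bar Q_m$. Put $\varepsilon(a)=1$ if $a$ is an arrow of $Q_m$ and $\varepsilon(a)=-1$ if $a$ is an added opposite arrow. Let $V_\oplus=\bigoplus_{h(a)=i}V_{t(a)}$ (over arrows $a$ of $\bar Q_m$ with head $i$), let $\mu:V_i\to V_\oplus$ have components $\varepsilon(a)V_{a^*}$, and let $\pi:V_\oplus\to V_i$ have components $\tau_i^{-1}V_a$; then $\pi\mu=1$. Replace $V_i$ by $V_i'=\mathrm{Im}(1-\mu\pi)\subset V_\oplus$; for each $a$ with $h(a)=i$, replace $V_a$ by the map $V_{t(a)}\to V_i'$ which is the inclusion $V_{t(a)}\to V_\oplus$ followed by $-\tau_i(1-\mu\pi)$, and replace $V_{a^*}$ by $\varepsilon(a)$ times the projection $V_i'\subset V_\oplus\to V_{t(a)}$. All other spaces and maps are unchanged. *)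

theory Defs
  imports
    "HOL-Library.Function_Algebras"
    "HOL-Library.Poly_Mapping"
    "HOL-Algebra.Bij"
    "HOL-Algebra.Generated_Groups"
    "HOL-Algebra.QuotRing"
    "Graph_Theory.Graph_Theory"
    Complex_Main
begin

text \<open>A quiver is a \<^typ>\<open>('v, 'a) pre_digraph\<close>: vertices \<^const>\<open>verts\<close>, arrows \<^const>\<open>arcs\<close>.
  Integer vectors indexed by the vertices are functions \<^typ>\<open>'v \<Rightarrow> int\<close>; coordinates outside
  \<^const>\<open>verts\<close> enter neither form and are fixed by all reflections at vertices, so that
  \<open>weyl_group\<close> below is isomorphic to the group generated inside the automorphisms of
  \<open>\<int>\<^bsup>verts Q\<^esup>\<close>.\<close>

definition ringel_form :: "('v, 'a) pre_digraph \<Rightarrow> ('v \<Rightarrow> int) \<Rightarrow> ('v \<Rightarrow> int) \<Rightarrow> int" where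
  "ringel_form Q \<alpha> \<beta> =
     (\<Sum>v\<in>verts Q. \<alpha> v * \<beta> v) - (\<Sum>a\<in>arcs Q. \<alpha> (tail Q a) * \<beta> (head Q a))"

definition sym_form :: "('v, 'a) pre_digraph \<Rightarrow> ('v \<Rightarrow> int) \<Rightarrow> ('v \<Rightarrow> int) \<Rightarrow> int" where
  "sym_form Q \<alpha> \<beta> = ringel_form Q \<alpha> \<beta> + ringel_form Q \<beta> \<alpha>"

definition unit_vec :: "'v \<Rightarrow> 'v \<Rightarrow> int" where
  "unit_vec i = (\<lambda>j. if j = i then 1 else 0)"

definition loop_free :: "('v, 'a) pre_digraph \<Rightarrow> 'v set" where
  "loop_free Q = {i \<in> verts Q. \<forall>a\<in>arcs Q. \<not> (tail Q a = i \<and> head Q a = i)}"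

definition simple_reflection :: "('v, 'a) pre_digraph \<Rightarrow> 'v \<Rightarrow> ('v \<Rightarrow> int) \<Rightarrow> 'v \<Rightarrow> int" where
  "simple_reflection Q i \<beta> = (\<lambda>j. \<beta> j - sym_form Q \<beta> (unit_vec i) * unit_vec i j)"

definition dual_reflection ::
    "('v, 'a) pre_digraph \<Rightarrow> 'v \<Rightarrow> ('v \<Rightarrow> complex) \<Rightarrow> 'v \<Rightarrow> complex" where
  "dual_reflection Q i \<tau> = (\<lambda>j. \<tau> j - of_int (sym_form Q (unit_vec i) (unit_vec j)) * \<tau> i)"

definition weyl_group :: "('v, 'a) pre_digraph \<Rightarrow> (('v \<Rightarrow> int) \<Rightarrow> 'v \<Rightarrow> int) set" where
  "weyl_group Q = generate (BijGroup UNIV) (simple_reflection Q ` loop_free Q)"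

definition real_roots :: "('v, 'a) pre_digraph \<Rightarrow> ('v \<Rightarrow> int) set" where
  "real_roots Q = {w (unit_vec i) | w i. w \<in> weyl_group Q \<and> i \<in> loop_free Q}"

text \<open>Kac's fundamental region: nonzero nonnegative vectors with connected support that pair
  nonpositively with every coordinate vector.\<close>

definition fundamental_region :: "('v, 'a) pre_digraph \<Rightarrow> ('v \<Rightarrow> int) set" where
  "fundamental_region Q =
     {\<gamma>. (\<forall>v. \<gamma> v \<ge> 0) \<and> (\<forall>v. v \<notin> verts Q \<longrightarrow> \<gamma> v = 0) \<and> (\<exists>v. \<gamma> v \<noteq> 0) \<and>
         connected (Q \<restriction> {v \<in> verts Q. \<gamma> v \<noteq> 0}) \<and>
         (\<forall>i\<in>verts Q. sym_form Q \<gamma> (unit_vec i) \<le> 0)}"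

definition imaginary_roots :: "('v, 'a) pre_digraph \<Rightarrow> ('v \<Rightarrow> int) set" where
  "imaginary_roots Q =
     (\<Union>w\<in>weyl_group Q. \<Union>\<gamma>\<in>fundamental_region Q. {w \<gamma>, \<lambda>v. - w \<gamma> v})"

text \<open>A path is a pair of its start vertex and the list of its arrows in the order in which they
  are traversed.  Products compose right to left, so that in \<open>p \<cdot> q\<close> the path \<open>q\<close> is traversed
  first.\<close>

type_synonym ('v, 'a) path = "'v \<times> 'a list"

definition paths :: "('v, 'a) pre_digraph \<Rightarrow> ('v, 'a) path set" where
  "paths G = {(u, p). \<exists>v. pre_digraph.awalk G u p v}"

definition path_end :: "('v, 'a) pre_digraph \<Rightarrow> ('v, 'a) path \<Rightarrow> 'v" where
  "path_end G p = pre_digraph.awlast G (fst p) (snd p)"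

definition path_mult :: "('v, 'a) pre_digraph \<Rightarrow> ('v, 'a) path \<Rightarrow> ('v, 'a) path \<Rightarrow> complex \<Rightarrow>
    (('v, 'a) path \<Rightarrow>\<^sub>0 complex)" where
  "path_mult G p q c =
     (if path_end G q = fst p then Poly_Mapping.single (fst q, snd q @ snd p) c else 0)"

definition pa_mult :: "('v, 'a) pre_digraph \<Rightarrow> (('v, 'a) path \<Rightarrow>\<^sub>0 complex) \<Rightarrow>
    (('v, 'a) path \<Rightarrow>\<^sub>0 complex) \<Rightarrow> (('v, 'a) path \<Rightarrow>\<^sub>0 complex)" where
  "pa_mult G x y = (\<Sum>p\<in>Poly_Mapping.keys x. \<Sum>q\<in>Poly_Mapping.keys y.
     path_mult G p q (Poly_Mapping.lookup x p * Poly_Mapping.lookup y q))"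

definition idem_elt :: "'v \<Rightarrow> (('v, 'a) path \<Rightarrow>\<^sub>0 complex)" where
  "idem_elt v = Poly_Mapping.single (v, []) 1"

definition arrow_elt :: "('v, 'a) pre_digraph \<Rightarrow> 'a \<Rightarrow> (('v, 'a) path \<Rightarrow>\<^sub>0 complex)" where
  "arrow_elt G a = Poly_Mapping.single (tail G a, [a]) 1"

definition path_algebra :: "('v, 'a) pre_digraph \<Rightarrow> (('v, 'a) path \<Rightarrow>\<^sub>0 complex) ring" where
  "path_algebra G =
     \<lparr>carrier = {x. Poly_Mapping.keys x \<subseteq> paths G}, monoid.mult = pa_mult G,
      one = (\<Sum>v\<in>verts G. idem_elt v), zero = 0, add = (+)\<rparr>"

lemma path_mult_0 [simp]: "path_mult G p q 0 = 0"
  by (simp add: path_mult_def)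

lemma path_mult_add: "path_mult G p q (c + d) = path_mult G p q c + path_mult G p q d"
  by (simp add: path_mult_def single_add)

lemma pa_mult_superset:
  assumes "finite A" "finite B" "Poly_Mapping.keys x \<subseteq> A" "Poly_Mapping.keys y \<subseteq> B"
  shows "pa_mult G x y = (\<Sum>p\<in>A. \<Sum>q\<in>B.
     path_mult G p q (Poly_Mapping.lookup x p * Poly_Mapping.lookup y q))"
proof -
  have "pa_mult G x y = (\<Sum>p\<in>Poly_Mapping.keys x. \<Sum>q\<in>B.
     path_mult G p q (Poly_Mapping.lookup x p * Poly_Mapping.lookup y q))"
    unfolding pa_mult_def
    by (intro sum.cong refl sum.mono_neutral_left) (use assms in \<open>auto simp: in_keys_iff\<close>)
  also have "\<dots> = (\<Sum>p\<in>A. \<Sum>q\<in>B.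
     path_mult G p q (Poly_Mapping.lookup x p * Poly_Mapping.lookup y q))"
    by (intro sum.mono_neutral_left) (use assms in \<open>auto simp: in_keys_iff\<close>)
  finally show ?thesis .
qed

lemma pa_mult_add_left: "pa_mult G (x + y) z = pa_mult G x z + pa_mult G y z"
proof -
  let ?A = "Poly_Mapping.keys x \<union> Poly_Mapping.keys y \<union> Poly_Mapping.keys (x + y)"
  show ?thesis
    by (simp add: pa_mult_superset[of ?A "Poly_Mapping.keys z"] le_supI1
        lookup_add distrib_right path_mult_add sum.distrib Un_upper1 Un_upper2)
qed

lemma pa_mult_add_right: "pa_mult G x (y + z) = pa_mult G x y + pa_mult G x z"
proof -
  let ?A = "Poly_Mapping.keys y \<union> Poly_Mapping.keys z \<union> Poly_Mapping.keys (y + z)"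
  show ?thesis
    by (simp add: pa_mult_superset[of "Poly_Mapping.keys x" ?A] le_supI1
        lookup_add distrib_left path_mult_add sum.distrib Un_upper1 Un_upper2)
qed

lemma pa_mult_zero [simp]: "pa_mult G 0 x = 0" "pa_mult G x 0 = 0"
  by (simp_all add: pa_mult_def)

lemma pa_mult_sum_left: "pa_mult G (\<Sum>i\<in>I. f i) y = (\<Sum>i\<in>I. pa_mult G (f i) y)"
  by (induction I rule: infinite_finite_induct) (auto simp: pa_mult_add_left)

lemma pa_mult_sum_right: "pa_mult G y (\<Sum>i\<in>I. f i) = (\<Sum>i\<in>I. pa_mult G y (f i))"
  by (induction I rule: infinite_finite_induct) (auto simp: pa_mult_add_right)

lemma pa_mult_single:
  "pa_mult G (Poly_Mapping.single p c) (Poly_Mapping.single q d) = path_mult G p q (c * d)"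
  by (subst pa_mult_superset[of "{p}" "{q}"]) (auto simp: lookup_single)

lemma sum_singles: "x = (\<Sum>p\<in>Poly_Mapping.keys x. Poly_Mapping.single p (Poly_Mapping.lookup x p))"
proof (rule poly_mapping_eqI)
  fix k
  show "Poly_Mapping.lookup x k = Poly_Mapping.lookup
     (\<Sum>p\<in>Poly_Mapping.keys x. Poly_Mapping.single p (Poly_Mapping.lookup x p)) k"
    by (simp add: lookup_sum lookup_single when_def in_keys_iff)
qed

lemma path_end_append:
  assumes "path_end G (u, p) = v"
  shows "path_end G (u, p @ q) = path_end G (v, q)"
  using assms by (auto simp: path_end_def pre_digraph.awalk_verts_conv)

lemma pa_mult_assoc: "pa_mult G (pa_mult G x y) z = pa_mult G x (pa_mult G y z)"
proof -
  have *: "pa_mult G (pa_mult G (Poly_Mapping.single p a) (Poly_Mapping.single q b)) (Poly_Mapping.single r c)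
     = pa_mult G (Poly_Mapping.single p a) (pa_mult G (Poly_Mapping.single q b) (Poly_Mapping.single r c))"
    for p q r a b c
  proof -
    have "path_end G (fst r, snd r @ snd q) = path_end G q" if "path_end G r = fst q"
      using path_end_append[of G "fst r" "snd r" "fst q" "snd q"] that by simp
    then show ?thesis
      by (auto simp: pa_mult_single path_mult_def mult.assoc)
  qed
  show ?thesis
    by (subst (1 2) sum_singles[of x], subst (1 2) sum_singles[of y], subst (1 2) sum_singles[of z])
      (simp add: pa_mult_sum_left pa_mult_sum_right *)
qed

lemma paths_iff:
  assumes "wf_digraph G"
  shows "p \<in> paths G \<longleftrightarrow> pre_digraph.awalk G (fst p) (snd p) (path_end G p)"
proof -
  interpret wf_digraph G by fact
  show ?thesis
    by (cases p) (auto simp: paths_def path_end_def)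
qed

lemma paths_append:
  assumes "wf_digraph G" "p \<in> paths G" "q \<in> paths G" "path_end G q = fst p"
  shows "(fst q, snd q @ snd p) \<in> paths G"
proof -
  interpret wf_digraph G by fact
  have "awalk (fst q) (snd q) (fst p)" "awalk (fst p) (snd p) (path_end G p)"
    using assms by (simp_all add: paths_iff)
  then have "awalk (fst q) (snd q @ snd p) (path_end G p)"
    by (rule awalk_appendI)
  then show ?thesis
    by (auto simp: paths_def)
qed

lemma keys_sum_subset:
  assumes "\<And>i. i \<in> I \<Longrightarrow> Poly_Mapping.keys (f i) \<subseteq> P"
  shows "Poly_Mapping.keys (\<Sum>i\<in>I. f i) \<subseteq> P"
  using assms
proof (induction I rule: infinite_finite_induct)
  case (insert a A)
  then show ?case
    using keys_add[of "f a" "\<Sum>i\<in>A. f i"] by fastforce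
qed auto

lemma ring_path_algebra:
  assumes "fin_digraph G"
  shows "ring (path_algebra G)"
proof -
  interpret fin_digraph G by fact
  have wf: "wf_digraph G" ..
  have mult_closed: "Poly_Mapping.keys (pa_mult G x y) \<subseteq> paths G"
    if "Poly_Mapping.keys x \<subseteq> paths G" "Poly_Mapping.keys y \<subseteq> paths G" for x y
    unfolding pa_mult_def
  proof (intro keys_sum_subset)
    fix p q assume "p \<in> Poly_Mapping.keys x" "q \<in> Poly_Mapping.keys y"
    then show "Poly_Mapping.keys (path_mult G p q (Poly_Mapping.lookup x p * Poly_Mapping.lookup y q))
        \<subseteq> paths G"
      using that paths_append[OF wf, of p q] by (auto simp: path_mult_def split: if_splits)
  qed
  have one_closed: "Poly_Mapping.keys (\<Sum>v\<in>verts G. idem_elt v :: _ \<Rightarrow>\<^sub>0 complex) \<subseteq> paths G"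
    by (intro keys_sum_subset) (auto simp: idem_elt_def paths_def awalk_Nil_iff)
  have end_in: "path_end G p \<in> verts G" and start_in: "fst p \<in> verts G" if "p \<in> paths G" for p
    using that by (auto simp: paths_iff[OF wf] awalk_def)
      (metis awalk_last_in_verts paths_iff[OF wf] that)
  have one_left_single: "pa_mult G (\<Sum>v\<in>verts G. idem_elt v) (Poly_Mapping.single p c) = Poly_Mapping.single p c"
    if "p \<in> paths G" for p c
    using end_in[OF that]
    by (simp add: pa_mult_sum_left idem_elt_def pa_mult_single path_mult_def)
  have one_right_single: "pa_mult G (Poly_Mapping.single p c) (\<Sum>v\<in>verts G. idem_elt v) = Poly_Mapping.single p c"
    if "p \<in> paths G" for p c
    using start_in[OF that]
    by (simp add: pa_mult_sum_right idem_elt_def pa_mult_single path_mult_def path_end_def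
        pre_digraph.awalk_verts.simps)
  have one_left: "pa_mult G (\<Sum>v\<in>verts G. idem_elt v) x = x"
    if "Poly_Mapping.keys x \<subseteq> paths G" for x
    by (subst (1 2) sum_singles[of x], subst pa_mult_sum_right, rule sum.cong)
      (use that one_left_single in auto)
  have one_right: "pa_mult G x (\<Sum>v\<in>verts G. idem_elt v) = x"
    if "Poly_Mapping.keys x \<subseteq> paths G" for x
    by (subst (1 2) sum_singles[of x], subst pa_mult_sum_left, rule sum.cong)
      (use that one_right_single in auto)
  show ?thesis
  proof (rule ringI)
    show "abelian_group (path_algebra G)"
    proof (rule abelian_groupI)
      fix x y assume "x \<in> carrier (path_algebra G)" "y \<in> carrier (path_algebra G)"
      then show "x \<oplus>\<^bsub>path_algebra G\<^esub> y \<in> carrier (path_algebra G)"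
        using keys_add[of x y] by (auto simp: path_algebra_def)
    next
      fix x assume "x \<in> carrier (path_algebra G)"
      then show "\<exists>y\<in>carrier (path_algebra G). y \<oplus>\<^bsub>path_algebra G\<^esub> x = \<zero>\<^bsub>path_algebra G\<^esub>"
        by (intro bexI[of _ "- x"]) (auto simp: path_algebra_def)
    qed (auto simp: path_algebra_def algebra_simps)
    show "monoid (path_algebra G)"
      by (rule monoidI)
        (auto simp: path_algebra_def pa_mult_assoc one_left one_right
          dest: mult_closed[THEN subsetD, rotated -1] one_closed[THEN subsetD])
  qed (auto simp: path_algebra_def pa_mult_add_left pa_mult_add_right)
qed

text \<open>The span of the trivial paths \<open>\<Sum>\<^sub>v c\<^sub>v e\<^sub>v\<close>.\<close>

definition vertex_comb :: "('v, 'a) pre_digraph \<Rightarrow> ('v \<Rightarrow> complex) \<Rightarrow> (('v, 'a) path \<Rightarrow>\<^sub>0 complex)" where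
  "vertex_comb G c = (\<Sum>v\<in>verts G. Poly_Mapping.single (v, []) (c v))"

definition vertex_subalgebra :: "('v, 'a) pre_digraph \<Rightarrow> (('v, 'a) path \<Rightarrow>\<^sub>0 complex) set" where
  "vertex_subalgebra G = range (vertex_comb G)"

datatype 'a darrow = Arr 'a | Star 'a

fun star :: "'a darrow \<Rightarrow> 'a darrow" where
  "star (Arr a) = Star a"
| "star (Star a) = Arr a"

fun arrow_sign :: "'a darrow \<Rightarrow> complex" where
  "arrow_sign (Arr a) = 1"
| "arrow_sign (Star a) = -1"

definition double :: "('v, 'a) pre_digraph \<Rightarrow> ('v, 'a darrow) pre_digraph" where
  "double Q =
     \<lparr>verts = verts Q, arcs = Arr ` arcs Q \<union> Star ` arcs Q,
      tail = case_darrow (tail Q) (head Q), head = case_darrow (head Q) (tail Q)\<rparr>"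

lemma fin_digraph_double:
  assumes "fin_digraph Q"
  shows "fin_digraph (double Q)"
proof -
  interpret fin_digraph Q by fact
  show ?thesis
    by unfold_locales (auto simp: double_def)
qed

definition omega_elt :: "('v, 'a) pre_digraph \<Rightarrow> (('v, 'a darrow) path \<Rightarrow>\<^sub>0 complex)" where
  "omega_elt Q = (\<Sum>a\<in>arcs Q.
     pa_mult (double Q) (arrow_elt (double Q) (Arr a)) (arrow_elt (double Q) (Star a))
     - pa_mult (double Q) (arrow_elt (double Q) (Star a)) (arrow_elt (double Q) (Arr a)))"

definition preprojective_ideal ::
    "('v, 'a) pre_digraph \<Rightarrow> ('v \<Rightarrow> complex) \<Rightarrow> (('v, 'a darrow) path \<Rightarrow>\<^sub>0 complex) set" where
  "preprojective_ideal Q \<tau> =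
     genideal (path_algebra (double Q)) {omega_elt Q - vertex_comb (double Q) \<tau>}"

text \<open>Ring automorphisms that fix \<open>S\<close> pointwise are automatically \<open>\<complex>\<close>-linear, because the scalars
  \<open>\<Sum>\<^sub>v c e\<^sub>v\<close> lie in \<open>S\<close>.  Extensionality makes each automorphism correspond to exactly one
  HOL function.\<close>

definition symmetry_group ::
    "('v, 'a) pre_digraph \<Rightarrow>
     ((('v, 'a darrow) path \<Rightarrow>\<^sub>0 complex) \<Rightarrow> (('v, 'a darrow) path \<Rightarrow>\<^sub>0 complex)) set" where
  "symmetry_group Q =
     {\<sigma> \<in> ring_iso (path_algebra (double Q)) (path_algebra (double Q)).
        \<sigma> \<in> extensional (carrier (path_algebra (double Q))) \<and>
        (\<forall>s\<in>vertex_subalgebra (double Q). \<sigma> s = s) \<and> \<sigma> (omega_elt Q) = omega_elt Q}"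

text \<open>Vector spaces are subspaces of \<^typ>\<open>'b \<Rightarrow> complex\<close> for some index type \<^typ>\<open>'b\<close>.\<close>

definition cscale :: "complex \<Rightarrow> ('b \<Rightarrow> complex) \<Rightarrow> 'b \<Rightarrow> complex" where
  "cscale c x = (\<lambda>b. c * x b)"

global_interpretation cvec: vector_space "cscale :: complex \<Rightarrow> ('b \<Rightarrow> complex) \<Rightarrow> 'b \<Rightarrow> complex"
  by unfold_locales (auto simp: cscale_def fun_eq_iff algebra_simps)

definition linear_between ::
    "('b \<Rightarrow> complex) set \<Rightarrow> ('c \<Rightarrow> complex) set \<Rightarrow> (('b \<Rightarrow> complex) \<Rightarrow> 'c \<Rightarrow> complex) \<Rightarrow> bool" where
  "linear_between U W f \<longleftrightarrow>
     f \<in> U \<rightarrow> W \<and> (\<forall>x\<in>U. \<forall>y\<in>U. f (x + y) = f x + f y) \<and>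
     (\<forall>c. \<forall>x\<in>U. f (cscale c x) = cscale c (f x))"

definition fin_dim_space :: "('b \<Rightarrow> complex) set \<Rightarrow> bool" where
  "fin_dim_space U \<longleftrightarrow> (\<exists>B. finite B \<and> cvec.span B = U)"

record ('v, 'a, 'b) quiver_rep =
  space :: "'v \<Rightarrow> ('b \<Rightarrow> complex) set"
  amap :: "'a \<Rightarrow> ('b \<Rightarrow> complex) \<Rightarrow> 'b \<Rightarrow> complex"

definition is_rep :: "('v, 'a) pre_digraph \<Rightarrow> ('v, 'a, 'b) quiver_rep \<Rightarrow> bool" where
  "is_rep G V \<longleftrightarrow>
     (\<forall>v\<in>verts G. fin_dim_space (space V v)) \<and>
     (\<forall>a\<in>arcs G. linear_between (space V (tail G a)) (space V (head G a)) (amap V a))"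

definition has_dimension :: "('v, 'a) pre_digraph \<Rightarrow> ('v, 'a, 'b) quiver_rep \<Rightarrow> ('v \<Rightarrow> int) \<Rightarrow> bool" where
  "has_dimension G V \<beta> \<longleftrightarrow> (\<forall>v\<in>verts G. int (cvec.dim (space V v)) = \<beta> v)"

text \<open>The action of the path algebra on \<open>\<Oplus>\<^sub>v V\<^sub>v\<close>, whose elements are families \<open>w\<close> with
  \<open>w v \<in> V\<^sub>v\<close>.\<close>

definition rep_act :: "('v, 'a) pre_digraph \<Rightarrow> ('v, 'a, 'b) quiver_rep \<Rightarrow> (('v, 'a) path \<Rightarrow>\<^sub>0 complex) \<Rightarrow>
    ('v \<Rightarrow> 'b \<Rightarrow> complex) \<Rightarrow> 'v \<Rightarrow> 'b \<Rightarrow> complex" where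
  "rep_act G V x w = (\<lambda>v. \<Sum>p | p \<in> Poly_Mapping.keys x \<and> path_end G p = v.
     cscale (Poly_Mapping.lookup x p) (fold (amap V) (snd p) (w (fst p))))"

text \<open>A module over the deformed preprojective algebra, the quotient of the path algebra of the
  double quiver by \<open>preprojective_ideal Q \<tau>\<close>, is a representation of the double quiver
  annihilated by that ideal.\<close>

definition is_preprojective_module ::
    "('v, 'a) pre_digraph \<Rightarrow> ('v \<Rightarrow> complex) \<Rightarrow> ('v, 'a darrow, 'b) quiver_rep \<Rightarrow> bool" where
  "is_preprojective_module Q \<tau> V \<longleftrightarrow>
     is_rep (double Q) V \<and>
     (\<forall>x\<in>preprojective_ideal Q \<tau>. \<forall>w. (\<forall>v\<in>verts Q. w v \<in> space V v) \<longrightarrow>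
        (\<forall>v\<in>verts Q. rep_act (double Q) V x w v = 0))"

definition rep_iso ::
    "('v, 'a) pre_digraph \<Rightarrow> ('v, 'a, 'b) quiver_rep \<Rightarrow> ('v, 'a, 'c) quiver_rep \<Rightarrow> bool" where
  "rep_iso G V W \<longleftrightarrow> (\<exists>\<phi>.
     (\<forall>v\<in>verts G. linear_between (space V v) (space W v) (\<phi> v) \<and>
                   bij_betw (\<phi> v) (space V v) (space W v)) \<and>
     (\<forall>a\<in>arcs G. \<forall>x\<in>space V (tail G a).
        \<phi> (head G a) (amap V a x) = amap W a (\<phi> (tail G a) x)))"

definition is_subrep ::
    "('v, 'a) pre_digraph \<Rightarrow> ('v, 'a, 'b) quiver_rep \<Rightarrow> ('v \<Rightarrow> ('b \<Rightarrow> complex) set) \<Rightarrow> bool" where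
  "is_subrep G V U \<longleftrightarrow>
     (\<forall>v\<in>verts G. cvec.subspace (U v) \<and> U v \<subseteq> space V v) \<and>
     (\<forall>a\<in>arcs G. amap V a ` U (tail G a) \<subseteq> U (head G a))"

definition is_simple_subrep ::
    "('v, 'a) pre_digraph \<Rightarrow> ('v, 'a, 'b) quiver_rep \<Rightarrow> ('v \<Rightarrow> ('b \<Rightarrow> complex) set) \<Rightarrow> bool" where
  "is_simple_subrep G V U \<longleftrightarrow>
     is_subrep G V U \<and> (\<exists>v\<in>verts G. U v \<noteq> {0}) \<and>
     (\<forall>U'. is_subrep G V U' \<and> (\<forall>v\<in>verts G. U' v \<subseteq> U v) \<longrightarrow>
        (\<forall>v\<in>verts G. U' v = {0}) \<or> (\<forall>v\<in>verts G. U' v = U v))"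

text \<open>A (finite-dimensional) module is semisimple if it is the internal direct sum of finitely
  many simple submodules.\<close>

definition is_semisimple :: "('v, 'a) pre_digraph \<Rightarrow> ('v, 'a, 'b) quiver_rep \<Rightarrow> bool" where
  "is_semisimple G V \<longleftrightarrow> (\<exists>n U.
     (\<forall>k<n. is_simple_subrep G V (U k)) \<and>
     (\<forall>v\<in>verts G. \<forall>x\<in>space V v.
        \<exists>!u. u \<in> (\<Pi>\<^sub>E k\<in>{..<n::nat}. U k v) \<and> x = (\<Sum>k<n. u k)))"

text \<open>Since \<^typ>\<open>nat \<Rightarrow> complex\<close> is infinite-dimensional, every finite-dimensional representation is
  isomorphic to one inside it; its isomorphism class is the set of all such representations.\<close>

type_synonym ('v, 'a) std_rep = "('v, 'a darrow, nat) quiver_rep"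

definition iso_class ::
    "('v, 'a) pre_digraph \<Rightarrow> ('v, 'a darrow, 'b) quiver_rep \<Rightarrow> ('v, 'a) std_rep set" where
  "iso_class Q V = {W. is_rep (double Q) W \<and> rep_iso (double Q) V W}"

definition quiver_variety ::
    "('v, 'a) pre_digraph \<Rightarrow> ('v \<Rightarrow> complex) \<Rightarrow> ('v \<Rightarrow> int) \<Rightarrow> ('v, 'a) std_rep set set" where
  "quiver_variety Q \<tau> \<beta> = {iso_class Q V | V :: ('v, 'a) std_rep.
     is_preprojective_module Q \<tau> V \<and> has_dimension (double Q) V \<beta> \<and> is_semisimple (double Q) V}"

text \<open>The twist \<open>\<sigma>\<cdot>V\<close>: a path-algebra element acts on it as \<open>\<sigma>\<^sup>-\<^sup>1\<close> of that element acts on \<open>V\<close>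
  (the inverse makes this a left action).\<close>

definition twist_rep ::
    "('v, 'a) pre_digraph \<Rightarrow>
     ((('v, 'a darrow) path \<Rightarrow>\<^sub>0 complex) \<Rightarrow> (('v, 'a darrow) path \<Rightarrow>\<^sub>0 complex)) \<Rightarrow>
     ('v, 'a darrow, 'b) quiver_rep \<Rightarrow> ('v, 'a darrow, 'b) quiver_rep" where
  "twist_rep Q \<sigma> V =
     \<lparr>space = space V,
      amap = (\<lambda>a x. rep_act (double Q) V
        (inv_into (carrier (path_algebra (double Q))) \<sigma> (arrow_elt (double Q) a))
        ((\<lambda>_. 0)(tail (double Q) a := x)) (head (double Q) a))\<rparr>"

definition twist_point ::
    "('v, 'a) pre_digraph \<Rightarrow>
     ((('v, 'a darrow) path \<Rightarrow>\<^sub>0 complex) \<Rightarrow> (('v, 'a darrow) path \<Rightarrow>\<^sub>0 complex)) \<Rightarrow>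
     ('v, 'a) std_rep set \<Rightarrow> ('v, 'a) std_rep set" where
  "twist_point Q \<sigma> X = (\<Union>V\<in>X. iso_class Q (twist_rep Q \<sigma> V))"

definition in_arrows :: "('v, 'a) pre_digraph \<Rightarrow> 'v \<Rightarrow> 'a darrow set" where
  "in_arrows Q i = {a \<in> arcs (double Q). head (double Q) a = i}"

definition refl_sum ::
    "('v, 'a) pre_digraph \<Rightarrow> 'v \<Rightarrow> ('v, 'a darrow, 'b) quiver_rep \<Rightarrow> ('a darrow \<Rightarrow> 'b \<Rightarrow> complex) set" where
  "refl_sum Q i V =
     {w. (\<forall>a\<in>in_arrows Q i. w a \<in> space V (tail (double Q) a)) \<and> (\<forall>a. a \<notin> in_arrows Q i \<longrightarrow> w a = 0)}"

definition refl_mu ::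
    "('v, 'a) pre_digraph \<Rightarrow> 'v \<Rightarrow> ('v, 'a darrow, 'b) quiver_rep \<Rightarrow>
     ('b \<Rightarrow> complex) \<Rightarrow> 'a darrow \<Rightarrow> 'b \<Rightarrow> complex" where
  "refl_mu Q i V x =
     (\<lambda>a. if a \<in> in_arrows Q i then cscale (arrow_sign a) (amap V (star a) x) else 0)"

definition refl_pi ::
    "('v, 'a) pre_digraph \<Rightarrow> ('v \<Rightarrow> complex) \<Rightarrow> 'v \<Rightarrow> ('v, 'a darrow, 'b) quiver_rep \<Rightarrow>
     ('a darrow \<Rightarrow> 'b \<Rightarrow> complex) \<Rightarrow> 'b \<Rightarrow> complex" where
  "refl_pi Q \<tau> i V w = (\<Sum>a\<in>in_arrows Q i. cscale (inverse (\<tau> i)) (amap V a (w a)))"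

definition refl_proj ::
    "('v, 'a) pre_digraph \<Rightarrow> ('v \<Rightarrow> complex) \<Rightarrow> 'v \<Rightarrow> ('v, 'a darrow, 'b) quiver_rep \<Rightarrow>
     ('a darrow \<Rightarrow> 'b \<Rightarrow> complex) \<Rightarrow> 'a darrow \<Rightarrow> 'b \<Rightarrow> complex" where
  "refl_proj Q \<tau> i V w = w - refl_mu Q i V (refl_pi Q \<tau> i V w)"

text \<open>The reflected module lives over the index type \<^typ>\<open>'b + 'a darrow \<times> 'b\<close>: the unchanged
  spaces sit in the first summand, \<open>V\<^sub>i' \<subseteq> V\<^sub>\<oplus>\<close> in the second.\<close>

definition vec_inl :: "('b \<Rightarrow> complex) \<Rightarrow> 'b + 'a \<times> 'b \<Rightarrow> complex" where
  "vec_inl x = case_sum x (\<lambda>_. 0)"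

definition vec_outl :: "('b + 'a \<times> 'b \<Rightarrow> complex) \<Rightarrow> 'b \<Rightarrow> complex" where
  "vec_outl y = (\<lambda>b. y (Inl b))"

definition vec_inr :: "('a \<Rightarrow> 'b \<Rightarrow> complex) \<Rightarrow> 'b + 'a \<times> 'b \<Rightarrow> complex" where
  "vec_inr w = case_sum (\<lambda>_. 0) (\<lambda>(a, b). w a b)"

definition vec_outr :: "('b + 'a \<times> 'b \<Rightarrow> complex) \<Rightarrow> 'a \<Rightarrow> 'b \<Rightarrow> complex" where
  "vec_outr y = (\<lambda>a b. y (Inr (a, b)))"

definition reflect_rep ::
    "('v, 'a) pre_digraph \<Rightarrow> ('v \<Rightarrow> complex) \<Rightarrow> 'v \<Rightarrow> ('v, 'a darrow, 'b) quiver_rep \<Rightarrow>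
     ('v, 'a darrow, 'b + 'a darrow \<times> 'b) quiver_rep" where
  "reflect_rep Q \<tau> i V =
     \<lparr>space = (\<lambda>v. if v = i then vec_inr ` refl_proj Q \<tau> i V ` refl_sum Q i V
                    else vec_inl ` space V v),
      amap = (\<lambda>a y.
        if head (double Q) a = i then
          cscale (- \<tau> i) (vec_inr (refl_proj Q \<tau> i V ((\<lambda>_. 0)(a := vec_outl y))))
        else if tail (double Q) a = i then
          vec_inl (cscale (arrow_sign (star a)) (vec_outr y (star a)))
        else vec_inl (amap V a (vec_outl y)))\<rparr>"

definition reflect_point ::
    "('v, 'a) pre_digraph \<Rightarrow> ('v \<Rightarrow> complex) \<Rightarrow> 'v \<Rightarrow> ('v, 'a) std_rep set \<Rightarrow> ('v, 'a) std_rep set" where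
  "reflect_point Q \<tau> i X = (\<Union>V\<in>X. iso_class Q (reflect_rep Q \<tau> i V))"

text \<open>For a word \<open>[i\<^sub>1, \<dots>, i\<^sub>k]\<close> the composites \<open>s\<^sub>i\<^sub>1 \<circ> \<dots> \<circ> s\<^sub>i\<^sub>k\<close>, \<open>r\<^sub>i\<^sub>1 \<dots> r\<^sub>i\<^sub>k \<tau>\<close> and
  \<open>\<R>\<^sub>i\<^sub>1 \<circ> \<dots> \<circ> \<R>\<^sub>i\<^sub>k\<close>, and the requirement that every step of the last one be defined.\<close>

definition word_reflection :: "('v, 'a) pre_digraph \<Rightarrow> 'v list \<Rightarrow> ('v \<Rightarrow> int) \<Rightarrow> 'v \<Rightarrow> int" where
  "word_reflection Q ws = foldr (simple_reflection Q) ws"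

definition word_dual_reflection ::
    "('v, 'a) pre_digraph \<Rightarrow> 'v list \<Rightarrow> ('v \<Rightarrow> complex) \<Rightarrow> 'v \<Rightarrow> complex" where
  "word_dual_reflection Q ws = foldr (dual_reflection Q) ws"

primrec admissible_word :: "('v, 'a) pre_digraph \<Rightarrow> ('v \<Rightarrow> complex) \<Rightarrow> 'v list \<Rightarrow> bool" where
  "admissible_word Q \<tau> [] \<longleftrightarrow> True"
| "admissible_word Q \<tau> (i # ws) \<longleftrightarrow>
     admissible_word Q \<tau> ws \<and> i \<in> loop_free Q \<and> word_dual_reflection Q ws \<tau> i \<noteq> 0"

primrec reflect_points ::
    "('v, 'a) pre_digraph \<Rightarrow> ('v \<Rightarrow> complex) \<Rightarrow> 'v list \<Rightarrow>
     ('v, 'a) std_rep set \<Rightarrow> ('v, 'a) std_rep set" where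
  "reflect_points Q \<tau> [] X = X"
| "reflect_points Q \<tau> (i # ws) X =
     reflect_point Q (word_dual_reflection Q ws \<tau>) i (reflect_points Q \<tau> ws X)"

datatype vertex = Infty | Cyc nat

text \<open>\<^const>\<open>Infty\<close> and \<^term>\<open>Cyc i\<close> name both the vertices \<open>\<infinity>\<close>, \<open>i\<close> and the arrows
  \<open>a\<^sub>\<infinity>\<close>, \<open>a\<^sub>i\<close>.\<close>

definition cyclic_quiver :: "nat \<Rightarrow> (vertex, vertex) pre_digraph" where
  "cyclic_quiver m =
     \<lparr>verts = Cyc ` {..<m}, arcs = Cyc ` {..<m},
      tail = case_vertex Infty (\<lambda>i. Cyc (Suc i mod m)), head = case_vertex (Cyc 0) Cyc\<rparr>"

definition framed_cyclic_quiver :: "nat \<Rightarrow> (vertex, vertex) pre_digraph" where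
  "framed_cyclic_quiver m =
     \<lparr>verts = insert Infty (Cyc ` {..<m}), arcs = insert Infty (Cyc ` {..<m}),
      tail = case_vertex Infty (\<lambda>i. Cyc (Suc i mod m)), head = case_vertex (Cyc 0) Cyc\<rparr>"

lemma fin_digraph_framed_cyclic_quiver:
  assumes "m \<ge> 1"
  shows "fin_digraph (framed_cyclic_quiver m)"
  by unfold_locales (use assms in \<open>auto simp: framed_cyclic_quiver_def split: vertex.splits\<close>)

definition generic :: "nat \<Rightarrow> (nat \<Rightarrow> complex) \<Rightarrow> bool" where
  "generic m l \<longleftrightarrow> (\<forall>\<gamma> \<in> real_roots (cyclic_quiver m) \<union> imaginary_roots (cyclic_quiver m).
     (\<Sum>i<m. l i * of_int (\<gamma> (Cyc i))) \<noteq> 0)"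

definition framed_dim :: "(nat \<Rightarrow> nat) \<Rightarrow> vertex \<Rightarrow> int" where
  "framed_dim \<alpha> = case_vertex 1 (\<lambda>i. int (\<alpha> i))"

definition framed_param :: "nat \<Rightarrow> (nat \<Rightarrow> complex) \<Rightarrow> (nat \<Rightarrow> nat) \<Rightarrow> vertex \<Rightarrow> complex" where
  "framed_param m l \<alpha> = case_vertex (- (\<Sum>i<m. l i * of_nat (\<alpha> i))) l"

end

theory Submission
  imports Defs "HOL-Computational_Algebra.Polynomial" "Jordan_Normal_Form.Determinant"
begin

text \<open>Let \<open>A\<close> be the path algebra of the double quiver and \<open>e\<close> the sum of the idempotents other than the
  one at the reflected vertex \<open>i\<close>.  If \<open>\<tau>\<^sub>i\<close> is nonzero, a module is determined up to isomorphism by its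
  restriction to \<open>e A e\<close> together with \<open>\<tau>\<^sub>i\<close>, and on \<open>e A e\<close> the reflection functor is the twist by the
  automorphism that adds \<open>\<plusminus>\<tau>\<^sub>i e\<^sub>j\<close> to the products \<open>a\<^sup>* a\<close> through \<open>i\<close>.  So one has to show that an
  automorphism \<open>\<rho>\<close> fixing the commutator element commutes with these shifts.

  The shifts form a flow, so this can be checked on derivatives, for modules induced from \<open>e A e\<close>, whose
  space at \<open>i\<close> is the direct sum over all arrows into \<open>i\<close>.  There the shift is the flow of a vector field
  \<open>\<delta>\<close>.  Evaluating \<open>\<rho>(\<omega>) = \<omega>\<close> on unipotent upper triangular 3 by 3 families and taking traces shows
  that \<open>\<rho>\<close> preserves the symplectic form, which identifies the image of \<open>\<delta>\<close> under \<open>\<rho>\<close> except for one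
  term: the logarithmic derivative of the determinant of a polynomial family of invertible matrices.
  Such a determinant is constant, so the term vanishes.\<close>

text \<open>The shift lives on \<open>e A e\<close> only. It does not come from an automorphism of
  \<open>A\<close> fixing the vertices, because the idempotent that it adds is not a combination of
  paths through \<open>i\<close>; so \<rho> cannot simply be conjugated past it inside
  \<open>A\<close>. On an induced module the difficulty becomes linear: the incoming arrows are the
  fixed inclusions of summands, and the shift is the translation of the outgoing arrows along
  \<delta>. No preprojective relation is imposed there, so every family of blocks is a tangent
  vector and the trace pairing is nondegenerate.

  The pairing of \<delta> with a tangent vector is the derivative of the trace of the map at
  \<open>i\<close> assembled from the incoming arrows. Twisting back multiplies this map on the
  right by a matrix \<open>fac\<close>, and the product rule leaves the wanted term plus the trace
  of the inverse of \<open>fac\<close> times its derivative. The formulas for \<rho> and for its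
  inverse are both noncommutative polynomials, so \<open>fac\<close> and its inverse depend
  polynomially on the parameter, and the determinant is a unit of the polynomial ring.\<close>

class calg = ring +
  fixes csc :: "complex \<Rightarrow> 'a \<Rightarrow> 'a"
  assumes csc_add_right: "csc c (x + y) = csc c x + csc c y"
    and csc_add_left: "csc (c + d) x = csc c x + csc d x"
    and csc_csc: "csc c (csc d x) = csc (c * d) x"
    and csc_one: "csc 1 x = x"
    and csc_mult_left: "csc c x * y = csc c (x * y)"
    and csc_mult_right: "x * csc c y = csc c (x * y)"
begin

lemma csc_zero_right [simp]: "csc c 0 = 0"
  using csc_add_right[of c 0 0] by simp

lemma csc_zero_left [simp]: "csc 0 x = 0"
  using csc_add_left[of 0 0 x] by simp

lemma csc_minus_left: "csc (- c) x = - csc c x"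
  using csc_add_left[of "- c" c x] by (simp add: eq_neg_iff_add_eq_0)

lemma csc_sum_right: "csc c (\<Sum>i\<in>I. f i) = (\<Sum>i\<in>I. csc c (f i))"
  by (induction I rule: infinite_finite_induct) (auto simp: csc_add_right)

end

text \<open>No unit is mentioned because these algebras need not have one: finitely supported
  matrices over an infinite index type lack an identity. Vertices are sent to idempotents that act
  as units on their own blocks only.\<close>

definition calg_hom :: "('a::calg \<Rightarrow> 'b::calg) \<Rightarrow> bool" where
  "calg_hom h \<longleftrightarrow> (\<forall>x y. h (x + y) = h x + h y) \<and> (\<forall>x y. h (x * y) = h x * h y) \<and>
     (\<forall>c x. h (csc c x) = csc c (h x))"

lemma calg_homI:
  assumes "\<And>x y. h (x + y) = h x + h y" "\<And>x y. h (x * y) = h x * h y"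
    "\<And>c x. h (csc c x) = csc c (h x)"
  shows "calg_hom h"
  using assms by (auto simp: calg_hom_def)

context
  fixes h :: "'a::calg \<Rightarrow> 'b::calg"
  assumes h: "calg_hom h"
begin

lemma hom_add: "h (x + y) = h x + h y"
  and hom_mult: "h (x * y) = h x * h y"
  and hom_csc: "h (csc c x) = csc c (h x)"
  using h by (auto simp: calg_hom_def)

lemma hom_zero: "h 0 = 0"
  using hom_csc[of 0 0] by simp

lemma hom_sum: "h (\<Sum>i\<in>I. f i) = (\<Sum>i\<in>I. h (f i))"
  by (induction I rule: infinite_finite_induct) (auto simp: hom_add hom_zero)

end

instantiation complex :: calg
begin
definition csc_complex :: "complex \<Rightarrow> complex \<Rightarrow> complex" where "csc_complex = (*)"
instance by standard (auto simp: csc_complex_def algebra_simps)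
end

instantiation poly :: ("{comm_ring_1, calg}") calg
begin
definition csc_poly :: "complex \<Rightarrow> 'a poly \<Rightarrow> 'a poly" where "csc_poly c p = smult (csc c 1) p"
instance
proof
  fix c d :: complex and p q :: "'a poly"
  have 1: "csc c (1::'a) * csc d 1 = csc (c * d) 1"
    by (simp add: csc_mult_left csc_csc)
  show "csc c (csc d p) = csc (c * d) p"
    by (simp add: csc_poly_def 1)
qed (auto simp: csc_poly_def algebra_simps csc_add_left smult_add_right smult_add_left csc_one)
end

section \<open>Finitely supported matrices\<close>

text \<open>Blocks of all sizes share one type, so that maps between the spaces at different
  vertices multiply in a single ring and traces need no dimension bookkeeping. An index counts as
  used if its row or its column is nonzero, so one finite set bounds both.\<close>

typedef (overloaded) ('i, 'k::zero) fmat = "{f :: 'i \<Rightarrow> 'i \<Rightarrow> 'k. finite {x. \<exists>y. f x y \<noteq> 0 \<or> f y x \<noteq> 0}}"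
  morphisms ent Fmat
  by (rule exI[of _ "\<lambda>_ _. 0"]) auto

definition fsupp :: "('i, 'k::zero) fmat \<Rightarrow> 'i set" where
  "fsupp M = {x. \<exists>y. ent M x y \<noteq> 0 \<or> ent M y x \<noteq> 0}"

lemma finite_fsupp [simp]: "finite (fsupp M)"
  using ent[of M] by (simp add: fsupp_def)

lemma ent_eqI: "(\<And>x y. ent M x y = ent N x y) \<Longrightarrow> M = N"
  by (metis ent_inject ext)

lemma ent_zero_outside: "x \<notin> fsupp M \<Longrightarrow> ent M x y = 0" "y \<notin> fsupp M \<Longrightarrow> ent M x y = 0"
  by (auto simp: fsupp_def)

lemma ent_Fmat:
  assumes "finite S" "\<And>x y. x \<notin> S \<or> y \<notin> S \<Longrightarrow> f x y = 0"
  shows "ent (Fmat f) = f"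
proof (rule Fmat_inverse)
  have "{x. \<exists>y. f x y \<noteq> 0 \<or> f y x \<noteq> 0} \<subseteq> S"
    using assms(2) by auto
  then show "f \<in> {f. finite {x. \<exists>y. f x y \<noteq> 0 \<or> f y x \<noteq> 0}}"
    using assms(1) finite_subset by auto
qed

lemma fsupp_subset:
  assumes "\<And>x y. x \<notin> S \<or> y \<notin> S \<Longrightarrow> ent M x y = 0"
  shows "fsupp M \<subseteq> S"
  using assms by (auto simp: fsupp_def)

instantiation fmat :: (type, calg) calg
begin

definition zero_fmat :: "('a, 'b) fmat" where "zero_fmat = Fmat (\<lambda>_ _. 0)"
definition plus_fmat :: "('a, 'b) fmat \<Rightarrow> ('a, 'b) fmat \<Rightarrow> ('a, 'b) fmat" where
  "plus_fmat M N = Fmat (\<lambda>x y. ent M x y + ent N x y)"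
definition minus_fmat :: "('a, 'b) fmat \<Rightarrow> ('a, 'b) fmat \<Rightarrow> ('a, 'b) fmat" where
  "minus_fmat M N = Fmat (\<lambda>x y. ent M x y - ent N x y)"
definition uminus_fmat :: "('a, 'b) fmat \<Rightarrow> ('a, 'b) fmat" where
  "uminus_fmat M = Fmat (\<lambda>x y. - ent M x y)"
definition times_fmat :: "('a, 'b) fmat \<Rightarrow> ('a, 'b) fmat \<Rightarrow> ('a, 'b) fmat" where
  "times_fmat M N = Fmat (\<lambda>x y. \<Sum>z\<in>fsupp M. ent M x z * ent N z y)"
definition csc_fmat :: "complex \<Rightarrow> ('a, 'b) fmat \<Rightarrow> ('a, 'b) fmat" where
  "csc_fmat c M = Fmat (\<lambda>x y. csc c (ent M x y))"

lemma ent_zero: "ent (0 :: ('a, 'b) fmat) x y = 0"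
  unfolding zero_fmat_def by (subst ent_Fmat[of "{}"]) auto

lemma ent_add: "ent (M + N) x y = ent M x y + ent (N :: ('a, 'b) fmat) x y"
  unfolding plus_fmat_def
  by (subst ent_Fmat[of "fsupp M \<union> fsupp N"]) (auto simp: ent_zero_outside)

lemma ent_diff: "ent (M - N) x y = ent M x y - ent (N :: ('a, 'b) fmat) x y"
  unfolding minus_fmat_def
  by (subst ent_Fmat[of "fsupp M \<union> fsupp N"]) (auto simp: ent_zero_outside)

lemma ent_uminus: "ent (- M) x y = - ent (M :: ('a, 'b) fmat) x y"
  unfolding uminus_fmat_def
  by (subst ent_Fmat[of "fsupp M"]) (auto simp: ent_zero_outside)

lemma ent_csc: "ent (csc c M) x y = csc c (ent (M :: ('a, 'b) fmat) x y)"
  unfolding csc_fmat_def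
  by (subst ent_Fmat[of "fsupp M"]) (auto simp: ent_zero_outside)

lemma ent_mult0: "ent (M * N) x y = (\<Sum>z\<in>fsupp M. ent M x z * ent (N :: ('a, 'b) fmat) z y)"
  unfolding times_fmat_def
proof (subst ent_Fmat[of "fsupp M \<union> fsupp N"])
  fix x y assume "x \<notin> fsupp M \<union> fsupp N \<or> y \<notin> fsupp M \<union> fsupp N"
  then show "(\<Sum>z\<in>fsupp M. ent M x z * ent N z y) = 0"
    by (intro sum.neutral) (auto simp: ent_zero_outside)
qed auto

text \<open>The set S has to contain the support of one factor, since a term vanishes as soon as one
  of its two entries does.\<close>

lemma ent_mult:
  fixes M N :: "('a, 'b) fmat"
  assumes "finite S" "fsupp M \<subseteq> S \<or> fsupp N \<subseteq> S"
  shows "ent (M * N) x y = (\<Sum>z\<in>S. ent M x z * ent N z y)"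
proof -
  have "ent (M * N) x y = (\<Sum>z\<in>S \<union> fsupp M. ent M x z * ent N z y)"
    unfolding ent_mult0 using assms by (intro sum.mono_neutral_left) (auto simp: ent_zero_outside)
  also have "\<dots> = (\<Sum>z\<in>S. ent M x z * ent N z y)"
  proof (intro sum.mono_neutral_right ballI)
    fix z assume "z \<in> S \<union> fsupp M - S"
    then have "z \<notin> fsupp M \<or> z \<notin> fsupp N" using assms by blast
    then show "ent M x z * ent N z y = 0" by (auto simp: ent_zero_outside)
  qed (use assms in auto)
  finally show ?thesis .
qed

instance
proof
  fix a b c :: "('a, 'b) fmat" and r s :: complex
  show "a * b * c = a * (b * c)"
  proof (rule ent_eqI)
    fix x y
    let ?A = "fsupp a" and ?B = "fsupp b"
    have ab: "fsupp (a * b) \<subseteq> ?A \<union> ?B"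
      by (rule fsupp_subset) (auto simp: ent_mult0 ent_zero_outside intro!: sum.neutral)
    have "ent (a * b * c) x y = (\<Sum>z\<in>?A \<union> ?B. \<Sum>w\<in>?A \<union> ?B. ent a x w * ent b w z * ent c z y)"
      using ab by (simp add: ent_mult[of "?A \<union> ?B"] sum_distrib_right)
    also have "\<dots> = (\<Sum>w\<in>?A \<union> ?B. \<Sum>z\<in>?A \<union> ?B. ent a x w * ent b w z * ent c z y)"
      by (rule sum.swap)
    also have "\<dots> = ent (a * (b * c)) x y"
      by (simp add: ent_mult[of "?A \<union> ?B"] sum_distrib_left mult.assoc)
    finally show "ent (a * b * c) x y = ent (a * (b * c)) x y" .
  qed
  show "(a + b) * c = a * c + b * c"
    by (rule ent_eqI) (simp add: ent_mult[of "fsupp c"] ent_add distrib_right sum.distrib)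
  show "a * (b + c) = a * b + a * c"
    by (rule ent_eqI) (simp add: ent_mult0 ent_add distrib_left sum.distrib)
  show "csc r a * b = csc r (a * b)"
    by (rule ent_eqI) (simp add: ent_mult[of "fsupp b"] ent_csc csc_mult_left csc_sum_right)
  show "a * csc r b = csc r (a * b)"
    by (rule ent_eqI) (simp add: ent_mult[of "fsupp a"] ent_csc csc_mult_right csc_sum_right)
qed (auto intro!: ent_eqI
    simp: ent_add ent_zero ent_diff ent_uminus ent_csc csc_add_right csc_add_left csc_csc csc_one)

end

lemma ent_sum: "ent (\<Sum>i\<in>I. f i) x y = (\<Sum>i\<in>I. ent (f i :: ('a, 'b::calg) fmat) x y)"
  by (induction I rule: infinite_finite_induct) (auto simp: ent_add ent_zero)

definition ftrace :: "('i, 'k::calg) fmat \<Rightarrow> 'k" where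
  "ftrace M = (\<Sum>x\<in>fsupp M. ent M x x)"

lemma ftrace_superset: "finite S \<Longrightarrow> fsupp M \<subseteq> S \<Longrightarrow> ftrace M = (\<Sum>x\<in>S. ent M x x)"
  unfolding ftrace_def by (rule sum.mono_neutral_left) (auto simp: ent_zero_outside)

lemma ftrace_zero [simp]: "ftrace 0 = 0"
  by (simp add: ftrace_def ent_zero)

lemma ftrace_add: "ftrace (M + N) = ftrace M + ftrace N"
proof -
  let ?S = "fsupp M \<union> fsupp N \<union> fsupp (M + N)"
  show ?thesis
    by (simp add: ftrace_superset[of ?S] ent_add sum.distrib le_supI1 le_supI2)
qed

lemma ftrace_sum: "ftrace (\<Sum>i\<in>I. f i) = (\<Sum>i\<in>I. ftrace (f i))"
  by (induction I rule: infinite_finite_induct) (auto simp: ftrace_add)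

lemma ftrace_csc: "ftrace (csc c M) = csc c (ftrace M)"
proof -
  let ?S = "fsupp M \<union> fsupp (csc c M)"
  show ?thesis
    by (simp add: ftrace_superset[of ?S] ent_csc csc_sum_right)
qed

lemma ftrace_comm:
  fixes M N :: "('i, 'k::{calg, comm_ring}) fmat"
  shows "ftrace (M * N) = ftrace (N * M)"
proof -
  let ?S = "fsupp M \<union> fsupp N \<union> fsupp (M * N) \<union> fsupp (N * M)"
  have "ftrace (M * N) = (\<Sum>x\<in>?S. \<Sum>z\<in>?S. ent M x z * ent N z x)"
    by (subst ftrace_superset[of ?S]) (auto intro!: sum.cong ent_mult)
  also have "\<dots> = (\<Sum>z\<in>?S. \<Sum>x\<in>?S. ent N z x * ent M x z)"
    by (subst sum.swap) (simp add: mult.commute)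
  also have "\<dots> = ftrace (N * M)"
    by (subst ftrace_superset[of ?S]) (auto intro!: sum.cong ent_mult[symmetric])
  finally show ?thesis .
qed

definition fmap :: "('k::zero \<Rightarrow> 'l::zero) \<Rightarrow> ('i, 'k) fmat \<Rightarrow> ('i, 'l) fmat" where
  "fmap h M = Fmat (\<lambda>x y. h (ent M x y))"

lemma ent_fmap:
  assumes "h 0 = 0"
  shows "ent (fmap h M) x y = h (ent M x y)"
  unfolding fmap_def
  by (subst ent_Fmat[of "fsupp M"]) (auto simp: ent_zero_outside assms)

lemma calg_hom_fmap:
  assumes "calg_hom h"
  shows "calg_hom (fmap h :: ('i, 'k::calg) fmat \<Rightarrow> ('i, 'l::calg) fmat)"
proof -
  note [simp] = ent_fmap[of h, OF hom_zero[OF assms]]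
  have s: "fsupp (fmap h M) \<subseteq> fsupp M" for M :: "('i, 'k::calg) fmat"
    by (rule fsupp_subset) (auto simp: ent_zero_outside hom_zero[OF assms])
  show ?thesis
  proof (rule calg_homI; rule ent_eqI)
    fix M N :: "('i, 'k::calg) fmat" and x y
    show "ent (fmap h (M * N)) x y = ent (fmap h M * fmap h N) x y"
      by (simp add: ent_mult[OF finite_fsupp disjI1[OF s], of M] ent_mult0[of M] hom_sum[OF assms]
          hom_mult[OF assms])
  qed (auto simp: ent_add ent_csc hom_add[OF assms] hom_csc[OF assms])
qed

definition funit :: "'i set \<Rightarrow> ('i, 'k::zero_neq_one) fmat" where
  "funit S = Fmat (\<lambda>x y. if x = y \<and> x \<in> S then 1 else 0)"

definition felem :: "'i \<Rightarrow> 'i \<Rightarrow> ('i, 'k::zero_neq_one) fmat" where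
  "felem p q = Fmat (\<lambda>x y. if x = p \<and> y = q then 1 else 0)"

lemma ent_funit: "finite S \<Longrightarrow> ent (funit S) x y = (if x = y \<and> x \<in> S then 1 else 0)"
  unfolding funit_def by (subst ent_Fmat[of S]) auto

lemma ent_felem: "ent (felem p q) x y = (if x = p \<and> y = q then 1 else 0)"
  unfolding felem_def by (subst ent_Fmat[of "{p, q}"]) auto

lemma fsupp_funit: "finite S \<Longrightarrow> fsupp (funit S) \<subseteq> S"
  by (rule fsupp_subset) (auto simp: ent_funit)

lemma ent_funit_mult:
  fixes M :: "('i, 'k::{calg, ring_1}) fmat"
  assumes "finite S"
  shows "ent (funit S * M) x y = (if x \<in> S then ent M x y else 0)"
  using assms by (simp add: ent_mult[OF assms disjI1[OF fsupp_funit]] ent_funit if_distrib if_distribR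
      cong: if_cong)

lemma ent_mult_funit:
  fixes M :: "('i, 'k::{calg, ring_1}) fmat"
  assumes "finite S"
  shows "ent (M * funit S) x y = (if y \<in> S then ent M x y else 0)"
proof -
  have "ent (M * funit S) x y = (\<Sum>z\<in>S. if z = y then ent M x z else 0)"
    by (subst ent_mult[OF assms disjI2[OF fsupp_funit[OF assms]]])
      (rule sum.cong; simp add: assms ent_funit)
  then show ?thesis using assms by simp
qed

text \<open>Nondegeneracy of the trace pairing: pairing with the matrix units recovers every entry.
  A derivative known only through its pairings is identified in this way.\<close>

lemma ftrace_felem:
  fixes M :: "('i, 'k::{calg, comm_ring_1}) fmat"
  shows "ftrace (M * felem p q) = ent M q p"
proof -
  have "ent (M * felem p q) x y = (if y = q then ent M x p else 0)" for x y
    by (cases "p = q"; subst ent_mult[of "{p, q}"]) (auto simp: ent_felem intro!: fsupp_subset)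
  moreover from this have "fsupp (M * felem p q) \<subseteq> insert q (fsupp M)"
    by (intro fsupp_subset) (auto simp: ent_zero_outside)
  ultimately show ?thesis
    by (subst ftrace_superset[of "insert q (fsupp M)"]) (auto simp: ent_zero_outside)
qed

text \<open>\<open>Tri a b c d\<close> is the upper triangular matrix with rows \<open>a b d\<close>, \<open>0 a c\<close>, \<open>0 0 a\<close>.  Evaluating
  at \<open>Tri (X a) (d1 a) (d2 a) 0\<close> yields the first derivatives in the directions \<open>d1\<close> and \<open>d2\<close>, and in
  the corner the mixed second-order term.\<close>

datatype 'r tri = Tri (td: 'r) (t1: 'r) (t2: 'r) (t12: 'r)

instantiation tri :: (calg) calg
begin
definition zero_tri :: "'a tri" where "0 = Tri 0 0 0 0"
definition plus_tri :: "'a tri \<Rightarrow> 'a tri \<Rightarrow> 'a tri" where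
  "x + y = Tri (td x + td y) (t1 x + t1 y) (t2 x + t2 y) (t12 x + t12 y)"
definition minus_tri :: "'a tri \<Rightarrow> 'a tri \<Rightarrow> 'a tri" where
  "x - y = Tri (td x - td y) (t1 x - t1 y) (t2 x - t2 y) (t12 x - t12 y)"
definition uminus_tri :: "'a tri \<Rightarrow> 'a tri" where
  "- x = Tri (- td x) (- t1 x) (- t2 x) (- t12 x)"
definition times_tri :: "'a tri \<Rightarrow> 'a tri \<Rightarrow> 'a tri" where
  "x * y = Tri (td x * td y) (td x * t1 y + t1 x * td y) (td x * t2 y + t2 x * td y)
     (td x * t12 y + t1 x * t2 y + t12 x * td y)"
definition csc_tri :: "complex \<Rightarrow> 'a tri \<Rightarrow> 'a tri" where
  "csc c x = Tri (csc c (td x)) (csc c (t1 x)) (csc c (t2 x)) (csc c (t12 x))"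
instance
  by standard
    (auto simp: zero_tri_def plus_tri_def minus_tri_def uminus_tri_def times_tri_def csc_tri_def
      algebra_simps csc_add_right csc_add_left csc_csc csc_mult_left csc_mult_right csc_one)
end

section \<open>Evaluating the path algebra in an algebra\<close>

text \<open>The defining relations of the path algebra on its generators, so such data amount to a
  homomorphism into the algebra, except that the sum of the idempotents need not be a unit. What is
  needed about an automorphism is read off from evaluations of this kind.\<close>

definition arep :: "('v, 'a) pre_digraph \<Rightarrow> ('v \<Rightarrow> 'r::calg) \<Rightarrow> ('a \<Rightarrow> 'r) \<Rightarrow> bool" where
  "arep G e X \<longleftrightarrow> (\<forall>u\<in>verts G. \<forall>v\<in>verts G. e u * e v = (if u = v then e u else 0)) \<and>
     (\<forall>a\<in>arcs G. e (head G a) * X a = X a \<and> X a * e (tail G a) = X a)"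

definition path_ev :: "('v \<Rightarrow> 'r::calg) \<Rightarrow> ('a \<Rightarrow> 'r) \<Rightarrow> ('v, 'a) path \<Rightarrow> 'r" where
  "path_ev e X p = fold (\<lambda>a r. X a * r) (snd p) (e (fst p))"

definition ev :: "('v \<Rightarrow> 'r::calg) \<Rightarrow> ('a \<Rightarrow> 'r) \<Rightarrow> (('v, 'a) path \<Rightarrow>\<^sub>0 complex) \<Rightarrow> 'r" where
  "ev e X x = (\<Sum>p\<in>Poly_Mapping.keys x. csc (Poly_Mapping.lookup x p) (path_ev e X p))"

lemma path_ev_Nil [simp]: "path_ev e X (u, []) = e u"
  and path_ev_snoc: "path_ev e X (u, p @ [a]) = X a * path_ev e X (u, p)"
  by (simp_all add: path_ev_def)

lemma ev_superset:
  assumes "finite A" "Poly_Mapping.keys x \<subseteq> A"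
  shows "ev e X x = (\<Sum>p\<in>A. csc (Poly_Mapping.lookup x p) (path_ev e X p))"
  unfolding ev_def by (rule sum.mono_neutral_left) (use assms in \<open>auto simp: in_keys_iff\<close>)

lemma ev_zero [simp]: "ev e X 0 = 0"
  by (simp add: ev_def)

lemma ev_add: "ev e X (x + y) = ev e X x + ev e X y"
proof -
  let ?A = "Poly_Mapping.keys x \<union> Poly_Mapping.keys y \<union> Poly_Mapping.keys (x + y)"
  show ?thesis
    by (simp add: ev_superset[of ?A] le_supI1 le_supI2 lookup_add csc_add_left sum.distrib)
qed

lemma ev_sum: "ev e X (\<Sum>i\<in>I. f i) = (\<Sum>i\<in>I. ev e X (f i))"
  by (induction I rule: infinite_finite_induct) (auto simp: ev_add)

lemma ev_uminus: "ev e X (- x) = - ev e X x"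
  using ev_add[of e X x "- x"] by (simp add: eq_neg_iff_add_eq_0 add.commute)

lemma ev_diff: "ev e X (x - y) = ev e X x - ev e X y"
  using ev_add[of e X x "- y"] by (simp add: ev_uminus)

lemma ev_single: "ev e X (Poly_Mapping.single p c) = csc c (path_ev e X p)"
  by (subst ev_superset[of "{p}"]) auto

lemma ev_idem [simp]: "ev e X (idem_elt v) = e v"
  by (simp add: idem_elt_def ev_single csc_one)

text \<open>Naturality of evaluation. Specialising a polynomial family at a point, taking its
  first-order jet and forgetting a tangent direction are all homomorphisms, so each can be moved
  through the formula of an automorphism without knowing that formula.\<close>

lemma hom_ev:
  assumes "calg_hom h"
  shows "h (ev e X x) = ev (h \<circ> e) (h \<circ> X) x"
proof -
  have "h (path_ev e X (u, p)) = path_ev (h \<circ> e) (h \<circ> X) (u, p)" for u p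
    by (induction p rule: rev_induct) (simp_all add: path_ev_snoc hom_mult[OF assms])
  then have "h (path_ev e X p) = path_ev (h \<circ> e) (h \<circ> X) p" for p
    by (cases p) auto
  then show ?thesis
    by (simp add: ev_def hom_sum[OF assms] hom_csc[OF assms])
qed

lemma arep_hom:
  assumes "calg_hom h" "arep G e X"
  shows "arep G (h \<circ> e) (h \<circ> X)"
  using assms(2) unfolding arep_def
  by (auto simp: hom_mult[OF assms(1), symmetric] hom_zero[OF assms(1)])

lemma pa_in_carrier: "x \<in> carrier (path_algebra G) \<longleftrightarrow> Poly_Mapping.keys x \<subseteq> paths G"
  by (simp add: path_algebra_def)

context wf_digraph
begin

lemma paths_Nil_iff: "(u, []) \<in> paths G \<longleftrightarrow> u \<in> verts G"
  by (auto simp: paths_def awalk_Nil_iff)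

lemma path_end_Nil [simp]: "path_end G (u, []) = u"
  by (simp add: path_end_def)

lemma path_end_snoc [simp]: "path_end G (u, p @ [a]) = head G a"
  by (subst path_end_append[of G u p, OF refl]) (simp add: path_end_def)

lemma paths_snoc_iff:
  "(u, p @ [a]) \<in> paths G \<longleftrightarrow> (u, p) \<in> paths G \<and> a \<in> arcs G \<and> path_end G (u, p) = tail G a"
proof -
  have "awalk (path_end G (u, p)) [a] v \<longleftrightarrow> a \<in> arcs G \<and> path_end G (u, p) = tail G a \<and> v = head G a" for v
    by (auto simp: awalk_simps)
  then show ?thesis
    unfolding paths_iff[OF wf_digraph_axioms] path_end_snoc
    by (simp add: path_end_def awalk_append_iff)
qed

lemma path_induct [consumes 1, case_names Nil snoc]:
  assumes "p \<in> paths G"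
    and "\<And>u. u \<in> verts G \<Longrightarrow> P (u, [])"
    and "\<And>u p a. (u, p) \<in> paths G \<Longrightarrow> a \<in> arcs G \<Longrightarrow> path_end G (u, p) = tail G a \<Longrightarrow>
      P (u, p) \<Longrightarrow> P (u, p @ [a])"
  shows "P p"
proof -
  have "(u, q) \<in> paths G \<Longrightarrow> P (u, q)" for u q
    by (induction q rule: rev_induct) (auto simp: paths_Nil_iff paths_snoc_iff intro: assms)
  then show ?thesis
    using assms(1) by (cases p) auto
qed

lemma path_end_in_verts: "p \<in> paths G \<Longrightarrow> path_end G p \<in> verts G"
  by (induction rule: path_induct) auto

lemma path_start_in_verts: "p \<in> paths G \<Longrightarrow> fst p \<in> verts G"
  by (induction rule: path_induct) auto

lemma idem_in_carrier: "v \<in> verts G \<Longrightarrow> idem_elt v \<in> carrier (path_algebra G)"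
  by (auto simp: pa_in_carrier idem_elt_def paths_Nil_iff)

lemma arrow_in_carrier: "a \<in> arcs G \<Longrightarrow> arrow_elt G a \<in> carrier (path_algebra G)"
  using paths_snoc_iff[of "tail G a" "[]" a] by (auto simp: pa_in_carrier arrow_elt_def paths_Nil_iff)

lemma vertex_comb_in_carrier: "vertex_comb G c \<in> carrier (path_algebra G)"
  unfolding pa_in_carrier vertex_comb_def
  by (rule keys_sum_subset) (auto simp: paths_Nil_iff)

lemma pa_mult_in_carrier:
  assumes "x \<in> carrier (path_algebra G)" "y \<in> carrier (path_algebra G)"
  shows "pa_mult G x y \<in> carrier (path_algebra G)"
  using assms paths_append[OF wf_digraph_axioms]
  unfolding pa_in_carrier pa_mult_def
  by (intro keys_sum_subset) (auto simp: path_mult_def split: if_splits dest!: subsetD)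

lemma add_in_carrier:
  "x \<in> carrier (path_algebra G) \<Longrightarrow> y \<in> carrier (path_algebra G) \<Longrightarrow> x + y \<in> carrier (path_algebra G)"
  using keys_add[of x y] by (auto simp: pa_in_carrier)

lemma single_in_carrier: "p \<in> paths G \<Longrightarrow> Poly_Mapping.single p c \<in> carrier (path_algebra G)"
  by (auto simp: pa_in_carrier)

lemma sum_in_carrier:
  "(\<And>i. i \<in> I \<Longrightarrow> f i \<in> carrier (path_algebra G)) \<Longrightarrow> (\<Sum>i\<in>I. f i) \<in> carrier (path_algebra G)"
  unfolding pa_in_carrier by (rule keys_sum_subset)

lemma carrier_induct [consumes 1, case_names single add]:
  assumes "x \<in> carrier (path_algebra G)"
    and "\<And>p c. p \<in> paths G \<Longrightarrow> P (Poly_Mapping.single p c)"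
    and "\<And>x y. x \<in> carrier (path_algebra G) \<Longrightarrow> y \<in> carrier (path_algebra G) \<Longrightarrow>
      P x \<Longrightarrow> P y \<Longrightarrow> P (x + y)"
    and "P 0"
  shows "P x"
proof -
  have "S \<subseteq> paths G \<Longrightarrow> finite S \<Longrightarrow> P (\<Sum>p\<in>S. Poly_Mapping.single p (f p))" for S f
    by (rotate_tac, induction S rule: finite_induct)
      (auto intro!: assms(2-) sum_in_carrier single_in_carrier)
  from this[of "Poly_Mapping.keys x" "Poly_Mapping.lookup x"] show ?thesis
    using assms(1) by (simp add: pa_in_carrier flip: sum_singles)
qed

text \<open>Constant combinations of the trivial paths are the scalars of the path algebra. An
  endomorphism that fixes them is therefore linear, which \<open>endo_map\<close> extracts.\<close>

lemma pa_mult_scalar: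
  assumes "x \<in> carrier (path_algebra G)" "finite (verts G)"
  shows "pa_mult G (vertex_comb G (\<lambda>_. c)) x = Poly_Mapping.map ((*) c) x"
proof (rule carrier_induct[OF assms(1)])
  fix p d assume "p \<in> paths G"
  then show "pa_mult G (vertex_comb G (\<lambda>_. c)) (Poly_Mapping.single p d) =
      Poly_Mapping.map ((*) c) (Poly_Mapping.single p d)"
    using path_end_in_verts[of p] assms(2)
    by (simp add: vertex_comb_def pa_mult_sum_left pa_mult_single path_mult_def map_single)
next
  fix x y :: "('a, 'b) path \<Rightarrow>\<^sub>0 complex"
  have "Poly_Mapping.map ((*) c) (x + y) = Poly_Mapping.map ((*) c) x + Poly_Mapping.map ((*) c) y"
    by (rule poly_mapping_eqI) (simp add: map.rep_eq lookup_add when_def flip: distrib_left)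
  then show "pa_mult G (vertex_comb G (\<lambda>_. c)) x = Poly_Mapping.map ((*) c) x \<Longrightarrow>
    pa_mult G (vertex_comb G (\<lambda>_. c)) y = Poly_Mapping.map ((*) c) y \<Longrightarrow>
    pa_mult G (vertex_comb G (\<lambda>_. c)) (x + y) = Poly_Mapping.map ((*) c) (x + y)"
    by (simp add: pa_mult_add_right)
qed (auto intro!: poly_mapping_eqI simp: map.rep_eq when_def)

lemma single_snoc:
  assumes "(u, p @ [a]) \<in> paths G"
  shows "Poly_Mapping.single (u, p @ [a]) 1 =
    pa_mult G (arrow_elt G a) (Poly_Mapping.single (u, p) 1)"
  using assms by (simp add: paths_snoc_iff arrow_elt_def pa_mult_single path_mult_def)

lemma arrow_idem:
  assumes "a \<in> arcs G"
  shows "pa_mult G (idem_elt (head G a)) (arrow_elt G a) = arrow_elt G a"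
    and "pa_mult G (arrow_elt G a) (idem_elt (tail G a)) = arrow_elt G a"
  using assms path_end_snoc[of "tail G a" "[]" a]
  by (simp_all add: idem_elt_def arrow_elt_def pa_mult_single path_mult_def)

context
  fixes e :: "'a \<Rightarrow> 'r::calg" and X :: "'b \<Rightarrow> 'r"
  assumes rep: "arep G e X"
begin

lemma arep_idem: "u \<in> verts G \<Longrightarrow> v \<in> verts G \<Longrightarrow> e u * e v = (if u = v then e u else 0)"
  and arep_head: "a \<in> arcs G \<Longrightarrow> e (head G a) * X a = X a"
  and arep_tail: "a \<in> arcs G \<Longrightarrow> X a * e (tail G a) = X a"
  using rep by (auto simp: arep_def)

lemma path_ev_end: "p \<in> paths G \<Longrightarrow> e (path_end G p) * path_ev e X p = path_ev e X p"
  by (induction rule: path_induct) (auto simp: arep_idem path_ev_snoc arep_head simp flip: mult.assoc)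

text \<open>For paths that do not compose, the idempotents of two distinct vertices meet and their
  product vanishes.\<close>

lemma path_ev_mult:
  assumes "p \<in> paths G" "q \<in> paths G"
  shows "path_ev e X p * path_ev e X q =
    (if path_end G q = fst p then path_ev e X (fst q, snd q @ snd p) else 0)"
  using assms(1)
proof (induction rule: path_induct)
  case (Nil u)
  have "path_ev e X (u, []) * path_ev e X q = e u * e (path_end G q) * path_ev e X q"
    using path_ev_end[OF assms(2)] by (simp add: mult.assoc)
  also have "\<dots> = (if u = path_end G q then e (path_end G q) * path_ev e X q else 0)"
    by (simp add: arep_idem[OF Nil path_end_in_verts[OF assms(2)]])
  finally show ?case
    by (simp only: path_ev_end[OF assms(2)] fst_conv snd_conv append_Nil2 prod.collapse eq_commute[of u])
next
  case (snoc u p a)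
  then show ?case
    using path_ev_snoc[of e X "fst q" "snd q @ p" a] by (simp add: path_ev_snoc mult.assoc)
qed

lemma ev_mult:
  assumes "x \<in> carrier (path_algebra G)" "y \<in> carrier (path_algebra G)"
  shows "ev e X (pa_mult G x y) = ev e X x * ev e X y"
proof -
  have 1: "ev e X (path_mult G p q (c * d)) = csc c (path_ev e X p) * csc d (path_ev e X q)"
    if "p \<in> paths G" "q \<in> paths G" for p q c d
    using path_ev_mult[OF that]
    by (auto simp: path_mult_def ev_single csc_mult_left csc_mult_right csc_csc mult.commute)
  have "ev e X (pa_mult G x y) = (\<Sum>p\<in>Poly_Mapping.keys x. \<Sum>q\<in>Poly_Mapping.keys y.
     csc (Poly_Mapping.lookup x p) (path_ev e X p) * csc (Poly_Mapping.lookup y q) (path_ev e X q))"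
    unfolding pa_mult_def ev_sum
    by (intro sum.cong refl 1) (use assms in \<open>auto simp: pa_in_carrier\<close>)
  then show ?thesis
    by (simp add: ev_def sum_product)
qed

lemma ev_arrow: "a \<in> arcs G \<Longrightarrow> ev e X (arrow_elt G a) = X a"
  by (simp add: arrow_elt_def ev_single csc_one path_ev_def arep_tail)

lemma ev_map: "ev e X (Poly_Mapping.map ((*) c) x) = csc c (ev e X x)"
proof (cases "c = 0")
  case True
  then have "Poly_Mapping.map ((*) c) x = 0"
    by (intro poly_mapping_eqI) (simp add: map.rep_eq when_def)
  then show ?thesis using True by simp
next
  case False
  have "ev e X (Poly_Mapping.map ((*) c) x) = (\<Sum>p\<in>Poly_Mapping.keys x.
      csc (Poly_Mapping.lookup (Poly_Mapping.map ((*) c) x) p) (path_ev e X p))"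
    using False by (intro ev_superset) (auto simp: in_keys_iff map.rep_eq when_def split: if_splits)
  also have "\<dots> = csc c (ev e X x)"
    unfolding ev_def csc_sum_right csc_csc
    by (rule sum.cong) (auto simp: map.rep_eq when_def in_keys_iff)
  finally show ?thesis .
qed

end

text \<open>A morphism of representations is an element T of the ambient algebra that intertwines
  the idempotents and the arrow values; by induction along paths it then intertwines the whole path
  algebra.\<close>

lemma ev_intertwine:
  assumes "x \<in> carrier (path_algebra G)"
    and "\<And>v. v \<in> verts G \<Longrightarrow> T * e v = e' v * T"
    and "\<And>a. a \<in> arcs G \<Longrightarrow> T * X a = X' a * T"
  shows "T * ev e X x = ev e' X' x * (T :: 'r::calg)"
proof (rule carrier_induct[OF assms(1)])
  fix p c assume "p \<in> paths G"
  then have "T * path_ev e X p = path_ev e' X' p * T"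
  proof (induction rule: path_induct)
    case (snoc u p a)
    have "T * (X a * path_ev e X (u, p)) = X' a * (T * path_ev e X (u, p))"
      by (simp add: assms(3)[OF snoc(2)] flip: mult.assoc)
    then show ?case
      using snoc by (simp add: path_ev_snoc mult.assoc)
  qed (simp add: assms)
  then show "T * ev e X (Poly_Mapping.single p c) = ev e' X' (Poly_Mapping.single p c) * T"
    by (simp add: ev_single csc_mult_left csc_mult_right)
qed (auto simp: ev_add distrib_left distrib_right)

definition path_endo :: "((('a, 'b) path \<Rightarrow>\<^sub>0 complex) \<Rightarrow> (('a, 'b) path \<Rightarrow>\<^sub>0 complex)) \<Rightarrow> bool" where
  "path_endo \<rho> \<longleftrightarrow>
     (\<forall>x\<in>carrier (path_algebra G). \<rho> x \<in> carrier (path_algebra G)) \<and>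
     (\<forall>x\<in>carrier (path_algebra G). \<forall>y\<in>carrier (path_algebra G).
        \<rho> (x + y) = \<rho> x + \<rho> y \<and> \<rho> (pa_mult G x y) = pa_mult G (\<rho> x) (\<rho> y)) \<and>
     (\<forall>c. \<rho> (vertex_comb G c) = vertex_comb G c)"

context
  fixes \<rho> :: "(('a, 'b) path \<Rightarrow>\<^sub>0 complex) \<Rightarrow> (('a, 'b) path \<Rightarrow>\<^sub>0 complex)"
  assumes \<rho>: "path_endo \<rho>" and fin: "finite (verts G)"
begin

lemma endo_carrier: "x \<in> carrier (path_algebra G) \<Longrightarrow> \<rho> x \<in> carrier (path_algebra G)"
  and endo_add: "x \<in> carrier (path_algebra G) \<Longrightarrow> y \<in> carrier (path_algebra G) \<Longrightarrow>
    \<rho> (x + y) = \<rho> x + \<rho> y"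
  and endo_mult: "x \<in> carrier (path_algebra G) \<Longrightarrow> y \<in> carrier (path_algebra G) \<Longrightarrow>
    \<rho> (pa_mult G x y) = pa_mult G (\<rho> x) (\<rho> y)"
  and endo_vertex_comb: "\<rho> (vertex_comb G c) = vertex_comb G c"
  using \<rho> by (auto simp: path_endo_def)

lemma endo_zero: "\<rho> 0 = 0"
  using endo_vertex_comb[of "\<lambda>_. 0"] by (simp add: vertex_comb_def)

lemma endo_idem: "v \<in> verts G \<Longrightarrow> \<rho> (idem_elt v) = idem_elt v"
proof -
  assume "v \<in> verts G"
  then have "idem_elt v = vertex_comb G (\<lambda>u. if u = v then 1 else 0)"
    using fin by (simp add: idem_elt_def vertex_comb_def if_distrib cong: if_cong)
  then show ?thesis by (simp add: endo_vertex_comb)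
qed

lemma endo_map: "x \<in> carrier (path_algebra G) \<Longrightarrow>
    \<rho> (Poly_Mapping.map ((*) c) x) = Poly_Mapping.map ((*) c) (\<rho> x)"
  using endo_mult[OF vertex_comb_in_carrier, of x "\<lambda>_. c"] endo_carrier[of x]
  by (simp add: pa_mult_scalar fin endo_vertex_comb)

lemma arep_endo:
  assumes "arep G e X"
  shows "arep G e (\<lambda>a. ev e X (\<rho> (arrow_elt G a)))"
  unfolding arep_def
proof (intro conjI ballI)
  fix a assume a: "a \<in> arcs G"
  then have c: "arrow_elt G a \<in> carrier (path_algebra G)"
    "idem_elt (head G a) \<in> carrier (path_algebra G)" "idem_elt (tail G a) \<in> carrier (path_algebra G)"
    by (auto intro: arrow_in_carrier idem_in_carrier)
  show "e (head G a) * ev e X (\<rho> (arrow_elt G a)) = ev e X (\<rho> (arrow_elt G a))"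
    using ev_mult[OF assms c(2) endo_carrier[OF c(1)]] endo_mult[OF c(2,1)] a
    by (simp add: endo_idem arrow_idem)
  show "ev e X (\<rho> (arrow_elt G a)) * e (tail G a) = ev e X (\<rho> (arrow_elt G a))"
    using ev_mult[OF assms endo_carrier[OF c(1)] c(3)] endo_mult[OF c(1,3)] a
    by (simp add: endo_idem arrow_idem)
qed (use arep_idem[OF assms] in auto)

text \<open>Precomposing a representation with \<rho> changes only the arrow values. A twisted
  representation is thus again an evaluation and can be twisted once more; twisting with the inverse
  automorphism returns the original arrows.\<close>

lemma ev_endo:
  assumes "arep G e X" "x \<in> carrier (path_algebra G)"
  shows "ev e X (\<rho> x) = ev e (\<lambda>a. ev e X (\<rho> (arrow_elt G a))) x"
    (is "_ = ev e ?Y x")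
proof (rule carrier_induct[OF assms(2)])
  fix p and c :: complex
  assume p: "p \<in> paths G"
  then have 1: "ev e X (\<rho> (Poly_Mapping.single p 1)) = path_ev e ?Y p"
  proof (induction rule: path_induct)
    case (Nil u)
    then show ?case
      using endo_idem[OF Nil] ev_idem[of e X u] by (simp add: idem_elt_def)
  next
    case (snoc u p a)
    then show ?case
      by (subst single_snoc)
        (auto simp: paths_snoc_iff endo_mult arrow_in_carrier single_in_carrier
          ev_mult[OF assms(1)] endo_carrier path_ev_snoc)
  qed
  have "\<rho> (Poly_Mapping.single p c) = Poly_Mapping.map ((*) c) (\<rho> (Poly_Mapping.single p 1))"
    using endo_map[OF single_in_carrier[OF p], of c 1] by (simp add: map_single)
  then show "ev e X (\<rho> (Poly_Mapping.single p c)) = ev e ?Y (Poly_Mapping.single p c)"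
    by (simp add: ev_map[OF assms(1)] 1 ev_single)
qed (simp_all add: endo_add endo_zero ev_add)

end

end

section \<open>Polynomial families of invertible matrices\<close>

lemma pderiv_sum: "pderiv (\<Sum>i\<in>I. f i) = (\<Sum>i\<in>I. pderiv (f i))"
  by (induction I rule: infinite_finite_induct) (simp_all add: pderiv_add)

text \<open>The Leibniz formula to first order. Differentiation affects one factor, while a
  permutation other than the identity moves at least two points, so an off-diagonal entry of the
  identity matrix survives and only the diagonal product contributes.\<close>

lemma pderiv_det_at_identity:
  fixes C :: "complex poly mat"
  assumes C: "C \<in> carrier_mat n n"
    and C0: "\<And>i j. i < n \<Longrightarrow> j < n \<Longrightarrow> poly (C $$ (i, j)) 0 = (if i = j then 1 else 0)"
  shows "poly (pderiv (det C)) 0 = (\<Sum>i<n. poly (pderiv (C $$ (i, i))) 0)"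
proof -
  let ?P = "{p. p permutes {0..<n}}"
  have "poly (pderiv (signof p * (\<Prod>i=0..<n. C $$ (i, p i)))) 0 =
      (if p = id then (\<Sum>i<n. poly (pderiv (C $$ (i, i))) 0) else 0)"
    if p: "p permutes {0..<n}" for p
  proof -
    have pn: "i < n \<Longrightarrow> p i < n" for i
      using permutes_in_image[OF p, of i] by simp
    have s: "pderiv (signof p :: complex poly) = 0"
      by (simp add: sign_def pderiv_minus)
    have "poly (pderiv (signof p * (\<Prod>i=0..<n. C $$ (i, p i)))) 0 =
        poly (signof p) 0 * (\<Sum>a=0..<n. (\<Prod>i\<in>{0..<n} - {a}. poly (C $$ (i, p i)) 0) *
          poly (pderiv (C $$ (a, p a))) 0)"
      by (simp add: pderiv_mult s pderiv_prod poly_sum poly_prod)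
    also have "\<dots> = (if p = id then (\<Sum>i<n. poly (pderiv (C $$ (i, i))) 0) else 0)"
    proof (cases "p = id")
      case True
      have "(\<Prod>i\<in>{0..<n} - {a}. poly (C $$ (i, p i)) 0) = 1" for a
        by (rule prod.neutral) (auto simp: C0 True)
      then show ?thesis
        using True by (simp add: sign_id atLeast0LessThan)
    next
      case False
      have "(\<Prod>i\<in>{0..<n} - {a}. poly (C $$ (i, p i)) 0) = 0" if a: "a < n" for a
      proof -
        \<comment> \<open>Both b and p b are moved and they differ, so one of them is not the index
          a whose factor was differentiated.\<close>
        obtain b where b: "p b \<noteq> b" using False by (auto simp: fun_eq_iff)
        then have bn: "b < n" using p by (auto simp: permutes_def)
        have "p (p b) \<noteq> p b" using b permutes_inj[OF p] by (auto dest: injD)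
        then obtain c where "c < n" "c \<noteq> a" "p c \<noteq> c"
          using b bn pn by metis
        then show ?thesis
          using pn C0[of c "p c"] by (intro prod_zero bexI[of _ c]) auto
      qed
      then have "(\<Sum>a=0..<n. (\<Prod>i\<in>{0..<n} - {a}. poly (C $$ (i, p i)) 0) *
          poly (pderiv (C $$ (a, p a))) 0) = 0"
        by (intro sum.neutral) auto
      then show ?thesis using False by simp
    qed
    finally show ?thesis .
  qed
  then have "poly (pderiv (det C)) 0 = (\<Sum>p\<in>?P. if p = id then (\<Sum>i<n. poly (pderiv (C $$ (i, i))) 0) else 0)"
    unfolding det_def'[OF C] by (simp add: pderiv_sum poly_sum)
  also have "\<dots> = (\<Sum>i<n. poly (pderiv (C $$ (i, i))) 0)"
    using finite_permutations[of "{0..<n}"] by (subst sum.delta) (auto simp: permutes_id)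
  finally show ?thesis .
qed

text \<open>A determinant dividing 1 in \<open>complex poly\<close> is a unit, hence a nonzero
  constant. Polynomial dependence is essential here: the determinant of a merely smooth family of
  invertible matrices can vary.\<close>

lemma pderiv_det_invertible:
  fixes A B :: "complex poly mat"
  assumes "A \<in> carrier_mat n n" "B \<in> carrier_mat n n" "A * B = 1\<^sub>m n"
  shows "pderiv (det A) = 0" "pderiv (det B) = 0"
proof -
  have "det A * det B = 1"
    using det_mult[OF assms(1,2)] assms(3) by simp
  then have "det A dvd 1" "det B dvd 1"
    by (metis dvd_triv_left, metis dvd_triv_right)
  moreover have "det A \<noteq> 0" "det B \<noteq> 0"
    using \<open>det A * det B = 1\<close> by auto
  ultimately show "pderiv (det A) = 0" "pderiv (det B) = 0"
    using is_unit_iff_degree by (auto simp: pderiv_eq_0_iff)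
qed

text \<open>Multiplying by the constant matrix B(0) turns A into a family that is the identity at 0
  and still has constant determinant. The derivative formula at the identity then says that the
  trace of B(0) A'(0) vanishes.\<close>

lemma log_derivative_trace:
  fixes A B :: "complex poly mat"
  assumes A: "A \<in> carrier_mat n n" and B: "B \<in> carrier_mat n n" and AB: "A * B = 1\<^sub>m n"
  shows "(\<Sum>i<n. \<Sum>k<n. poly (B $$ (i, k)) 0 * poly (pderiv (A $$ (k, i))) 0) = 0"
    and "i < n \<Longrightarrow> j < n \<Longrightarrow>
      (\<Sum>k<n. poly (B $$ (i, k)) 0 * poly (A $$ (k, j)) 0) = (if i = j then 1 else 0)"
proof -
  define B0 where "B0 = mat n n (\<lambda>ij. poly (B $$ ij) 0)"
  define A0 where "A0 = mat n n (\<lambda>ij. poly (A $$ ij) 0)"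
  \<comment> \<open>The primed matrices are the values at 0 lifted back to constant polynomials;
    being inverse to one another, they show that \<open>det B0'\<close> is constant.\<close>
  define B0' where "B0' = mat n n (\<lambda>ij. [:poly (B $$ ij) 0:])"
  define A0' where "A0' = mat n n (\<lambda>ij. [:poly (A $$ ij) 0:])"
  have "(\<Sum>k<n. A $$ (i, k) * B $$ (k, j)) = (if i = j then 1 else 0)" if "i < n" "j < n" for i j
  proof -
    have "(A * B) $$ (i, j) = (\<Sum>k<n. A $$ (i, k) * B $$ (k, j))"
      using A B that by (simp add: scalar_prod_def atLeast0LessThan)
    then show ?thesis using that AB by simp
  qed
  note AB_ent = this
  have 0: "(\<Sum>k<n. poly (A $$ (i, k)) 0 * poly (B $$ (k, j)) 0) = (if i = j then 1 else 0)"
    if "i < n" "j < n" for i j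
    using arg_cong[OF AB_ent[OF that], of "\<lambda>p. poly p 0"]
    by (simp add: poly_sum split: if_splits)
  have AB': "(\<Sum>k<n. poly (B $$ (k, j)) 0 * poly (A $$ (i, k)) 0) = (if i = j then 1 else 0)"
    if "i < n" "j < n" for i j
    using 0[OF that] by (simp add: mult.commute)
  have c: "A0 \<in> carrier_mat n n" "B0 \<in> carrier_mat n n" "A0' \<in> carrier_mat n n" "B0' \<in> carrier_mat n n"
    by (simp_all add: A0_def B0_def A0'_def B0'_def)
  have "A0 * B0 = 1\<^sub>m n"
    by (rule eq_matI) (simp_all add: A0_def B0_def scalar_prod_def atLeast0LessThan 0)
  then have BA: "B0 * A0 = 1\<^sub>m n"
    by (rule mat_mult_left_right_inverse[OF c(1,2)])
  show 1: "(\<Sum>k<n. poly (B $$ (i, k)) 0 * poly (A $$ (k, j)) 0) = (if i = j then 1 else 0)"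
    if "i < n" "j < n" for i j
  proof -
    have "(B0 * A0) $$ (i, j) = (\<Sum>k<n. poly (B $$ (i, k)) 0 * poly (A $$ (k, j)) 0)"
      using that by (simp add: A0_def B0_def scalar_prod_def atLeast0LessThan)
    then show ?thesis using that BA by simp
  qed
  have sum_const: "(\<Sum>k<n. [:f k:]) = [:\<Sum>k<n. f k:]" for f :: "nat \<Rightarrow> complex"
    by (induction n) simp_all
  have "A0' * B0' = 1\<^sub>m n"
    by (rule eq_matI) (simp_all add: A0'_def B0'_def scalar_prod_def atLeast0LessThan sum_const AB'
        one_pCons mult.commute[of "poly (A $$ _) 0"])
  then have "pderiv (det B0') = 0"
    by (rule pderiv_det_invertible[OF c(3,4)])
  then have d: "pderiv (det (B0' * A)) = 0"
    using pderiv_det_invertible(1)[OF A B AB] by (simp add: det_mult[OF c(4) A] pderiv_mult)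
  have C: "(B0' * A) $$ (i, j) = (\<Sum>k<n. smult (poly (B $$ (i, k)) 0) (A $$ (k, j)))"
    if "i < n" "j < n" for i j
    using A that by (simp add: B0'_def scalar_prod_def atLeast0LessThan)
  have "poly (pderiv (det (B0' * A))) 0 = (\<Sum>i<n. poly (pderiv ((B0' * A) $$ (i, i))) 0)"
  proof (rule pderiv_det_at_identity)
    show "B0' * A \<in> carrier_mat n n" using A c by simp
    show "poly ((B0' * A) $$ (i, j)) 0 = (if i = j then 1 else 0)" if "i < n" "j < n" for i j
      unfolding C[OF that] 1[OF that, symmetric] by (simp add: poly_sum)
  qed
  also have "\<dots> = (\<Sum>i<n. \<Sum>k<n. poly (B $$ (i, k)) 0 * poly (pderiv (A $$ (k, i))) 0)"
    by (rule sum.cong) (simp_all add: C pderiv_sum pderiv_smult poly_sum)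
  finally show "(\<Sum>i<n. \<Sum>k<n. poly (B $$ (i, k)) 0 * poly (pderiv (A $$ (k, i))) 0) = 0"
    by (simp add: d)
qed

definition eval_at :: "complex \<Rightarrow> ('i, complex poly) fmat \<Rightarrow> ('i, complex) fmat" where
  "eval_at s = fmap (\<lambda>p. poly p s)"

definition deriv_at :: "complex \<Rightarrow> ('i, complex poly) fmat \<Rightarrow> ('i, complex) fmat" where
  "deriv_at s = fmap (\<lambda>p. poly (pderiv p) s)"

lemma ent_eval_at [simp]: "ent (eval_at s M) x y = poly (ent M x y) s"
  by (simp add: eval_at_def ent_fmap)

lemma ent_deriv_at [simp]: "ent (deriv_at s M) x y = poly (pderiv (ent M x y)) s"
  by (simp add: deriv_at_def ent_fmap)

lemma fsupp_eval_at: "fsupp (eval_at s M) \<subseteq> fsupp M" and fsupp_deriv_at: "fsupp (deriv_at s M) \<subseteq> fsupp M"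
  by (rule fsupp_subset; auto simp: ent_zero_outside)+

text \<open>An enumeration of I carries the determinant argument over to finitely supported
  matrices. Within the finite block I a right inverse is also a left inverse, which gives the second
  claim.\<close>

lemma fmat_log_derivative:
  fixes A B :: "('i, complex poly) fmat"
  assumes I: "finite I" and A: "fsupp A \<subseteq> I" and B: "fsupp B \<subseteq> I" and AB: "A * B = funit I"
  shows "ftrace (eval_at 0 B * deriv_at 0 A) = 0" "eval_at 0 B * eval_at 0 A = funit I"
proof -
  obtain f where f: "bij_betw f {..<card I} I"
    using ex_bij_betw_nat_finite[OF I] by (auto simp: atLeast0LessThan)
  let ?n = "card I"
  let ?A = "mat ?n ?n (\<lambda>(i, j). ent A (f i) (f j))" and ?B = "mat ?n ?n (\<lambda>(i, j). ent B (f i) (f j))"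
  have re: "(\<Sum>x\<in>I. g x) = (\<Sum>i<?n. g (f i))" for g :: "'i \<Rightarrow> 'c::comm_monoid_add"
    using sum.reindex_bij_betw[OF f, of g] by simp
  have inj: "i < ?n \<Longrightarrow> j < ?n \<Longrightarrow> f i = f j \<longleftrightarrow> i = j" and fI: "i < ?n \<Longrightarrow> f i \<in> I" for i j
    using f by (auto simp: bij_betw_def inj_on_def)
  have "?A * ?B = 1\<^sub>m ?n"
  proof (rule eq_matI)
    fix i j assume "i < dim_row (1\<^sub>m ?n)" "j < dim_col (1\<^sub>m ?n)"
    then have ij: "i < ?n" "j < ?n" by simp_all
    then have "(?A * ?B) $$ (i, j) = (\<Sum>x\<in>I. ent A (f i) x * ent B x (f j))"
      by (simp add: scalar_prod_def atLeast0LessThan re)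
    also have "\<dots> = ent (A * B) (f i) (f j)"
      by (rule ent_mult[symmetric]) (use I A in auto)
    finally show "(?A * ?B) $$ (i, j) = 1\<^sub>m ?n $$ (i, j)"
      using ij by (simp add: AB ent_funit I inj fI)
  qed auto
  note * = log_derivative_trace[of ?A ?n ?B, OF _ _ this]
  have sub: "fsupp (eval_at 0 B) \<subseteq> I" "fsupp (deriv_at 0 A) \<subseteq> I" "fsupp (eval_at 0 A) \<subseteq> I"
    by (rule subset_trans[OF fsupp_eval_at B] subset_trans[OF fsupp_deriv_at A]
        subset_trans[OF fsupp_eval_at A])+
  have "ftrace (eval_at 0 B * deriv_at 0 A) =
      (\<Sum>x\<in>I. \<Sum>y\<in>I. poly (ent B x y) 0 * poly (pderiv (ent A y x)) 0)"
  proof (subst ftrace_superset[OF I])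
    show "fsupp (eval_at 0 B * deriv_at 0 A) \<subseteq> I"
    proof (rule fsupp_subset)
      fix x y assume "x \<notin> I \<or> y \<notin> I"
      then have "x \<notin> fsupp B \<or> y \<notin> fsupp A" using A B by auto
      then show "ent (eval_at 0 B * deriv_at 0 A) x y = 0"
        using sub by (auto simp: ent_mult[OF I] ent_zero_outside)
    qed
  qed (use sub in \<open>simp add: ent_mult[OF I]\<close>)
  also have "\<dots> = 0"
    using *(1) by (simp add: re)
  finally show "ftrace (eval_at 0 B * deriv_at 0 A) = 0" .
  show "eval_at 0 B * eval_at 0 A = funit I"
  proof (rule ent_eqI)
    fix x y
    have 1: "ent (eval_at 0 B * eval_at 0 A) x y = (\<Sum>z\<in>I. poly (ent B x z) 0 * poly (ent A z y) 0)"
      using sub by (simp add: ent_mult[OF I])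
    show "ent (eval_at 0 B * eval_at 0 A) x y = ent (funit I) x y"
    proof (cases "x \<in> I \<and> y \<in> I")
      case True
      then have "x \<in> f ` {..<?n}" "y \<in> f ` {..<?n}"
        using f by (simp_all add: bij_betw_def)
      then obtain i j where ij: "i < ?n" "j < ?n" "x = f i" "y = f j"
        by (elim imageE) simp
      have "(\<Sum>k<?n. poly (ent B (f i) (f k)) 0 * poly (ent A (f k) (f j)) 0) = (if i = j then 1 else 0)"
        using *(2)[OF _ _ ij(1,2)] ij by simp
      then show ?thesis
        unfolding 1 re using ij inj fI by (simp add: ent_funit I)
    next
      case False
      then have "x \<notin> fsupp B \<or> y \<notin> fsupp A" using A B by auto
      then have "poly (ent B x z) 0 * poly (ent A z y) 0 = 0" for z
        by (auto simp: ent_zero_outside)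
      then have "(\<Sum>z\<in>I. poly (ent B x z) 0 * poly (ent A z y) 0) = 0"
        by (intro sum.neutral) blast
      then show ?thesis using False unfolding 1 by (auto simp: ent_funit I)
    qed
  qed
qed

lemma calg_hom_eval_at: "calg_hom (eval_at s)"
  unfolding eval_at_def
  by (intro calg_hom_fmap calg_homI) (auto simp: csc_poly_def csc_complex_def)

section \<open>Sums over the arrows of the double quiver, and tangent vectors\<close>

lemma double_simps [simp]:
  "verts (double Q) = verts Q" "star (star a) = a"
  "a \<in> arcs (double Q) \<Longrightarrow> star a \<in> arcs (double Q)"
  "tail (double Q) (star a) = head (double Q) a" "head (double Q) (star a) = tail (double Q) a"
  "arrow_sign (star a) = - arrow_sign a" "arrow_sign a * arrow_sign a = 1"
  by (cases a; auto simp: double_def)+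

lemma bij_star: "bij_betw star (arcs (double Q)) (arcs (double Q))"
  by (rule bij_betw_byWitness[of _ star]) auto

lemma sum_star: "(\<Sum>a\<in>arcs (double Q). f (star a)) = (\<Sum>a\<in>arcs (double Q). f a)"
  by (rule sum.reindex_bij_betw[OF bij_star])

lemma sum_double:
  assumes "finite (arcs Q)"
  shows "(\<Sum>a\<in>arcs (double Q). f a) = (\<Sum>a\<in>arcs Q. f (Arr a) + f (Star a))"
proof -
  have "(\<Sum>a\<in>arcs (double Q). f a) = (\<Sum>a\<in>Arr ` arcs Q. f a) + (\<Sum>a\<in>Star ` arcs Q. f a)"
    unfolding double_def by (simp, intro sum.union_disjoint) (use assms in auto)
  then show ?thesis
    by (simp add: sum.reindex inj_on_def sum.distrib)
qed

lemma sum_in_arrows: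
  assumes "finite (arcs Q)"
  shows "(\<Sum>c\<in>in_arrows Q i. f c) = (\<Sum>c\<in>arcs (double Q). if head (double Q) c = i then f c else 0)"
  using assms unfolding in_arrows_def
  by (subst sum.inter_filter) (auto simp: double_def)

text \<open>Tangent vectors at a representation with fixed idempotents: one block for each arrow,
  and no relation between the blocks. Adding a multiple of such a family to a representation gives a
  representation.\<close>

definition corner :: "('v, 'a) pre_digraph \<Rightarrow> ('v \<Rightarrow> 'r::calg) \<Rightarrow> ('a \<Rightarrow> 'r) \<Rightarrow> bool" where
  "corner G e \<delta> \<longleftrightarrow> (\<forall>a\<in>arcs G. e (head G a) * \<delta> a = \<delta> a \<and> \<delta> a * e (tail G a) = \<delta> a)"

lemma arep_corner: "arep G e X \<Longrightarrow> corner G e X"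
  by (auto simp: arep_def corner_def)

lemma arep_change: "arep G e X \<Longrightarrow> corner G e Y \<Longrightarrow> arep G e Y"
  by (auto simp: arep_def corner_def)

section \<open>Automorphisms preserving the commutator element are symplectic\<close>

definition tri0 :: "'r::calg \<Rightarrow> 'r tri" where
  "tri0 x = Tri x 0 0 0"

lemma arep_tri:
  assumes "arep G e X" "corner G e d1" "corner G e d2"
  shows "arep G (tri0 \<circ> e) (\<lambda>a. Tri (X a) (d1 a) (d2 a) 0)"
  using assms by (auto simp: arep_def corner_def tri0_def times_tri_def zero_tri_def)

text \<open>Forgetting one tangent direction together with the corner is multiplicative, so in an
  evaluation with two directions each first-order coordinate depends on its own direction
  alone.\<close>

lemma calg_hom_tri_fst: "calg_hom (\<lambda>x. Tri (td x) (t1 x) 0 0 :: 'r::calg tri)"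
  and calg_hom_tri_snd: "calg_hom (\<lambda>x. Tri (td x) 0 (t2 x) 0 :: 'r::calg tri)"
  by (auto intro!: calg_homI simp: plus_tri_def times_tri_def csc_tri_def)

lemma (in wf_digraph) ev_cong:
  assumes "x \<in> carrier (path_algebra G)" "\<And>a. a \<in> arcs G \<Longrightarrow> X a = Y a"
  shows "ev e X x = ev e Y x"
proof -
  have "path_ev e X p = path_ev e Y p" if "p \<in> paths G" for p
    using that by (induction rule: path_induct) (auto simp: path_ev_snoc assms(2))
  then show ?thesis
    using assms(1) unfolding ev_def pa_in_carrier by (intro sum.cong) auto
qed

context fin_digraph
begin

lemma wf_double: "wf_digraph (double G)"
  using fin_digraph_double[OF fin_digraph_axioms] by (simp add: fin_digraph_def)

lemma omega_in_carrier: "omega_elt G \<in> carrier (path_algebra (double G))"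
proof -
  interpret D: wf_digraph "double G" by (rule wf_double)
  have m: "- x \<in> carrier (path_algebra (double G))" if "x \<in> carrier (path_algebra (double G))" for x
    using that by (simp add: pa_in_carrier)
  have sub: "x - y \<in> carrier (path_algebra (double G))"
    if "x \<in> carrier (path_algebra (double G))" "y \<in> carrier (path_algebra (double G))" for x y
    using D.add_in_carrier[OF that(1) m[OF that(2)]] by simp
  have "Arr a \<in> arcs (double G)" "Star a \<in> arcs (double G)" if "a \<in> arcs G" for a
    using that by (auto simp: double_def)
  then show ?thesis
    unfolding omega_elt_def
    by (intro D.sum_in_carrier sub D.pa_mult_in_carrier D.arrow_in_carrier)
qed

lemma ev_omega:
  assumes "arep (double G) e X"
  shows "ev e X (omega_elt G) = (\<Sum>a\<in>arcs (double G). csc (arrow_sign a) (X a * X (star a)))"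
proof -
  interpret D: wf_digraph "double G" by (rule wf_double)
  have a: "Arr a \<in> arcs (double G)" "Star a \<in> arcs (double G)" if "a \<in> arcs G" for a
    using that by (auto simp: double_def)
  show ?thesis
    by (simp add: omega_elt_def ev_sum ev_diff D.ev_mult[OF assms] D.arrow_in_carrier a
        D.ev_arrow[OF assms] sum_double csc_one csc_minus_left)
qed

text \<open>The form is what the corner of \<open>omega_elt\<close> contributes when it is evaluated
  at two tangent directions. On the twisted side the corner also contains the unknown second-order
  part of \<rho>, and that part disappears under the trace.\<close>

lemma symplectic:
  fixes X :: "_ \<Rightarrow> ('i, complex) fmat"
  assumes X: "arep (double G) e X" and d: "corner (double G) e d1" "corner (double G) e d2"
    and \<rho>: "wf_digraph.path_endo (double G) \<rho>" "\<rho> (omega_elt G) = omega_elt G"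
  defines "Y \<equiv> \<lambda>a. ev (tri0 \<circ> e) (\<lambda>a. Tri (X a) (d1 a) (d2 a) 0) (\<rho> (arrow_elt (double G) a))"
  shows "(\<Sum>a\<in>arcs (double G). arrow_sign a * ftrace (t1 (Y a) * t2 (Y (star a)))) =
    (\<Sum>a\<in>arcs (double G). arrow_sign a * ftrace (d1 a * d2 (star a)))"
proof -
  interpret D: wf_digraph "double G" by (rule wf_double)
  let ?X = "\<lambda>a. Tri (X a) (d1 a) (d2 a) 0"
  have t12: "t12 (\<Sum>a\<in>S. f a) = (\<Sum>a\<in>S. t12 (f a :: ('i, complex) fmat tri))" for S :: "'b darrow set" and f
    by (induction S rule: infinite_finite_induct) (auto simp: plus_tri_def zero_tri_def)
  have "arep (double G) (tri0 \<circ> e) ?X"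
    by (rule arep_tri[OF X d])
  note r = this D.arep_endo[OF \<rho>(1) _ this]
  have "ev (tri0 \<circ> e) ?X (omega_elt G) = ev (tri0 \<circ> e) Y (omega_elt G)"
    using D.ev_endo[OF \<rho>(1) _ r(1) omega_in_carrier] \<rho>(2) by (simp add: Y_def)
  then have "(\<Sum>a\<in>arcs (double G). csc (arrow_sign a) (?X a * ?X (star a))) =
      (\<Sum>a\<in>arcs (double G). csc (arrow_sign a) (Y a * Y (star a)))"
    using ev_omega[OF r(1)] ev_omega[of "tri0 \<circ> e" Y] r(2) by (simp add: Y_def)
  from arg_cong[OF this, of t12] have "(\<Sum>a\<in>arcs (double G). csc (arrow_sign a) (d1 a * d2 (star a))) =
    (\<Sum>a\<in>arcs (double G). csc (arrow_sign a)
      (td (Y a) * t12 (Y (star a)) + t1 (Y a) * t2 (Y (star a)) + t12 (Y a) * td (Y (star a))))"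
    by (simp add: t12 csc_tri_def times_tri_def)
  from arg_cong[OF this, of ftrace]
  have "(\<Sum>a\<in>arcs (double G). arrow_sign a * ftrace (d1 a * d2 (star a))) =
    (\<Sum>a\<in>arcs (double G). arrow_sign a * ftrace (td (Y a) * t12 (Y (star a)))) +
    (\<Sum>a\<in>arcs (double G). arrow_sign a * ftrace (t1 (Y a) * t2 (Y (star a)))) +
    (\<Sum>a\<in>arcs (double G). arrow_sign a * ftrace (t12 (Y a) * td (Y (star a))))"
    by (simp add: ftrace_sum ftrace_csc ftrace_add csc_complex_def algebra_simps sum.distrib)
  \<comment> \<open>Replacing a by \<open>star a\<close> reverses the sign, and cyclicity of the
    trace restores the order of the factors: the two second-order terms cancel.\<close>
  moreover have "(\<Sum>a\<in>arcs (double G). arrow_sign a * ftrace (t12 (Y a) * td (Y (star a)))) =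
    - (\<Sum>a\<in>arcs (double G). arrow_sign a * ftrace (td (Y a) * t12 (Y (star a))))"
    by (subst sum_star[symmetric]) (simp add: ftrace_comm[of "td _"] sum_negf)
  ultimately show ?thesis by simp
qed

end

section \<open>Representations induced from the complement of a vertex\<close>

locale loop_free_vertex = fin_digraph Q for Q :: "('v, 'a) pre_digraph" +
  fixes i :: 'v
  assumes i: "i \<in> loop_free Q"
begin

sublocale D: wf_digraph "double Q" by (rule wf_double)

abbreviation "C \<equiv> in_arrows Q i"
abbreviation "A \<equiv> carrier (path_algebra (double Q))"
abbreviation "arr \<equiv> arrow_elt (double Q)"

lemma finite_verts_double: "finite (verts (double Q))"
  by simp

lemma finite_C: "finite C"
  by (simp add: in_arrows_def double_def)

lemma i_in: "i \<in> verts Q"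
  using i by (simp add: loop_free_def)

lemma C_arc: "c \<in> C \<Longrightarrow> c \<in> arcs (double Q)" and C_head: "c \<in> C \<Longrightarrow> head (double Q) c = i"
  by (auto simp: in_arrows_def)

lemma C_tail: "c \<in> C \<Longrightarrow> tail (double Q) c \<noteq> i"
  using i by (cases c) (auto simp: in_arrows_def double_def loop_free_def)

lemma C_tail_in: "c \<in> C \<Longrightarrow> tail (double Q) c \<in> verts Q"
  using D.tail_in_verts[of c] by (simp add: C_arc)

lemma e_arc: "a \<in> arcs (double Q) \<Longrightarrow> head (double Q) a \<in> verts Q"
    "a \<in> arcs (double Q) \<Longrightarrow> tail (double Q) a \<in> verts Q"
  using D.head_in_verts[of a] D.tail_in_verts[of a] by auto

lemma star_in_C: "a \<in> arcs (double Q) \<Longrightarrow> tail (double Q) a = i \<Longrightarrow> star a \<in> C"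
  by (simp add: in_arrows_def)

end

text \<open>\<open>inj\<close> and \<open>proj\<close> exhibit the block at i as the direct sum of
  the blocks at the tails of the arrows into i. The coefficient algebra is left open because the
  data are used twice: over complex matrices and, with constant entries, over matrices of
  polynomials.\<close>

locale ind_ring = loop_free_vertex Q i for Q :: "('v, 'a) pre_digraph" and i +
  fixes e :: "'v \<Rightarrow> 'r::calg" and inj proj :: "'a darrow \<Rightarrow> 'r"
  assumes e_orth: "u \<in> verts Q \<Longrightarrow> v \<in> verts Q \<Longrightarrow> e u * e v = (if u = v then e u else 0)"
    and proj_inj: "c \<in> in_arrows Q i \<Longrightarrow> c' \<in> in_arrows Q i \<Longrightarrow>
      proj c * inj c' = (if c = c' then e (tail (double Q) c) else 0)"
    and inj_proj: "(\<Sum>c\<in>in_arrows Q i. inj c * proj c) = e i"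
    and inj_corner: "c \<in> in_arrows Q i \<Longrightarrow> e i * inj c = inj c"
      "c \<in> in_arrows Q i \<Longrightarrow> inj c * e (tail (double Q) c) = inj c"
    and proj_corner: "c \<in> in_arrows Q i \<Longrightarrow> proj c * e i = proj c"
      "c \<in> in_arrows Q i \<Longrightarrow> e (tail (double Q) c) * proj c = proj c"
begin

text \<open>\<open>hat W\<close> is \<open>W\<close> with the space at \<open>i\<close> replaced by the direct sum of the spaces at the tails of the
  arrows into \<open>i\<close>; the map \<open>\<Sum>c\<in>C. W c * proj c\<close> at \<open>i\<close> is a morphism from \<open>hat W\<close> to \<open>W\<close>.\<close>

definition hat :: "('a darrow \<Rightarrow> 'r) \<Rightarrow> 'a darrow \<Rightarrow> 'r" where
  "hat W a = (if head (double Q) a = i then inj a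
     else if tail (double Q) a = i then W a * (\<Sum>c\<in>C. W c * proj c) else W a)"

text \<open>The map at i of \<open>hat W\<close> twisted by \<sigma>, an endomorphism of the direct
  sum. As \<open>factor\<close> shows, it measures how the map at i changes when W is
  twisted.\<close>

definition fac :: "((('v, 'a darrow) path \<Rightarrow>\<^sub>0 complex) \<Rightarrow> (('v, 'a darrow) path \<Rightarrow>\<^sub>0 complex)) \<Rightarrow>
    ('a darrow \<Rightarrow> 'r) \<Rightarrow> 'r" where
  "fac \<sigma> W = (\<Sum>c\<in>C. ev e (hat W) (\<sigma> (arr c)) * proj c)"

lemma sum_proj_e: "(\<Sum>c\<in>C. W c * proj c) * e i = (\<Sum>c\<in>C. W c * proj c)"
  by (simp add: sum_distrib_right mult.assoc proj_corner)

lemma sum_e_proj: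
  assumes "arep (double Q) e W"
  shows "e i * (\<Sum>c\<in>C. W c * proj c) = (\<Sum>c\<in>C. W c * proj c)"
  using D.arep_head[OF assms C_arc]
  by (simp add: sum_distrib_left C_head flip: mult.assoc)

lemma sum_proj_inj:
  assumes "arep (double Q) e W" "c \<in> C"
  shows "(\<Sum>c\<in>C. W c * proj c) * inj c = W c"
proof -
  have "(\<Sum>c\<in>C. W c * proj c) * inj c = (\<Sum>c'\<in>C. if c = c' then W c * e (tail (double Q) c) else 0)"
    unfolding sum_distrib_right using assms(2)
    by (intro sum.cong) (auto simp: mult.assoc proj_inj)
  then show ?thesis
    using assms D.arep_tail[OF assms(1) C_arc] by (simp add: finite_C)
qed

lemma arep_hat:
  assumes W: "arep (double Q) e W"
  shows "arep (double Q) e (hat W)"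
  unfolding arep_def
proof (intro conjI ballI)
  fix a assume a: "a \<in> arcs (double Q)"
  then have c: "head (double Q) a = i \<Longrightarrow> a \<in> C" by (simp add: in_arrows_def)
  show "e (head (double Q) a) * hat W a = hat W a"
    using D.arep_head[OF W a] inj_corner(1) c
    by (auto simp: hat_def simp flip: mult.assoc)
  show "hat W a * e (tail (double Q) a) = hat W a"
    using D.arep_tail[OF W a] inj_corner(2) c
    by (auto simp: hat_def mult.assoc sum_proj_e)
qed (simp add: e_orth)

text \<open>The canonical morphism T from \<open>hat W\<close> to W is the identity away from i, and
  it stays a morphism after twisting. A twisted arrow into i starts away from i, where T acts
  trivially, so its value on W is its value on \<open>hat W\<close> followed by the map at
  i.\<close>

lemma factor:
  assumes W: "arep (double Q) e W" and \<sigma>: "D.path_endo \<sigma>"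
  shows "(\<Sum>c\<in>C. ev e W (\<sigma> (arr c)) * proj c) = (\<Sum>c\<in>C. W c * proj c) * fac \<sigma> W"
proof -
  let ?p = "\<Sum>c\<in>C. W c * proj c"
  define T where "T = (\<Sum>v\<in>verts Q - {i}. e v) + ?p"
  have fin: "finite (verts Q - {i})" by simp
  have Te: "T * e v = (if v = i then ?p else e v)" and eT: "e v * T = (if v = i then ?p else e v)"
    if v: "v \<in> verts Q" for v
  proof -
    have "(\<Sum>u\<in>verts Q - {i}. e u) * e v = (if v = i then 0 else e v)"
    proof -
      have "(\<Sum>u\<in>verts Q - {i}. e u) * e v = (\<Sum>u\<in>verts Q - {i}. if u = v then e v else 0)"
        unfolding sum_distrib_right using v by (intro sum.cong) (auto simp: e_orth)
      then show ?thesis using v fin by simp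
    qed
    moreover have "?p * e v = (if v = i then ?p else 0)"
      using sum_proj_e[of W] e_orth[OF i_in v] by (metis mult.assoc mult_zero_right)
    ultimately show "T * e v = (if v = i then ?p else e v)"
      by (simp add: T_def distrib_right)
    have "e v * (\<Sum>u\<in>verts Q - {i}. e u) = (if v = i then 0 else e v)"
    proof -
      have "e v * (\<Sum>u\<in>verts Q - {i}. e u) = (\<Sum>u\<in>verts Q - {i}. if u = v then e v else 0)"
        unfolding sum_distrib_left using v by (intro sum.cong) (auto simp: e_orth)
      then show ?thesis using v fin by simp
    qed
    moreover have "e v * ?p = (if v = i then ?p else 0)"
      using sum_e_proj[OF W] e_orth[OF v i_in] by (metis mult.assoc mult_zero_left)
    ultimately show "e v * T = (if v = i then ?p else e v)"
      by (simp add: T_def distrib_left)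
  qed
  have TX: "T * hat W a = W a * T" if a: "a \<in> arcs (double Q)" for a
  proof -
    have v: "head (double Q) a \<in> verts Q" "tail (double Q) a \<in> verts Q"
      using D.head_in_verts[OF a] D.tail_in_verts[OF a] by simp_all
    have "T * hat W a = T * e (head (double Q) a) * hat W a"
      using D.arep_head[OF arep_hat[OF W] a] by (simp add: mult.assoc)
    moreover have "W a * T = W a * (e (tail (double Q) a) * T)"
      using D.arep_tail[OF W a] by (simp flip: mult.assoc)
    moreover have "?p * inj a = W a" "tail (double Q) a \<noteq> i" if "head (double Q) a = i"
      using sum_proj_inj[OF W] C_tail that a by (auto simp: in_arrows_def)
    ultimately show ?thesis
      using D.arep_head[OF W a] D.arep_tail[OF W a]
      by (auto simp: Te eT v hat_def simp flip: mult.assoc)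
  qed
  have "ev e W (\<sigma> (arr c)) = ?p * ev e (hat W) (\<sigma> (arr c))" if c: "c \<in> C" for c
  proof -
    note cs = D.endo_carrier[OF \<sigma> finite_verts_double D.arrow_in_carrier[OF C_arc[OF c]]]
    have "ev e W (\<sigma> (arr c)) = ev e W (\<sigma> (arr c)) * (e (tail (double Q) c) * T)"
      using D.arep_tail[OF D.arep_endo[OF \<sigma> finite_verts_double W] C_arc[OF c]] C_tail[OF c] eT[OF C_tail_in[OF c]]
      by simp
    also have "\<dots> = ev e W (\<sigma> (arr c)) * T"
      using D.arep_tail[OF D.arep_endo[OF \<sigma> finite_verts_double W] C_arc[OF c]]
      by (simp flip: mult.assoc)
    also have "\<dots> = T * ev e (hat W) (\<sigma> (arr c))"
      by (rule D.ev_intertwine[OF cs, symmetric]) (use TX Te eT in auto)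
    also have "\<dots> = T * e i * ev e (hat W) (\<sigma> (arr c))"
      using D.arep_head[OF D.arep_endo[OF \<sigma> finite_verts_double arep_hat[OF W]] C_arc[OF c]]
      by (simp add: mult.assoc C_head[OF c])
    finally show ?thesis by (simp add: Te i_in)
  qed
  then show ?thesis
    by (simp add: fac_def sum_distrib_left mult.assoc)
qed

text \<open>The map at i of X is the identity, and twisting by \<sigma> and back by \<rho> restores
  X. Applying \<open>factor\<close> to the second twist therefore exhibits a right inverse of the
  map at i after the first one.\<close>

lemma fac_right_inverse:
  assumes X: "arep (double Q) e X" "\<And>c. c \<in> C \<Longrightarrow> X c = inj c"
    and \<sigma>: "D.path_endo \<sigma>" and \<rho>: "D.path_endo \<rho>" and inv: "\<And>x. x \<in> A \<Longrightarrow> \<sigma> (\<rho> x) = x"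
  shows "(\<Sum>c\<in>C. ev e X (\<sigma> (arr c)) * proj c) * fac \<rho> (\<lambda>a. ev e X (\<sigma> (arr a))) = e i"
proof -
  let ?W = "\<lambda>a. ev e X (\<sigma> (arr a))"
  have W: "arep (double Q) e ?W" by (rule D.arep_endo[OF \<sigma> finite_verts_double X(1)])
  have "ev e ?W (\<rho> (arr c)) = inj c" if c: "c \<in> C" for c
  proof -
    have 1: "arr c \<in> A" using C_arc[OF c] by (rule D.arrow_in_carrier)
    have "ev e ?W (\<rho> (arr c)) = ev e X (\<sigma> (\<rho> (arr c)))"
      by (rule D.ev_endo[OF \<sigma> finite_verts_double X(1), symmetric])
        (rule D.endo_carrier[OF \<rho> finite_verts_double 1])
    then show ?thesis
      using D.ev_arrow[OF X(1) C_arc[OF c]] by (simp add: inv[OF 1] X(2)[OF c])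
  qed
  then have "e i = (\<Sum>c\<in>C. ev e ?W (\<rho> (arr c)) * proj c)"
    by (simp add: inj_proj)
  then show ?thesis using factor[OF W \<rho>] by simp
qed

end

section \<open>One-parameter families of matrices and their jets\<close>

definition cst :: "('i, complex) fmat \<Rightarrow> ('i, complex poly) fmat" where
  "cst = fmap (\<lambda>z. [:z:])"

definition linear_family :: "('i, complex) fmat \<Rightarrow> ('i, complex) fmat \<Rightarrow> ('i, complex poly) fmat" where
  "linear_family M N = cst M + fmap (\<lambda>z. [:0, z:]) N"

lemma calg_hom_cst: "calg_hom cst"
  unfolding cst_def
  by (intro calg_hom_fmap calg_homI) (auto simp: csc_poly_def csc_complex_def)

lemma ent_cst [simp]: "ent (cst M) x y = [:ent M x y:]"
  by (simp add: cst_def ent_fmap)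

lemma ent_linear_family [simp]: "ent (linear_family M N) x y = [:ent M x y, ent N x y:]"
  by (simp add: linear_family_def ent_add ent_fmap)

lemma eval_at_cst [simp]: "eval_at s (cst M) = M"
  and deriv_at_cst [simp]: "deriv_at s (cst M) = 0"
  and eval_at_linear [simp]: "eval_at s (linear_family M N) = M + csc s N"
  and deriv_at_linear [simp]: "deriv_at s (linear_family M N) = N"
  and cst_funit: "finite S \<Longrightarrow> cst (funit S) = funit S"
  by (auto intro!: ent_eqI simp: ent_add ent_csc ent_zero csc_complex_def pderiv_pCons ent_funit one_pCons)

lemma cst_mult_linear: "cst M * linear_family N L = linear_family (M * N) (M * L)"
  and linear_mult_cst: "linear_family N L * cst M = linear_family (N * M) (L * M)"
proof -
  have s: "fsupp (cst M) \<subseteq> fsupp M" for M :: "('i, complex) fmat"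
    by (rule fsupp_subset) (auto simp: ent_zero_outside)
  have S: "(\<Sum>z\<in>S. [:f z, g z:]) = [:\<Sum>z\<in>S. f z, \<Sum>z\<in>S. g z:]" for S and f g :: "'i \<Rightarrow> complex"
    by (induction S rule: infinite_finite_induct) auto
  show "cst M * linear_family N L = linear_family (M * N) (M * L)"
    by (rule ent_eqI) (simp add: ent_mult[OF finite_fsupp disjI1[OF s]] ent_mult0[of M] S mult.commute)
  show "linear_family N L * cst M = linear_family (N * M) (L * M)"
    by (rule ent_eqI) (simp add: ent_mult[OF finite_fsupp disjI2[OF s]]
        ent_mult[OF finite_fsupp[of M] disjI2[OF subset_refl]] S mult.commute)
qed

lemma deriv_at_mult: "deriv_at s (M * N) = deriv_at s M * eval_at s N + eval_at s M * deriv_at s N"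
proof (rule ent_eqI)
  fix x y
  have "fsupp (deriv_at s M) \<subseteq> fsupp M" "fsupp (eval_at s M) \<subseteq> fsupp M"
    by (rule fsupp_deriv_at fsupp_eval_at)+
  then show "ent (deriv_at s (M * N)) x y = ent (deriv_at s M * eval_at s N + eval_at s M * deriv_at s N) x y"
    by (simp add: ent_add ent_mult[OF finite_fsupp[of M]] pderiv_sum pderiv_mult poly_sum sum.distrib
        algebra_simps)
qed

lemma deriv_at_add: "deriv_at s (M + N) = deriv_at s M + deriv_at s N"
  by (rule ent_eqI) (simp add: ent_add pderiv_add)

lemma deriv_at_csc: "deriv_at s (csc c M) = csc c (deriv_at s M)"
  by (rule ent_eqI) (simp add: ent_csc csc_poly_def csc_complex_def pderiv_smult)

lemma deriv_at_sum: "deriv_at s (\<Sum>i\<in>I. f i) = (\<Sum>i\<in>I. deriv_at s (f i))"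
  by (induction I rule: infinite_finite_induct)
    (auto simp: deriv_at_add intro!: ent_eqI simp: ent_zero)

text \<open>By the product rule, value and derivative at s together form a homomorphism into
  \<open>tri\<close>. The two versions place the derivative in either tangent slot, so that it can
  be combined with a direction in the other one.\<close>

lemma calg_hom_jet_fst: "calg_hom (\<lambda>M. Tri (eval_at s M) (deriv_at s M) 0 0)"
  and calg_hom_jet_snd: "calg_hom (\<lambda>M. Tri (eval_at s M) 0 (deriv_at s M) 0)"
  by (auto intro!: calg_homI simp: plus_tri_def times_tri_def csc_tri_def deriv_at_mult deriv_at_add
      deriv_at_csc hom_add[OF calg_hom_eval_at] hom_mult[OF calg_hom_eval_at] hom_csc[OF calg_hom_eval_at])

text \<open>Integration over the polynomials: a polynomial derivative with the same value at every
  complex point is a constant.\<close>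

lemma eval_at_affine:
  assumes "\<And>t. deriv_at t M = N"
  shows "eval_at t M = eval_at 0 M + csc t N"
proof (rule ent_eqI)
  fix x y
  have "poly (pderiv (ent M x y)) t = ent N x y" for t
    using arg_cong[OF assms[of t], of "\<lambda>M. ent M x y"] by simp
  then have "poly (pderiv (ent M x y - [:0, ent N x y:])) = poly 0"
    by (auto simp: fun_eq_iff pderiv_diff pderiv_pCons)
  then have "pderiv (ent M x y - [:0, ent N x y:]) = 0"
    by (simp only: poly_eq_poly_eq_iff)
  then obtain k where "ent M x y - [:0, ent N x y:] = [:k:]"
    by (auto simp: pderiv_eq_0_iff elim: degree_eq_zeroE)
  then have "ent M x y = [:k, ent N x y:]"
    by (simp add: diff_eq_eq)
  then show "ent (eval_at t M) x y = ent (eval_at 0 M + csc t N) x y"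
    by (simp add: ent_add ent_csc csc_complex_def)
qed

lemma fsupp_corner:
  fixes M :: "('i, 'k::{calg, ring_1}) fmat"
  assumes "finite S" "funit S * M = M" "M * funit S = M"
  shows "fsupp M \<subseteq> S"
  using ent_funit_mult[OF assms(1), of M] ent_mult_funit[OF assms(1), of M] assms(2,3)
  by (intro fsupp_subset) (metis (full_types))

text \<open>A right inverse found in the large matrix ring may have entries outside the block S;
  cutting it down on both sides keeps it a right inverse and makes determinants available.\<close>

lemma ring_inverse_corner:
  assumes S: "finite S" and M: "funit S * M = M" "M * funit S = M" and MN: "M * N = funit S"
  shows "\<exists>B. fsupp B \<subseteq> S \<and> M * B = (funit S :: ('i, complex poly) fmat)"
proof (intro exI[of _ "funit S * N * funit S"] conjI)
  have u: "funit S * funit S = (funit S :: ('i, complex poly) fmat)"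
    by (rule ent_eqI) (simp add: ent_funit_mult[OF S] ent_funit[OF S])
  show "fsupp (funit S * N * funit S) \<subseteq> S"
    by (rule fsupp_corner[OF S]) (simp_all add: mult.assoc u, simp_all add: u flip: mult.assoc)
  show "M * (funit S * N * funit S) = funit S"
    using u by (simp add: M MN flip: mult.assoc)
qed

lemma corner_linear:
  assumes "corner G e X" "corner G e d"
  shows "corner G (cst \<circ> e) (\<lambda>a. linear_family (X a) (d a))"
  using assms by (auto simp: corner_def cst_mult_linear linear_mult_cst)

text \<open>Coordinate idempotents turn the corners into honest blocks with finite index sets, so
  that traces and determinants apply to them.\<close>

locale ind_matrix = ind_ring Q i e inj proj
  for Q :: "('v, 'a) pre_digraph" and i and e :: "'v \<Rightarrow> ('i, complex) fmat" and inj proj +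
  fixes Ix :: "'v \<Rightarrow> 'i set"
  assumes e_funit: "v \<in> verts Q \<Longrightarrow> e v = funit (Ix v)"
    and finite_Ix: "v \<in> verts Q \<Longrightarrow> finite (Ix v)"
begin

sublocale P: ind_ring Q i "cst \<circ> e" "cst \<circ> inj" "cst \<circ> proj"
proof unfold_locales
  note [simp] = hom_mult[OF calg_hom_cst, symmetric] hom_zero[OF calg_hom_cst] hom_sum[OF calg_hom_cst, symmetric]
  fix c c' assume c: "c \<in> C" "c' \<in> C"
  show "(cst \<circ> proj) c * (cst \<circ> inj) c' = (if c = c' then (cst \<circ> e) (tail (double Q) c) else 0)"
    using proj_inj[OF c] by simp
qed (use i e_orth inj_proj inj_corner proj_corner in
    \<open>auto simp: hom_mult[OF calg_hom_cst, symmetric] hom_zero[OF calg_hom_cst]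
      hom_sum[OF calg_hom_cst, symmetric]\<close>)

text \<open>If the incoming arrows are the inclusions, adding t \<delta> to the arrows changes a
  product b c through i only for c = star b, and then by t times the sign of b times an idempotent,
  because \<open>proj\<close> and \<open>inj\<close> are dual. This is the shift caused by
  reflection, with t in the role of \<tau> i.\<close>

definition \<delta> :: "'a darrow \<Rightarrow> ('i, complex) fmat" where
  "\<delta> a = (if tail (double Q) a = i then csc (arrow_sign a) (proj (star a)) else 0)"

lemma corner_\<delta>: "corner (double Q) e \<delta>"
  using proj_corner star_in_C by (auto simp: corner_def \<delta>_def csc_mult_left csc_mult_right)
    (metis double_simps(4))

lemma sum_sign_tail:
  "(\<Sum>a\<in>arcs (double Q). if tail (double Q) a = i then f (star a) else 0) = (\<Sum>c\<in>C. f c :: complex)"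
  by (subst sum_star[symmetric]) (simp add: sum_in_arrows cong: if_cong)

text \<open>The derivative \<open>\<eta>\<close> of the twist in the direction \<open>\<delta>\<close> is found by pairing it with every tangent
  vector \<open>d\<close> at the twisted representation \<open>Y\<close>.  By symplecticity this equals the pairing of \<open>\<delta>\<close> with
  the preimage of \<open>d\<close>, which is a trace in which the contribution of \<open>fac \<sigma>\<close> is a logarithmic
  derivative and vanishes.\<close>

lemma twist_derivative:
  assumes X: "arep (double Q) e X" "\<And>c. c \<in> C \<Longrightarrow> X c = inj c"
    and \<rho>: "D.path_endo \<rho>" "\<rho> (omega_elt Q) = omega_elt Q" and \<sigma>: "D.path_endo \<sigma>"
    and inv: "\<And>x. x \<in> A \<Longrightarrow> \<sigma> (\<rho> x) = x" "\<And>x. x \<in> A \<Longrightarrow> \<rho> (\<sigma> x) = x"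
  defines "Y \<equiv> \<lambda>a. ev e X (\<rho> (arr a))"
    and "\<eta> \<equiv> \<lambda>a. t1 (ev (tri0 \<circ> e) (\<lambda>a. Tri (X a) (\<delta> a) 0 0) (\<rho> (arr a)))"
  shows "fac \<sigma> Y * (\<Sum>c\<in>C. Y c * proj c) = e i"
    and "a \<in> arcs (double Q) \<Longrightarrow>
      \<eta> a = (if tail (double Q) a = i then csc (arrow_sign a) (proj (star a) * fac \<sigma> Y) else 0)"
proof -
  have Y: "arep (double Q) e Y"
    unfolding Y_def by (rule D.arep_endo[OF \<rho>(1) finite_verts_double X(1)])
  let ?P = "\<Sum>c\<in>C. Y c * proj c" and ?R = "fac \<sigma> Y"
  have evY: "ev e Y (\<sigma> (arr a)) = X a" if a: "a \<in> arcs (double Q)" for a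
    using D.ev_endo[OF \<rho>(1) finite_verts_double X(1)
        D.endo_carrier[OF \<sigma> finite_verts_double D.arrow_in_carrier[OF a]]]
      inv(2)[OF D.arrow_in_carrier[OF a]] D.ev_arrow[OF X(1) a]
    by (simp add: Y_def)
  \<comment> \<open>Twisting Y back by \<sigma> returns X, whose map at i is the identity; so the
    map at i of Y times its factor is the identity.\<close>
  have PR: "?P * ?R = e i"
    using factor[OF Y \<sigma>] by (simp add: evY C_arc X(2) inj_proj)
  have main: "?R * ?P = e i \<and>
      (\<Sum>a\<in>arcs (double Q). arrow_sign a * ftrace (\<eta> a * d (star a))) =
      (\<Sum>c\<in>C. ftrace (proj c * ?R * d c))"
    if d: "corner (double Q) e d" for d
  proof -
    \<comment> \<open>Ys is the line through Y in direction d, and Zs its image under the inverse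
      twist: a polynomial curve through X whose velocity d' is the preimage of d.\<close>
    define Ys where "Ys = (\<lambda>a. linear_family (Y a) (d a))"
    define Zs where "Zs = (\<lambda>a. ev (cst \<circ> e) Ys (\<sigma> (arr a)))"
    define d' where "d' = (\<lambda>a. deriv_at 0 (Zs a))"
    have eo: "eval_at 0 \<circ> (cst \<circ> e) = e" "eval_at 0 \<circ> Ys = Y"
      by (auto simp: fun_eq_iff Ys_def)
    have Ys: "arep (double Q) (cst \<circ> e) Ys"
      using arep_change[OF arep_hom[OF calg_hom_cst X(1)] corner_linear[OF arep_corner[OF Y] d]]
      by (simp add: Ys_def)
    have Zs: "arep (double Q) (cst \<circ> e) Zs"
      unfolding Zs_def by (rule D.arep_endo[OF \<sigma> finite_verts_double Ys])
    have Zs0: "eval_at 0 (Zs a) = X a" if "a \<in> arcs (double Q)" for a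
      by (simp add: Zs_def hom_ev[OF calg_hom_eval_at] eo evY[OF that])
    let ?j = "\<lambda>M. Tri (eval_at 0 M) 0 (deriv_at 0 M) 0"
    have je: "?j \<circ> (cst \<circ> e) = tri0 \<circ> e"
      by (auto simp: fun_eq_iff tri0_def)
    \<comment> \<open>Twisting Zs by \<rho> gives the line Ys again; comparing first-order jets
      shows that the linearised twist takes d' to d.\<close>
    have jX: "ev (tri0 \<circ> e) (\<lambda>a. Tri (X a) 0 (d' a) 0) (\<rho> (arr a)) = Tri (Y a) 0 (d a) 0"
      if a: "a \<in> arcs (double Q)" for a
    proof -
      note ra = D.endo_carrier[OF \<rho>(1) finite_verts_double D.arrow_in_carrier[OF a]]
      have "ev (tri0 \<circ> e) (\<lambda>a. Tri (X a) 0 (d' a) 0) (\<rho> (arr a)) = ev (tri0 \<circ> e) (?j \<circ> Zs) (\<rho> (arr a))"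
        by (rule D.ev_cong[OF ra]) (simp add: Zs0 d'_def)
      also have "\<dots> = ?j (ev (cst \<circ> e) Zs (\<rho> (arr a)))"
        unfolding hom_ev[OF calg_hom_jet_snd] je ..
      also have "ev (cst \<circ> e) Zs (\<rho> (arr a)) = ev (cst \<circ> e) Ys (\<sigma> (\<rho> (arr a)))"
        unfolding Zs_def by (rule D.ev_endo[OF \<sigma> finite_verts_double Ys ra, symmetric])
      also have "\<dots> = Ys a"
        by (simp add: inv(1) D.arrow_in_carrier[OF a] D.ev_arrow[OF Ys a])
      finally show ?thesis by (simp add: Ys_def comp_def)
    qed
    have d': "corner (double Q) e d'"
      unfolding corner_def
    proof (intro ballI conjI)
      fix a assume a: "a \<in> arcs (double Q)"
      show "e (head (double Q) a) * d' a = d' a" "d' a * e (tail (double Q) a) = d' a"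
        using arg_cong[OF D.arep_head[OF Zs a], of "deriv_at 0"] arg_cong[OF D.arep_tail[OF Zs a], of "deriv_at 0"]
        by (simp_all add: deriv_at_mult d'_def)
    qed
    let ?U = "\<lambda>a. ev (tri0 \<circ> e) (\<lambda>a. Tri (X a) (\<delta> a) (d' a) 0) (\<rho> (arr a))"
    have U1: "t1 (?U a) = \<eta> a" for a
      using arg_cong[OF hom_ev[OF calg_hom_tri_fst, of "tri0 \<circ> e" "\<lambda>a. Tri (X a) (\<delta> a) (d' a) 0" "\<rho> (arr a)"], of t1]
      by (simp add: \<eta>_def comp_def tri0_def)
    have U2: "t2 (?U a) = d a" if "a \<in> arcs (double Q)" for a
      using arg_cong[OF hom_ev[OF calg_hom_tri_snd, of "tri0 \<circ> e" "\<lambda>a. Tri (X a) (\<delta> a) (d' a) 0" "\<rho> (arr a)"], of t2] jX[OF that]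
      by (simp add: comp_def tri0_def)
    \<comment> \<open>The linearised twist maps \<delta> to \<eta> and d' to d, so by symplecticity
      the pairing can be computed at X instead of Y, where \<delta> is explicit.\<close>
    have "(\<Sum>a\<in>arcs (double Q). arrow_sign a * ftrace (\<eta> a * d (star a))) =
        (\<Sum>a\<in>arcs (double Q). arrow_sign a * ftrace (\<delta> a * d' (star a)))"
      using symplectic[OF X(1) corner_\<delta> d' \<rho>] by (simp add: U1 U2)
    also have "\<dots> = (\<Sum>a\<in>arcs (double Q). if tail (double Q) a = i then ftrace (d' (star a) * proj (star a)) else 0)"
      by (intro sum.cong)
        (auto simp: \<delta>_def csc_mult_left ftrace_csc csc_complex_def ftrace_comm[of "proj _"] simp flip: mult.assoc)
    also have "\<dots> = (\<Sum>c\<in>C. ftrace (d' c * proj c))"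
      by (rule sum_sign_tail)
    also have "\<dots> = ftrace (deriv_at 0 (\<Sum>c\<in>C. Zs c * cst (proj c)))"
      by (simp add: deriv_at_sum deriv_at_mult d'_def ftrace_sum)
    \<comment> \<open>The pairing has become the trace of the derivative of the map at i along Zs.
      By \<open>factor\<close> this map is the one of Ys times a polynomial family, to which the
      product rule applies.\<close>
    also have "(\<Sum>c\<in>C. Zs c * cst (proj c)) = (\<Sum>c\<in>C. Ys c * cst (proj c)) * P.fac \<sigma> Ys"
      using P.factor[OF Ys \<sigma>] by (simp add: Zs_def)
    also have "deriv_at 0 \<dots> = (\<Sum>c\<in>C. d c * proj c) * eval_at 0 (P.fac \<sigma> Ys) + ?P * deriv_at 0 (P.fac \<sigma> Ys)"
      by (simp add: deriv_at_mult deriv_at_sum hom_sum[OF calg_hom_eval_at] hom_mult[OF calg_hom_eval_at] Ys_def)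
    also have hat0: "eval_at 0 (P.fac \<sigma> Ys) = ?R"
    proof -
      have h: "eval_at 0 \<circ> P.hat Ys = hat Y"
        by (auto simp: fun_eq_iff P.hat_def hat_def hom_mult[OF calg_hom_eval_at] hom_sum[OF calg_hom_eval_at] Ys_def)
      show ?thesis
        by (simp add: P.fac_def fac_def hom_mult[OF calg_hom_eval_at] hom_sum[OF calg_hom_eval_at]
            hom_ev[OF calg_hom_eval_at] eo h)
    qed
    finally have tr: "(\<Sum>a\<in>arcs (double Q). arrow_sign a * ftrace (\<eta> a * d (star a))) =
        ftrace ((\<Sum>c\<in>C. d c * proj c) * ?R) + ftrace (?P * deriv_at 0 (P.fac \<sigma> Ys))"
      unfolding ftrace_add .
    let ?I = "Ix i" and ?F = "P.fac \<sigma> Ys"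
    have fin: "finite ?I" by (simp add: finite_Ix i_in)
    have ci: "cst (e i) = funit ?I" by (simp add: e_funit i_in cst_funit fin)
    have hY: "arep (double Q) (cst \<circ> e) (P.hat Ys)" by (rule P.arep_hat[OF Ys])
    have Fc: "funit ?I * ?F = ?F" "?F * funit ?I = ?F"
      using P.sum_e_proj[OF D.arep_endo[OF \<sigma> finite_verts_double hY]] P.sum_proj_e
      by (simp_all add: P.fac_def flip: ci)
    \<comment> \<open>The incoming arrows of \<open>P.hat Ys\<close> are the inclusions, so the
      family is invertible over the polynomials and not merely at 0.\<close>
    have "?F * P.fac \<rho> (\<lambda>a. ev (cst \<circ> e) (P.hat Ys) (\<sigma> (arr a))) = funit ?I"
      using P.fac_right_inverse[OF hY _ \<sigma> \<rho>(1) inv(1)] by (simp add: P.fac_def P.hat_def C_head ci)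
    then obtain B where B: "fsupp B \<subseteq> ?I" "?F * B = funit ?I"
      using ring_inverse_corner[OF fin Fc] by blast
    note L = fmat_log_derivative[OF fin fsupp_corner[OF fin Fc] B]
    have RB: "?R * eval_at 0 B = e i"
      using arg_cong[OF B(2), of "eval_at 0"] by (simp add: hom_mult[OF calg_hom_eval_at] hat0 flip: ci)
    have BR: "eval_at 0 B * ?R = e i"
      using L(2) by (simp add: hat0 e_funit i_in)
    \<comment> \<open>A left and a right inverse of ?R coincide, so ?P is the value of B at 0 and
      the leftover trace is exactly the logarithmic derivative.\<close>
    have "?P = ?P * e i" by (simp add: sum_proj_e)
    also have "\<dots> = ?P * ?R * eval_at 0 B" by (simp add: mult.assoc RB)
    also have "\<dots> = eval_at 0 B * ?R * eval_at 0 B" by (simp add: PR BR)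
    also have "\<dots> = eval_at 0 B * e i" by (simp add: mult.assoc RB)
    also have "\<dots> = eval_at 0 B"
    proof (rule ent_eqI)
      fix x y
      show "ent (eval_at 0 B * e i) x y = ent (eval_at 0 B) x y"
        using B(1) by (cases "y \<in> fsupp B") (auto simp: ent_zero_outside e_funit i_in ent_mult_funit fin)
    qed
    finally have PB: "?P = eval_at 0 B" .
    have "(\<Sum>c\<in>C. ftrace (proj c * ?R * d c)) = ftrace ((\<Sum>c\<in>C. d c * proj c) * ?R)"
    proof -
      have "ftrace (proj c * ?R * d c) = ftrace (d c * proj c * ?R)" for c
        by (subst ftrace_comm) (simp add: mult.assoc)
      then show ?thesis by (simp add: sum_distrib_right ftrace_sum)
    qed
    then show ?thesis
      using tr L(1) RB by (simp add: PB)
  qed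
  \<comment> \<open>The first part of \<open>main\<close> does not mention d, so the zero direction
    extracts it.\<close>
  have "corner (double Q) e (\<lambda>_. 0)" by (simp add: corner_def)
  then show "?R * ?P = e i" using main by blast
  show "\<eta> a = (if tail (double Q) a = i then csc (arrow_sign a) (proj (star a) * ?R) else 0)"
    if a: "a \<in> arcs (double Q)"
  proof (rule ent_eqI)
    fix x y
    \<comment> \<open>The error in the claimed formula. It is tested on a direction supported on the
      single arrow \<open>star a\<close>. A matrix unit need not lie in that block; cutting it by
      the two idempotents makes it a tangent vector, and the trace against it still reads off the
      entry because \<zeta> a lies in the opposite block.\<close>
    define \<zeta> where "\<zeta> = (\<lambda>a. \<eta> a - (if tail (double Q) a = i then csc (arrow_sign a) (proj (star a) * ?R) else 0))"
    let ?E = "e (tail (double Q) a) * felem y x * e (head (double Q) a)"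
    define d where "d = (\<lambda>b. if b = star a then ?E else 0)"
    have h: "e (head (double Q) a) * e (head (double Q) a) = e (head (double Q) a)"
      and t: "e (tail (double Q) a) * e (tail (double Q) a) = e (tail (double Q) a)"
      using e_orth e_arc[OF a] by simp_all
    have "corner (double Q) e d"
      using h t by (auto simp: corner_def d_def mult.assoc) (simp flip: mult.assoc)
    then have 1: "(\<Sum>b\<in>arcs (double Q). arrow_sign b * ftrace (\<eta> b * d (star b))) =
        (\<Sum>c\<in>C. ftrace (proj c * ?R * d c))"
      using main by blast
    have "(\<Sum>b\<in>arcs (double Q). arrow_sign b * ftrace (\<zeta> b * d (star b))) =
        (\<Sum>b\<in>arcs (double Q). arrow_sign b * ftrace (\<eta> b * d (star b))) -
        (\<Sum>b\<in>arcs (double Q). if tail (double Q) b = i then ftrace (proj (star b) * ?R * d (star b)) else 0)"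
      unfolding sum_subtractf[symmetric]
    proof (intro sum.cong refl)
      fix b
      have "ftrace ((x - y) * z) = ftrace (x * z) - ftrace (y * z)" for x y z :: "('i, complex) fmat"
        using ftrace_add[of "(x - y) * z" "y * z"] by (simp flip: distrib_right)
      then show "arrow_sign b * ftrace (\<zeta> b * d (star b)) = arrow_sign b * ftrace (\<eta> b * d (star b)) -
          (if tail (double Q) b = i then ftrace (proj (star b) * ?R * d (star b)) else 0)"
        by (simp add: \<zeta>_def csc_mult_left ftrace_csc csc_complex_def right_diff_distrib flip: mult.assoc)
    qed
    also have "\<dots> = 0"
      using sum_sign_tail[of "\<lambda>c. ftrace (proj c * ?R * d c)"] 1 by simp
    also have "(\<Sum>b\<in>arcs (double Q). arrow_sign b * ftrace (\<zeta> b * d (star b))) =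
        (\<Sum>b\<in>arcs (double Q). if b = a then arrow_sign a * ftrace (\<zeta> a * ?E) else 0)"
    proof (intro sum.cong refl)
      fix b
      have "star b = star a \<longleftrightarrow> b = a" by (metis double_simps(2))
      then show "arrow_sign b * ftrace (\<zeta> b * d (star b)) = (if b = a then arrow_sign a * ftrace (\<zeta> a * ?E) else 0)"
        by (simp add: d_def)
    qed
    also have "\<dots> = arrow_sign a * ftrace (\<zeta> a * ?E)"
      using a by (simp add: double_def)
    finally have 2: "ftrace (\<zeta> a * ?E) = 0"
      by (cases a) auto
    have "arep (double Q) (tri0 \<circ> e) (\<lambda>a. Tri (X a) (\<delta> a) 0 0)"
      using arep_tri[OF X(1) corner_\<delta>, of "\<lambda>_. 0"] by (simp add: corner_def)
    note r = D.arep_endo[OF \<rho>(1) finite_verts_double this]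
    have t1: "t1 (tri0 z * U) = z * t1 U" "t1 (U * tri0 z) = t1 U * z" for z :: "('i, complex) fmat" and U
      by (simp_all add: tri0_def times_tri_def)
    have c\<eta>: "e (head (double Q) a) * \<eta> a = \<eta> a" "\<eta> a * e (tail (double Q) a) = \<eta> a"
      using arg_cong[OF D.arep_head[OF r a], of t1] arg_cong[OF D.arep_tail[OF r a], of t1]
      by (simp_all only: \<eta>_def o_apply t1)
    have Re: "?R * e i = ?R" unfolding fac_def by (rule sum_proj_e)
    have c\<zeta>: "e (head (double Q) a) * \<zeta> a = \<zeta> a" "\<zeta> a * e (tail (double Q) a) = \<zeta> a"
    proof -
      have 3: "e (head (double Q) a) * (proj (star a) * ?R) = proj (star a) * ?R"
        "proj (star a) * ?R * e (tail (double Q) a) = proj (star a) * ?R" if "tail (double Q) a = i"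
      proof -
        show "e (head (double Q) a) * (proj (star a) * ?R) = proj (star a) * ?R"
          using proj_corner(2)[OF star_in_C[OF a that]] by (simp flip: mult.assoc)
        show "proj (star a) * ?R * e (tail (double Q) a) = proj (star a) * ?R"
          using Re that by (simp add: mult.assoc)
      qed
      show "e (head (double Q) a) * \<zeta> a = \<zeta> a" "\<zeta> a * e (tail (double Q) a) = \<zeta> a"
        using c\<eta> 3 by (simp_all add: \<zeta>_def right_diff_distrib left_diff_distrib csc_mult_left csc_mult_right)
    qed
    have "ftrace (\<zeta> a * ?E) = ftrace (\<zeta> a * (e (tail (double Q) a) * felem y x) * e (head (double Q) a))"
      by (simp only: mult.assoc)
    also have "\<dots> = ftrace (e (head (double Q) a) * (\<zeta> a * (e (tail (double Q) a) * felem y x)))"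
      by (rule ftrace_comm)
    also have "\<dots> = ftrace (e (head (double Q) a) * (\<zeta> a * e (tail (double Q) a)) * felem y x)"
      by (simp only: mult.assoc)
    also have "\<dots> = ent (\<zeta> a) x y"
      unfolding c\<zeta> by (rule ftrace_felem)
    finally have "ent (\<zeta> a) x y = 0"
      using 2 by simp
    then show "ent (\<eta> a) x y = ent (if tail (double Q) a = i then csc (arrow_sign a) (proj (star a) * ?R) else 0) x y"
      by (simp add: \<zeta>_def ent_diff)
  qed
qed

end

text \<open>Higher-order unification eta-expands vectors; these rules would then push the expansion inwards.\<close>

declare plus_fun_apply [simp del] zero_fun_apply [simp del] minus_apply [simp del] uminus_apply [simp del]

lemmas fun_arith = plus_fun_apply zero_fun_apply minus_apply uminus_apply

section \<open>Linear maps between subspaces of function spaces\<close>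

lemma cscale_simps [simp]:
  "cscale c 0 = 0" "cscale 0 x = 0" "cscale 1 x = x" "cscale c (cscale d x) = cscale (c * d) x"
  "cscale c (- x) = - cscale c x" "cscale (- c) x = - cscale c x"
  by (auto simp: cscale_def fun_eq_iff fun_arith)

lemma cscale_add_right: "cscale c (x + y) = cscale c x + cscale c y"
  and cscale_add_left: "cscale (c + d) x = cscale c x + cscale d x"
  and cscale_diff_right: "cscale c (x - y) = cscale c x - cscale c y"
  by (auto simp: cscale_def fun_eq_iff algebra_simps fun_arith)

lemma cscale_sum_right: "cscale c (\<Sum>i\<in>I. f i) = (\<Sum>i\<in>I. cscale c (f i))"
  and cscale_sum_left: "cscale (\<Sum>i\<in>I. g i) x = (\<Sum>i\<in>I. cscale (g i) x)"
  by (induction I rule: infinite_finite_induct) (auto simp: cscale_add_right cscale_add_left)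

lemma fin_dim_subspace: "fin_dim_space U \<Longrightarrow> cvec.subspace U"
  by (auto simp: fin_dim_space_def)

lemma fin_dim_basis:
  assumes "fin_dim_space U"
  obtains B where "finite B" "B \<subseteq> U" "cvec.independent B" "cvec.span B = U"
proof -
  from assms obtain S where S: "finite S" "cvec.span S = U" by (auto simp: fin_dim_space_def)
  obtain B where B: "B \<subseteq> S" "cvec.independent B" "S \<subseteq> cvec.span B"
    using cvec.maximal_independent_subset by blast
  then have "cvec.span B = U"
    using S(2) by (metis cvec.span_mono cvec.span_span subset_antisym)
  then show ?thesis
    using that[of B] B S finite_subset cvec.span_superset by blast
qed

context
  fixes U :: "('b \<Rightarrow> complex) set" and W :: "('c \<Rightarrow> complex) set" and f
  assumes f: "linear_between U W f" and U: "cvec.subspace U"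
begin

lemma lin_in: "x \<in> U \<Longrightarrow> f x \<in> W"
  and lin_add: "x \<in> U \<Longrightarrow> y \<in> U \<Longrightarrow> f (x + y) = f x + f y"
  and lin_scale: "x \<in> U \<Longrightarrow> f (cscale c x) = cscale c (f x)"
  using f by (auto simp: linear_between_def)

lemma lin_zero: "f 0 = 0"
  using lin_scale[of 0 0] cvec.subspace_0[OF U] by simp

lemma lin_sum: "(\<And>i. i \<in> I \<Longrightarrow> x i \<in> U) \<Longrightarrow> f (\<Sum>i\<in>I. x i) = (\<Sum>i\<in>I. f (x i))"
  by (induction I rule: infinite_finite_induct) (auto simp: lin_zero lin_add cvec.subspace_sum[OF U])

lemma lin_span_eq:
  assumes g: "linear_between U W g" and B: "cvec.span B = U" "\<And>x. x \<in> B \<Longrightarrow> f x = g x" and x: "x \<in> U"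
  shows "f x = g x"
proof -
  have "x \<in> cvec.span B" using x B(1) by simp
  then have "x \<in> U \<and> f x = g x"
  proof (induction rule: cvec.span_induct_alt)
    case base
    have "g 0 = cscale 0 (g 0)"
      using g cvec.subspace_0[OF U] by (metis cscale_simps(1) cscale_simps(2) linear_between_def)
    then show ?case
      using lin_zero cvec.subspace_0[OF U] by simp
  next
    case (step c b y)
    have b: "b \<in> U" using step(1) B(1) cvec.span_base by blast
    then have "cscale c b \<in> U" by (rule cvec.subspace_scale[OF U])
    then show ?case
      using b step g B(2) cvec.subspace_add[OF U] by (simp add: lin_add lin_scale linear_between_def)
  qed
  then show ?thesis ..
qed

end

lemma linear_between_comp:
  "linear_between U W f \<Longrightarrow> linear_between W X g \<Longrightarrow> linear_between U X (g \<circ> f)"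
  by (auto simp: linear_between_def Pi_iff)

lemma subspace_image:
  assumes "linear_between U W f" "cvec.subspace U"
  shows "cvec.subspace (f ` U)"
proof (rule cvec.subspaceI)
  show "0 \<in> f ` U"
    using lin_zero[OF assms] cvec.subspace_0[OF assms(2)] by (metis imageI)
  show "x + y \<in> f ` U" if "x \<in> f ` U" "y \<in> f ` U" for x y
    using that lin_add[OF assms, symmetric] cvec.subspace_add[OF assms(2)] by auto
  show "cscale c x \<in> f ` U" if "x \<in> f ` U" for c x
    using that lin_scale[OF assms, symmetric] cvec.subspace_scale[OF assms(2)] by auto
qed

lemma fin_dim_image:
  assumes f: "linear_between U W f" and U: "fin_dim_space U"
  shows "fin_dim_space (f ` U)"
proof -
  obtain B where B: "finite B" "B \<subseteq> U" "cvec.span B = U"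
    using fin_dim_basis[OF U] by metis
  note s = fin_dim_subspace[OF U]
  have "f ` U \<subseteq> cvec.span (f ` B)"
  proof clarify
    fix x assume "x \<in> U"
    then have "x \<in> cvec.span B" using B by simp
    then have "x \<in> U \<and> f x \<in> cvec.span (f ` B)"
    proof (induction rule: cvec.span_induct_alt)
      case base
      then show ?case using lin_zero[OF f s] cvec.subspace_0[OF s] by (simp add: cvec.span_zero)
    next
      case (step c b y)
      have b: "b \<in> U" using step B by auto
      then have "cscale c b \<in> U" by (rule cvec.subspace_scale[OF s])
      then show ?case
        using b step cvec.subspace_add[OF s]
        by (simp add: lin_add[OF f s] lin_scale[OF f s] cvec.span_add cvec.span_scale cvec.span_base)
    qed
    then show "f x \<in> cvec.span (f ` B)" ..
  qed
  moreover have "cvec.span (f ` B) \<subseteq> f ` U"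
    using B by (intro cvec.span_minimal subspace_image[OF f s]) auto
  ultimately show ?thesis
    using B(1) by (auto simp: fin_dim_space_def)
qed

section \<open>The action of the path algebra on a representation\<close>

definition fam :: "('v, 'a) pre_digraph \<Rightarrow> ('v, 'a, 'b) quiver_rep \<Rightarrow> ('v \<Rightarrow> 'b \<Rightarrow> complex) \<Rightarrow> bool" where
  "fam G V w \<longleftrightarrow> (\<forall>v\<in>verts G. w v \<in> space V v)"

definition point_fam :: "'v \<Rightarrow> ('b \<Rightarrow> complex) \<Rightarrow> 'v \<Rightarrow> 'b \<Rightarrow> complex" where
  "point_fam v x = (\<lambda>_. 0)(v := x)"

lemma point_fam_simps [simp]: "point_fam v x v = x" "u \<noteq> v \<Longrightarrow> point_fam v x u = 0"
  by (simp_all add: point_fam_def)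

lemma rep_act_superset:
  assumes "finite A" "Poly_Mapping.keys x \<subseteq> A"
  shows "rep_act G V x w v = (\<Sum>p\<in>A. if path_end G p = v
    then cscale (Poly_Mapping.lookup x p) (fold (amap V) (snd p) (w (fst p))) else 0)"
proof -
  have "rep_act G V x w v = (\<Sum>p\<in>Poly_Mapping.keys x. if path_end G p = v
    then cscale (Poly_Mapping.lookup x p) (fold (amap V) (snd p) (w (fst p))) else 0)"
    unfolding rep_act_def by (rule sum.inter_filter) simp
  also have "\<dots> = (\<Sum>p\<in>A. if path_end G p = v
    then cscale (Poly_Mapping.lookup x p) (fold (amap V) (snd p) (w (fst p))) else 0)"
    using assms by (intro sum.mono_neutral_left) (auto simp: in_keys_iff)
  finally show ?thesis .
qed

lemma rep_act_zero [simp]: "rep_act G V 0 w v = 0"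
  by (simp add: rep_act_def)

lemma rep_act_add: "rep_act G V (x + y) w v = rep_act G V x w v + rep_act G V y w v"
proof -
  let ?A = "Poly_Mapping.keys x \<union> Poly_Mapping.keys y \<union> Poly_Mapping.keys (x + y)"
  show ?thesis
    by (simp add: rep_act_superset[of ?A] le_supI1 le_supI2 flip: sum.distrib)
      (rule sum.cong, auto simp: cscale_add_left lookup_add)
qed

lemma rep_act_uminus: "rep_act G V (- x) w v = - rep_act G V x w v"
  using rep_act_add[of G V x "- x" w v] by (simp add: eq_neg_iff_add_eq_0 add.commute)

lemma rep_act_diff: "rep_act G V (x - y) w v = rep_act G V x w v - rep_act G V y w v"
  using rep_act_add[of G V x "- y" w v] by (simp add: rep_act_uminus)

lemma rep_act_sum: "rep_act G V (\<Sum>i\<in>I. f i) w v = (\<Sum>i\<in>I. rep_act G V (f i) w v)"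
  by (induction I rule: infinite_finite_induct) (auto simp: rep_act_add)

lemma rep_act_single: "rep_act G V (Poly_Mapping.single p c) w v =
    (if path_end G p = v then cscale c (fold (amap V) (snd p) (w (fst p))) else 0)"
  by (subst rep_act_superset[of "{p}"]) auto

lemma rep_act_idem: "rep_act G V (idem_elt u) w v = (if u = v then w v else 0)"
  by (simp add: idem_elt_def rep_act_single path_end_def pre_digraph.awalk_verts.simps)

lemma rep_act_vertex_comb:
  assumes "finite (verts G)" "v \<in> verts G"
  shows "rep_act G V (vertex_comb G c) w v = cscale (c v) (w v)"
  using assms by (simp add: vertex_comb_def rep_act_sum rep_act_single path_end_def pre_digraph.awalk_verts.simps)

context wf_digraph
begin

lemma rep_act_arrow: "rep_act G V (arrow_elt G a) w v = (if head G a = v then amap V a (w (tail G a)) else 0)"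
  using path_end_snoc[of "tail G a" "[]" a] by (simp add: arrow_elt_def rep_act_single)

lemma rep_act_cong:
  assumes "x \<in> carrier (path_algebra G)" "\<And>v. v \<in> verts G \<Longrightarrow> w v = w' v"
  shows "rep_act G V x w = rep_act G V x w'"
proof -
  have "w (fst p) = w' (fst p)" if "p \<in> Poly_Mapping.keys x" for p
    using assms(1) path_start_in_verts[of p] that by (intro assms(2)) (auto simp: pa_in_carrier)
  then show ?thesis
    unfolding rep_act_def by (intro ext sum.cong) auto
qed

context
  fixes V :: "('a, 'b, 'c) quiver_rep"
  assumes V: "is_rep G V"
begin

lemma rep_subspace: "v \<in> verts G \<Longrightarrow> cvec.subspace (space V v)"
  and rep_arrow: "a \<in> arcs G \<Longrightarrow> linear_between (space V (tail G a)) (space V (head G a)) (amap V a)"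
  using V by (auto simp: is_rep_def intro: fin_dim_subspace)

lemma rep_zero_in: "v \<in> verts G \<Longrightarrow> 0 \<in> space V v"
  by (rule cvec.subspace_0[OF rep_subspace])

lemma path_linear:
  assumes "p \<in> paths G"
  shows "linear_between (space V (fst p)) (space V (path_end G p)) (fold (amap V) (snd p))"
  using assms
proof (induction rule: path_induct)
  case (Nil u)
  then show ?case by (auto simp: linear_between_def)
next
  case (snoc u p a)
  then show ?case
    using linear_between_comp[OF snoc(4)[unfolded snoc(3)] rep_arrow[OF snoc(2)]] by (simp add: comp_def)
qed

lemma path_zero: "p \<in> paths G \<Longrightarrow> fold (amap V) (snd p) 0 = 0"
  by (rule lin_zero[OF path_linear rep_subspace[OF path_start_in_verts]])

lemma rep_act_in:
  assumes x: "x \<in> carrier (path_algebra G)" and w: "fam G V w" and v: "v \<in> verts G"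
  shows "rep_act G V x w v \<in> space V v"
  using x
proof (induction rule: carrier_induct)
  case (single p c)
  have "w (fst p) \<in> space V (fst p)"
    using w path_start_in_verts[OF single] by (auto simp: fam_def)
  then show ?case
    using lin_in[OF path_linear[OF single]] rep_subspace[OF v] rep_zero_in[OF v] cvec.subspace_scale
      path_start_in_verts[OF single] rep_subspace
    by (auto simp: rep_act_single)
qed (use rep_subspace[OF v] rep_zero_in[OF v] in \<open>auto simp: rep_act_add cvec.subspace_add\<close>)

lemma fam_rep_act: "x \<in> carrier (path_algebra G) \<Longrightarrow> fam G V w \<Longrightarrow> fam G V (rep_act G V x w)"
  by (simp add: fam_def rep_act_in[unfolded fam_def])

lemma fam_point: "v \<in> verts G \<Longrightarrow> x \<in> space V v \<Longrightarrow> fam G V (point_fam v x)"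
  by (auto simp: fam_def point_fam_def rep_zero_in)

lemma rep_act_fam_add:
  assumes "x \<in> carrier (path_algebra G)" "fam G V w" "fam G V w'"
  shows "rep_act G V x (\<lambda>v. w v + w' v) v = rep_act G V x w v + rep_act G V x w' v"
  using assms(1)
proof (induction rule: carrier_induct)
  case (single p c)
  note u = path_start_in_verts[OF single]
  then have "w (fst p) \<in> space V (fst p)" "w' (fst p) \<in> space V (fst p)"
    using assms(2,3) by (auto simp: fam_def)
  then show ?case
    using lin_add[OF path_linear[OF single] rep_subspace[OF u]]
    by (auto simp: rep_act_single cscale_add_right)
qed (auto simp: rep_act_add)

lemma rep_act_fam_scale:
  assumes "x \<in> carrier (path_algebra G)" "fam G V w"
  shows "rep_act G V x (\<lambda>v. cscale c (w v)) v = cscale c (rep_act G V x w v)"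
  using assms(1)
proof (induction rule: carrier_induct)
  case (single p d)
  note u = path_start_in_verts[OF single]
  then have "w (fst p) \<in> space V (fst p)"
    using assms(2) by (auto simp: fam_def)
  then show ?case
    using lin_scale[OF path_linear[OF single] rep_subspace[OF u]]
    by (auto simp: rep_act_single mult.commute)
qed (auto simp: rep_act_add cscale_add_right)

lemma rep_act_linear:
  assumes "x \<in> carrier (path_algebra G)" "u \<in> verts G" "v \<in> verts G"
  shows "linear_between (space V u) (space V v) (\<lambda>y. rep_act G V x (point_fam u y) v)"
proof -
  have "point_fam u (y + z) = (\<lambda>v. point_fam u y v + point_fam u z v)"
    "point_fam u (cscale c y) = (\<lambda>v. cscale c (point_fam u y v))" for y z :: "'c \<Rightarrow> complex" and c
    by (auto simp: point_fam_def)
  then show ?thesis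
    using assms by (auto simp: linear_between_def rep_act_in fam_point rep_act_fam_add rep_act_fam_scale)
qed

lemma rep_act_mult:
  assumes x: "x \<in> carrier (path_algebra G)" and y: "y \<in> carrier (path_algebra G)" and w: "fam G V w"
  shows "rep_act G V (pa_mult G x y) w v = rep_act G V x (rep_act G V y w) v"
  using x
proof (induction rule: carrier_induct)
  case (single p c)
  note p = single
  from y show ?case
  proof (induction rule: carrier_induct)
    case (single q d)
    have q: "path_end G (fst q, snd q @ snd p) = path_end G p" if "path_end G q = fst p"
      using path_end_append[of G "fst q" "snd q" "fst p" "snd p"] that by simp
    have "w (fst q) \<in> space V (fst q)"
      using w path_start_in_verts[OF single] by (auto simp: fam_def)
    then have i: "fold (amap V) (snd q) (w (fst q)) \<in> space V (path_end G q)"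
      using lin_in[OF path_linear[OF single] rep_subspace[OF path_start_in_verts[OF single]]] by simp
    show ?case
    proof (cases "path_end G q = fst p")
      case True
      then show ?thesis
        using i q lin_scale[OF path_linear[OF p] rep_subspace[OF path_start_in_verts[OF p]]]
        by (simp add: pa_mult_single path_mult_def rep_act_single)
    next
      case False
      then show ?thesis
        using path_zero[OF p] by (simp add: pa_mult_single path_mult_def rep_act_single)
    qed
  next
    case (add x y)
    then show ?case
      using rep_act_fam_add[OF single_in_carrier[OF p] fam_rep_act[OF add(1) w] fam_rep_act[OF add(2) w], of c v]
      by (simp add: pa_mult_add_right rep_act_add)
  next
    have "fam G V (\<lambda>_. 0)" by (simp add: fam_def rep_zero_in)
    from rep_act_fam_scale[OF single_in_carrier[OF p, of c] this, of 0 v]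
    show "rep_act G V (pa_mult G (Poly_Mapping.single p c) 0) w v =
        rep_act G V (Poly_Mapping.single p c) (rep_act G V 0 w) v"
      by (simp add: rep_act_def[of G V 0])
  qed
qed (auto simp: pa_mult_add_left rep_act_add)

lemma rep_act_morphism:
  assumes x: "x \<in> carrier (path_algebra G)" and w: "fam G V w" and W: "is_rep G W"
    and \<phi>: "\<And>v. v \<in> verts G \<Longrightarrow> linear_between (space V v) (space W v) (\<phi> v)"
    and nat: "\<And>a y. a \<in> arcs G \<Longrightarrow> y \<in> space V (tail G a) \<Longrightarrow>
      \<phi> (head G a) (amap V a y) = amap W a (\<phi> (tail G a) y)"
    and v: "v \<in> verts G"
  shows "\<phi> v (rep_act G V x w v) = rep_act G W x (\<lambda>v. \<phi> v (w v)) v"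
  using x
proof (induction rule: carrier_induct)
  case (single p c)
  note lin = \<phi>[THEN lin_scale, OF _ rep_subspace] \<phi>[THEN lin_zero, OF _ rep_subspace]
  have "w (fst p) \<in> space V (fst p)"
    using w path_start_in_verts[OF single] by (auto simp: fam_def)
  with single have "fold (amap V) (snd p) (w (fst p)) \<in> space V (path_end G p) \<and>
      \<phi> (path_end G p) (fold (amap V) (snd p) (w (fst p))) = fold (amap W) (snd p) (\<phi> (fst p) (w (fst p)))"
  proof (induction rule: path_induct)
    case (snoc u p a)
    then show ?case
      using nat[OF snoc(2)] lin_in[OF rep_arrow[OF snoc(2)] rep_subspace] by simp
  qed simp
  then show ?case
    using lin v by (auto simp: rep_act_single)
next
  case (add x y)
  then show ?case
    using lin_add[OF \<phi>[OF v] rep_subspace[OF v]] rep_act_in[OF _ w v] by (simp add: rep_act_add)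
qed (simp add: lin_zero[OF \<phi>[OF v] rep_subspace[OF v]])

end

end

section \<open>Twisted representations\<close>

definition tw :: "('v, 'a) pre_digraph \<Rightarrow>
    ((('v, 'a) path \<Rightarrow>\<^sub>0 complex) \<Rightarrow> (('v, 'a) path \<Rightarrow>\<^sub>0 complex)) \<Rightarrow>
    ('v, 'a, 'b) quiver_rep \<Rightarrow> ('v, 'a, 'b) quiver_rep" where
  "tw G \<rho> V = \<lparr>space = space V,
     amap = (\<lambda>a x. rep_act G V (\<rho> (arrow_elt G a)) (point_fam (tail G a) x) (head G a))\<rparr>"

lemma twist_rep_eq: "twist_rep Q \<sigma> V = tw (double Q) (inv_into (carrier (path_algebra (double Q))) \<sigma>) V"
  by (simp add: twist_rep_def tw_def point_fam_def)

lemma space_tw [simp]: "space (tw G \<rho> V) = space V"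
  by (simp add: tw_def)

context wf_digraph
begin

context
  fixes \<rho> :: "(('a, 'b) path \<Rightarrow>\<^sub>0 complex) \<Rightarrow> (('a, 'b) path \<Rightarrow>\<^sub>0 complex)"
    and V :: "('a, 'b, 'c) quiver_rep"
  assumes \<rho>: "path_endo \<rho>" and fin: "finite (verts G)" and V: "is_rep G V"
begin

lemma is_rep_tw: "is_rep G (tw G \<rho> V)"
  using V rep_act_linear[OF V endo_carrier[OF \<rho> fin arrow_in_carrier]]
  by (auto simp: is_rep_def tw_def)

text \<open>The twist records only how the arrows act. That every x then acts as \<rho> x did on the
  old module follows along paths, because \<rho> is multiplicative and fixes the
  idempotents.\<close>

lemma rep_act_tw:
  assumes x: "x \<in> carrier (path_algebra G)" and w: "fam G V w" and v: "v \<in> verts G"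
  shows "rep_act G (tw G \<rho> V) x w v = rep_act G V (\<rho> x) w v"
  using x
proof (induction rule: carrier_induct)
  case (single p c)
  have "\<forall>v\<in>verts G. rep_act G V (\<rho> (Poly_Mapping.single p 1)) w v =
      (if path_end G p = v then fold (amap (tw G \<rho> V)) (snd p) (w (fst p)) else 0)"
    using single
  proof (induction rule: path_induct)
    case (Nil u)
    then show ?case
      using endo_idem[OF \<rho> fin Nil] by (simp add: idem_elt_def rep_act_single)
  next
    case (snoc u p a)
    let ?r = "rep_act G V (\<rho> (Poly_Mapping.single (u, p) 1)) w"
      and ?t = "fold (amap (tw G \<rho> V)) p (w u)"
    have c: "Poly_Mapping.single (u, p) 1 \<in> carrier (path_algebra G)" "arrow_elt G a \<in> carrier (path_algebra G)"
      "idem_elt (head G a) \<in> carrier (path_algebra G)"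
      using snoc by (auto intro: single_in_carrier arrow_in_carrier idem_in_carrier)
    note \<rho>c = endo_carrier[OF \<rho> fin c(1)] endo_carrier[OF \<rho> fin c(2)]
    have "rep_act G V (\<rho> (Poly_Mapping.single (u, p @ [a]) 1)) w v =
        (if head G a = v then fold (amap (tw G \<rho> V)) (p @ [a]) (w u) else 0)" if v: "v \<in> verts G" for v
    proof -
      have "rep_act G V (\<rho> (Poly_Mapping.single (u, p @ [a]) 1)) w v =
          rep_act G V (\<rho> (arrow_elt G a)) ?r v"
        using snoc by (subst single_snoc)
          (simp_all add: paths_snoc_iff endo_mult[OF \<rho> fin c(2,1)] rep_act_mult[OF V \<rho>c(2,1) w])
      also have "rep_act G V (\<rho> (arrow_elt G a)) ?r v =
          rep_act G V (\<rho> (arrow_elt G a)) (point_fam (tail G a) ?t) v"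
        using snoc(3,4) by (intro fun_cong[OF rep_act_cong[OF \<rho>c(2)]]) (auto simp: point_fam_def)
      \<comment> \<open>The image of an arrow under \<rho> is still supported on paths ending at the
        head of that arrow; inserting the idempotent makes the components at other vertices
        vanish.\<close>
      also have "\<dots> = rep_act G V (pa_mult G (idem_elt (head G a)) (\<rho> (arrow_elt G a))) (point_fam (tail G a) ?t) v"
        using endo_mult[OF \<rho> fin c(3,2)] snoc(2) by (simp add: endo_idem[OF \<rho> fin] arrow_idem)
      also have "\<dots> = (if head G a = v then rep_act G V (\<rho> (arrow_elt G a)) (point_fam (tail G a) ?t) v else 0)"
      proof -
        have "?t \<in> space V (tail G a)"
        proof -
          have "w u \<in> space V u" using w path_start_in_verts[OF snoc(1)] by (auto simp: fam_def)
          then show ?thesis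
            using lin_in[OF path_linear[OF is_rep_tw snoc(1)]] rep_subspace[OF V] path_start_in_verts[OF snoc(1)] snoc(3)
            by simp
        qed
        then have "fam G V (point_fam (tail G a) ?t)"
          using snoc(2) by (intro fam_point[OF V]) auto
        then show ?thesis
          using rep_act_mult[OF V c(3) \<rho>c(2)] by (simp add: rep_act_idem)
      qed
      finally show ?thesis by (auto simp: tw_def)
    qed
    then show ?case by simp
  qed
  then have 1: "rep_act G V (\<rho> (Poly_Mapping.single p 1)) w v =
      (if path_end G p = v then fold (amap (tw G \<rho> V)) (snd p) (w (fst p)) else 0)"
    using v by blast
  have "rep_act G V (\<rho> (Poly_Mapping.single p c)) w v =
      rep_act G V (pa_mult G (vertex_comb G (\<lambda>_. c)) (\<rho> (Poly_Mapping.single p 1))) w v"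
    using endo_map[OF \<rho> fin single_in_carrier[OF single], of c 1]
      pa_mult_scalar[OF endo_carrier[OF \<rho> fin single_in_carrier[OF single, of 1]] fin, of c]
    by (simp add: map_single)
  also have "\<dots> = cscale c (rep_act G V (\<rho> (Poly_Mapping.single p 1)) w v)"
    using rep_act_mult[OF V vertex_comb_in_carrier endo_carrier[OF \<rho> fin single_in_carrier[OF single]] w]
    by (simp add: rep_act_vertex_comb[OF fin v])
  finally show ?case
    by (simp add: 1 rep_act_single)
qed (auto simp: endo_add[OF \<rho> fin] endo_zero[OF \<rho> fin] rep_act_add)

end

end

section \<open>Modules over the deformed preprojective algebra\<close>

text \<open>The vertices are kept apart because their relations serve different purposes: the one at
  i recovers the space at i, while those elsewhere are transferred with a changed parameter.\<close>

definition moment :: "('v, 'a) pre_digraph \<Rightarrow> ('v \<Rightarrow> complex) \<Rightarrow> ('v, 'a darrow, 'b) quiver_rep \<Rightarrow> 'v \<Rightarrow> bool" where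
  "moment Q \<tau> V v \<longleftrightarrow> (\<forall>x\<in>space V v.
     (\<Sum>a\<in>in_arrows Q v. cscale (arrow_sign a) (amap V a (amap V (star a) x))) = cscale (\<tau> v) x)"

context fin_digraph
begin

lemma rep_act_omega:
  assumes V: "is_rep (double G) V" and w: "fam (double G) V w" and v: "v \<in> verts G"
  shows "rep_act (double G) V (omega_elt G) w v =
    (\<Sum>a\<in>in_arrows G v. cscale (arrow_sign a) (amap V a (amap V (star a) (w v))))"
proof -
  interpret D: wf_digraph "double G" by (rule wf_double)
  let ?f = "\<lambda>a. if head (double G) a = v then cscale (arrow_sign a) (amap V a (amap V (star a) (w v))) else 0"
  have z: "amap V a 0 = 0" if "a \<in> arcs (double G)" for a
    using that lin_zero[OF D.rep_arrow[OF V that] D.rep_subspace[OF V]] D.tail_in_verts[OF that] by simp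
  have "rep_act (double G) V (pa_mult (double G) (arrow_elt (double G) a) (arrow_elt (double G) (star a))) w v =
      (if head (double G) a = v then amap V a (amap V (star a) (w v)) else 0)"
    if a: "a \<in> arcs (double G)" for a
    using a by (subst D.rep_act_mult[OF V _ _ w]) (auto simp: D.arrow_in_carrier D.rep_act_arrow)
  from this[of "Arr _"] this[of "Star _"]
  have "rep_act (double G) V (omega_elt G) w v = (\<Sum>a\<in>arcs G. ?f (Arr a) + ?f (Star a))"
    unfolding omega_elt_def rep_act_sum rep_act_diff
    by (intro sum.cong) (auto simp: double_def)
  also have "\<dots> = (\<Sum>a\<in>arcs (double G). ?f a)"
    by (rule sum_double[OF finite_arcs, symmetric])
  finally show ?thesis
    by (simp only: sum_in_arrows[OF finite_arcs])
qed

lemma annihilator_ideal: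
  assumes V: "is_rep (double G) V"
  shows "ideal {x \<in> carrier (path_algebra (double G)). \<forall>w. fam (double G) V w \<longrightarrow>
    (\<forall>v\<in>verts G. rep_act (double G) V x w v = 0)} (path_algebra (double G))" (is "ideal ?J ?R")
proof -
  interpret D: wf_digraph "double G" by (rule wf_double)
  interpret R: ring ?R by (rule ring_path_algebra[OF fin_digraph_double[OF fin_digraph_axioms]])
  have R [simp]: "monoid.mult ?R = pa_mult (double G)" "add ?R = (+)" "zero ?R = 0"
    by (simp_all add: path_algebra_def)
  have inv: "\<ominus>\<^bsub>?R\<^esub> x = - x" if "x \<in> carrier ?R" for x
    by (rule R.minus_equality) (use that in \<open>auto simp: pa_in_carrier\<close>)
  have m: "- x \<in> carrier ?R" if "x \<in> carrier ?R" for x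
    using that by (simp add: pa_in_carrier)
  show ?thesis
  proof (rule idealI)
    show "ring ?R" by (rule R.ring_axioms)
    show "subgroup ?J (add_monoid ?R)"
    proof (rule R.add.subgroupI)
      have "0 \<in> ?J" using R.zero_closed by simp
      then show "?J \<noteq> {}" by blast
      show "\<ominus>\<^bsub>?R\<^esub> x \<in> ?J" if "x \<in> ?J" for x
        using that inv[of x] m[of x] by (auto simp: rep_act_uminus)
    qed (auto simp: rep_act_add intro: D.add_in_carrier)
    show "x \<otimes>\<^bsub>?R\<^esub> a \<in> ?J" if "a \<in> ?J" "x \<in> carrier ?R" for a x
    proof -
      have "rep_act (double G) V x (rep_act (double G) V a w) v = 0"
        if "fam (double G) V w" "v \<in> verts G" for w v
      proof -
        have "rep_act (double G) V x (rep_act (double G) V a w) = rep_act (double G) V x (\<lambda>v. cscale 0 (w v))"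
          using \<open>a \<in> ?J\<close> \<open>x \<in> carrier ?R\<close> that by (intro D.rep_act_cong) auto
        then show ?thesis
          using D.rep_act_fam_scale[OF V \<open>x \<in> carrier ?R\<close> that(1), of 0 v] by simp
      qed
      then show ?thesis
        using that by (auto simp: D.pa_mult_in_carrier D.rep_act_mult[OF V])
    qed
    show "a \<otimes>\<^bsub>?R\<^esub> x \<in> ?J" if "a \<in> ?J" "x \<in> carrier ?R" for a x
      using that by (auto simp: D.pa_mult_in_carrier D.rep_act_mult[OF V] D.fam_rep_act[OF V])
  qed
qed

text \<open>The elements annihilating V form an ideal, so the whole two-sided ideal acts by zero
  once its generator does. Testing the generator on families concentrated at one vertex gives the
  relations vertex by vertex.\<close>

lemma preprojective_iff:
  "is_preprojective_module G \<tau> V \<longleftrightarrow> is_rep (double G) V \<and> (\<forall>v\<in>verts G. moment G \<tau> V v)"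
proof (cases "is_rep (double G) V")
  case V: True
  interpret D: wf_digraph "double G" by (rule wf_double)
  let ?R = "path_algebra (double G)"
  let ?g = "omega_elt G - vertex_comb (double G) \<tau>"
  interpret R: ring ?R by (rule ring_path_algebra[OF fin_digraph_double[OF fin_digraph_axioms]])
  have g: "?g \<in> carrier ?R"
    using D.add_in_carrier[OF omega_in_carrier, of "- vertex_comb (double G) \<tau>"] D.vertex_comb_in_carrier
    by (simp add: pa_in_carrier)
  have act: "rep_act (double G) V ?g w v = (\<Sum>a\<in>in_arrows G v. cscale (arrow_sign a) (amap V a (amap V (star a) (w v))))
      - cscale (\<tau> v) (w v)" if "fam (double G) V w" "v \<in> verts G" for w v
    using that by (simp add: rep_act_diff rep_act_omega[OF V] rep_act_vertex_comb)
  have "is_preprojective_module G \<tau> V \<longleftrightarrow> (\<forall>w. fam (double G) V w \<longrightarrow> (\<forall>v\<in>verts G. rep_act (double G) V ?g w v = 0))"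
  proof
    show "is_preprojective_module G \<tau> V \<Longrightarrow> \<forall>w. fam (double G) V w \<longrightarrow> (\<forall>v\<in>verts G. rep_act (double G) V ?g w v = 0)"
      using R.genideal_self[of "{?g}"] g
      by (auto simp: is_preprojective_module_def preprojective_ideal_def fam_def)
    assume *: "\<forall>w. fam (double G) V w \<longrightarrow> (\<forall>v\<in>verts G. rep_act (double G) V ?g w v = 0)"
    have "preprojective_ideal G \<tau> \<subseteq> {x \<in> carrier ?R. \<forall>w. fam (double G) V w \<longrightarrow>
        (\<forall>v\<in>verts G. rep_act (double G) V x w v = 0)}"
      unfolding preprojective_ideal_def
      by (rule R.genideal_minimal[OF annihilator_ideal[OF V]]) (use * g in auto)
    then show "is_preprojective_module G \<tau> V"
      using V by (auto simp: is_preprojective_module_def fam_def)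
  qed
  also have "\<dots> \<longleftrightarrow> (\<forall>v\<in>verts G. moment G \<tau> V v)"
  proof safe
    fix v assume *: "\<forall>w. fam (double G) V w \<longrightarrow> (\<forall>v\<in>verts G. rep_act (double G) V ?g w v = 0)"
      and v: "v \<in> verts G"
    show "moment G \<tau> V v"
      unfolding moment_def
    proof
      fix x assume "x \<in> space V v"
      then have f: "fam (double G) V (point_fam v x)"
        using D.fam_point[OF V] v by simp
      show "(\<Sum>a\<in>in_arrows G v. cscale (arrow_sign a) (amap V a (amap V (star a) x))) = cscale (\<tau> v) x"
        using * f v act[OF f v] by auto
    qed
  qed (auto simp: act moment_def fam_def)
  finally show ?thesis using V by simp
qed (simp add: is_preprojective_module_def)

lemma preprojective_tw:
  assumes V: "is_preprojective_module G \<tau> V"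
    and \<rho>: "wf_digraph.path_endo (double G) \<rho>" "\<rho> (omega_elt G) = omega_elt G"
  shows "is_preprojective_module G \<tau> (tw (double G) \<rho> V)"
proof -
  interpret D: wf_digraph "double G" by (rule wf_double)
  have fin: "finite (verts (double G))" by simp
  have r: "is_rep (double G) V" and m: "\<And>v. v \<in> verts G \<Longrightarrow> moment G \<tau> V v"
    using V by (auto simp: preprojective_iff)
  note t = D.is_rep_tw[OF \<rho>(1) fin r]
  have "moment G \<tau> (tw (double G) \<rho> V) v" if v: "v \<in> verts G" for v
    unfolding moment_def
  proof
    fix x assume x: "x \<in> space (tw (double G) \<rho> V) v"
    have f: "fam (double G) V (point_fam v x)"
      using D.fam_point[OF r] v x by simp
    then have f': "fam (double G) (tw (double G) \<rho> V) (point_fam v x)"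
      by (simp add: fam_def)
    show "(\<Sum>a\<in>in_arrows G v. cscale (arrow_sign a)
        (amap (tw (double G) \<rho> V) a (amap (tw (double G) \<rho> V) (star a) x))) = cscale (\<tau> v) x"
      using rep_act_omega[OF t f' v] rep_act_omega[OF r f v] D.rep_act_tw[OF \<rho>(1) fin r omega_in_carrier f, of v]
        m[OF v] x v by (simp add: \<rho>(2) moment_def)
  qed
  then show ?thesis using t by (simp add: preprojective_iff)
qed

end

section \<open>Representations that agree away from a vertex\<close>

lemma linear_bij_inverse:
  assumes f: "linear_between U W f" "bij_betw f U W" and U: "cvec.subspace U"
  shows "linear_between W U (inv_into U f)" "bij_betw (inv_into U f) W U"
    "x \<in> U \<Longrightarrow> inv_into U f (f x) = x" "y \<in> W \<Longrightarrow> f (inv_into U f y) = y"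
proof -
  have inj: "inj_on f U" and W: "f ` U = W" using f(2) by (auto simp: bij_betw_def)
  show inv: "x \<in> U \<Longrightarrow> inv_into U f (f x) = x" for x using inj by simp
  show "y \<in> W \<Longrightarrow> f (inv_into U f y) = y" using f_inv_into_f[of y f U] W by simp
  show "bij_betw (inv_into U f) W U" using f(2) by (rule bij_betw_inv_into)
  have "inv_into U f (f x + f y) = x + y" if "x \<in> U" "y \<in> U" for x y
    using inv[of "x + y"] that lin_add[OF f(1) U] cvec.subspace_add[OF U] by simp
  moreover have "inv_into U f (cscale c (f x)) = cscale c x" if "x \<in> U" for x c
    using inv[of "cscale c x"] that lin_scale[OF f(1) U] cvec.subspace_scale[OF U] by simp
  ultimately show "linear_between W U (inv_into U f)"
    using inv unfolding linear_between_def W[symmetric] by (auto simp: inv_into_into)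
qed

lemma linear_between_sum:
  assumes "cvec.subspace W" "\<And>i. i \<in> I \<Longrightarrow> linear_between U W (f i)"
  shows "linear_between U W (\<lambda>x. \<Sum>i\<in>I. f i x)"
proof -
  have "f i x \<in> W" "y \<in> U \<Longrightarrow> f i (x + y) = f i x + f i y" "f i (cscale c x) = cscale c (f i x)"
    if "i \<in> I" "x \<in> U" for i x y c
    using assms(2)[OF that(1)] that(2) by (auto simp: linear_between_def)
  then show ?thesis
    unfolding linear_between_def
    by (auto simp: cscale_sum_right simp flip: sum.distrib intro!: cvec.subspace_sum[OF assms(1)] sum.cong)
qed

lemma linear_between_scale:
  assumes "cvec.subspace W" "linear_between U W f"
  shows "linear_between U W (\<lambda>x. cscale c (f x))"
  using assms unfolding linear_between_def
  by (auto simp: cscale_add_right mult.commute intro: cvec.subspace_scale)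

text \<open>Unique decomposition is split into existence and triviality of zero sums, the form in
  which it can be transported. Extensionality of the choice functions only pins down their values
  from n on.\<close>

lemma direct_sum_iff:
  fixes U :: "nat \<Rightarrow> ('b \<Rightarrow> complex) set"
  assumes U: "\<And>k. k < n \<Longrightarrow> cvec.subspace (U k)" and S: "0 \<in> S"
  shows "(\<forall>x\<in>S. \<exists>!u. u \<in> (\<Pi>\<^sub>E k\<in>{..<n}. U k) \<and> x = (\<Sum>k<n. u k)) \<longleftrightarrow>
    (\<forall>x\<in>S. \<exists>u. (\<forall>k<n. u k \<in> U k) \<and> x = (\<Sum>k<n. u k)) \<and>
    (\<forall>u. (\<forall>k<n. u k \<in> U k) \<and> (\<Sum>k<n. u k) = 0 \<longrightarrow> (\<forall>k<n. u k = 0))" (is "?L \<longleftrightarrow> ?R1 \<and> ?R2")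
proof
  assume L: ?L
  have ?R1 using L by (fastforce simp: PiE_iff)
  moreover have ?R2
  proof (intro allI impI)
    fix u k assume u: "(\<forall>k<n. u k \<in> U k) \<and> (\<Sum>k<n. u k) = 0" and k: "k < n"
    let ?u = "restrict u {..<n}" and ?z = "restrict (\<lambda>_. 0) {..<n}"
    have "?u \<in> (\<Pi>\<^sub>E k\<in>{..<n}. U k) \<and> 0 = (\<Sum>k<n. ?u k)" using u by (auto simp: PiE_iff)
    moreover have "?z \<in> (\<Pi>\<^sub>E k\<in>{..<n}. U k) \<and> 0 = (\<Sum>k<n. ?z k)"
      using U by (auto simp: PiE_iff cvec.subspace_0)
    ultimately have "?u = ?z" using L S by blast
    then show "u k = 0" using k by (metis lessThan_iff restrict_apply')
  qed
  ultimately show "?R1 \<and> ?R2" ..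
next
  assume R: "?R1 \<and> ?R2"
  show ?L
  proof
    fix x assume "x \<in> S"
    then obtain u where u: "\<forall>k<n. u k \<in> U k" "x = (\<Sum>k<n. u k)" using R by blast
    show "\<exists>!u. u \<in> (\<Pi>\<^sub>E k\<in>{..<n}. U k) \<and> x = (\<Sum>k<n. u k)"
    proof (rule ex1I)
      show "restrict u {..<n} \<in> (\<Pi>\<^sub>E k\<in>{..<n}. U k) \<and> x = (\<Sum>k<n. restrict u {..<n} k)"
        using u by (auto simp: PiE_iff)
      fix v assume v: "v \<in> (\<Pi>\<^sub>E k\<in>{..<n}. U k) \<and> x = (\<Sum>k<n. v k)"
      have "\<forall>k<n. v k - u k \<in> U k" using v u U by (auto simp: PiE_iff intro: cvec.subspace_diff)
      moreover have "(\<Sum>k<n. v k - u k) = 0" using v u by (simp add: sum_subtractf)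
      ultimately have "\<forall>k<n. v k - u k = 0"
        using conjunct2[OF R, THEN spec, of "\<lambda>k. v k - u k"] by blast
      then have "v k = u k" if "k < n" for k using that by simp
      moreover have "v k = undefined" if "\<not> k < n" for k
        using v that by (simp add: PiE_def extensional_def)
      ultimately show "v = restrict u {..<n}"
        by (intro ext) (simp add: restrict_def)
    qed
  qed
qed

context loop_free_vertex
begin

text \<open>Away from \<open>i\<close>, a module is determined by the arrows avoiding \<open>i\<close> and the products \<open>b c\<close> through
  \<open>i\<close>.  Reflection changes only the products with \<open>c = b\<^sup>*\<close>, by a scalar \<open>\<plusminus>k\<close> with \<open>k = \<tau> i\<close>.\<close>

definition ext_iso :: "('v \<Rightarrow> ('b \<Rightarrow> complex) \<Rightarrow> 'c \<Rightarrow> complex) \<Rightarrow> ('v, 'a darrow, 'b) quiver_rep \<Rightarrow>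
    ('v, 'a darrow, 'c) quiver_rep \<Rightarrow> complex \<Rightarrow> bool" where
  "ext_iso \<psi> V W k \<longleftrightarrow>
     (\<forall>v\<in>verts Q - {i}. linear_between (space V v) (space W v) (\<psi> v) \<and>
        bij_betw (\<psi> v) (space V v) (space W v)) \<and>
     (\<forall>a\<in>arcs (double Q). tail (double Q) a \<noteq> i \<and> head (double Q) a \<noteq> i \<longrightarrow>
        (\<forall>x\<in>space V (tail (double Q) a).
          \<psi> (head (double Q) a) (amap V a x) = amap W a (\<psi> (tail (double Q) a) x))) \<and>
     (\<forall>b\<in>arcs (double Q). tail (double Q) b = i \<longrightarrow> (\<forall>c\<in>C. \<forall>x\<in>space V (tail (double Q) c).
        amap W b (amap W c (\<psi> (tail (double Q) c) x)) =
        \<psi> (head (double Q) b) (amap V b (amap V c x) +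
          (if star b = c then cscale (k * arrow_sign b) x else 0))))"

lemma ext_isoD:
  assumes "ext_iso \<psi> V W k"
  shows "v \<in> verts Q \<Longrightarrow> v \<noteq> i \<Longrightarrow> linear_between (space V v) (space W v) (\<psi> v)"
    and "v \<in> verts Q \<Longrightarrow> v \<noteq> i \<Longrightarrow> bij_betw (\<psi> v) (space V v) (space W v)"
    and "a \<in> arcs (double Q) \<Longrightarrow> tail (double Q) a \<noteq> i \<Longrightarrow> head (double Q) a \<noteq> i \<Longrightarrow>
      x \<in> space V (tail (double Q) a) \<Longrightarrow>
      \<psi> (head (double Q) a) (amap V a x) = amap W a (\<psi> (tail (double Q) a) x)"
    and "b \<in> arcs (double Q) \<Longrightarrow> tail (double Q) b = i \<Longrightarrow> c \<in> C \<Longrightarrow> x \<in> space V (tail (double Q) c) \<Longrightarrow>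
      amap W b (amap W c (\<psi> (tail (double Q) c) x)) =
        \<psi> (head (double Q) b) (amap V b (amap V c x) +
          (if star b = c then cscale (k * arrow_sign b) x else 0))"
  using assms unfolding ext_iso_def by blast+

lemma tail_i_head: "b \<in> arcs (double Q) \<Longrightarrow> tail (double Q) b = i \<Longrightarrow> head (double Q) b \<noteq> i"
  using C_tail[OF star_in_C] by simp

context
  fixes V :: "('v, 'a darrow, 'b) quiver_rep"
  assumes V: "is_rep (double Q) V"
begin

lemma subsp: "v \<in> verts Q \<Longrightarrow> cvec.subspace (space V v)"
  using D.rep_subspace[OF V] by simp

lemma arrow_in: "a \<in> arcs (double Q) \<Longrightarrow> x \<in> space V (tail (double Q) a) \<Longrightarrow> amap V a x \<in> space V (head (double Q) a)"
  using lin_in[OF D.rep_arrow[OF V] subsp] e_arc by blast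

lemma C_in: "c \<in> C \<Longrightarrow> x \<in> space V (tail (double Q) c) \<Longrightarrow> amap V c x \<in> space V i"
  using arrow_in[of c x] C_arc C_head by auto

lemma star_in: "c \<in> C \<Longrightarrow> x \<in> space V i \<Longrightarrow> amap V (star c) x \<in> space V (tail (double Q) c)"
  using arrow_in[of "star c" x] C_arc C_head by auto

lemma out_in: "b \<in> arcs (double Q) \<Longrightarrow> tail (double Q) b = i \<Longrightarrow> x \<in> space V i \<Longrightarrow>
    amap V b x \<in> space V (head (double Q) b)"
  using arrow_in[of b x] by auto

lemma shifted_in: "b \<in> arcs (double Q) \<Longrightarrow> tail (double Q) b = i \<Longrightarrow> c \<in> C \<Longrightarrow>
    x \<in> space V (tail (double Q) c) \<Longrightarrow>
    amap V b (amap V c x) + (if star b = c then cscale k x else 0) \<in> space V (head (double Q) b)"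
  using C_in out_in e_arc(1)[of b] subsp[of "head (double Q) b"]
  by (auto simp: cvec.subspace_add cvec.subspace_scale)

end

lemma ext_iso_sym:
  assumes V: "is_rep (double Q) V" and W: "is_rep (double Q) W" and e: "ext_iso \<psi> V W k"
  shows "ext_iso (\<lambda>v. inv_into (space V v) (\<psi> v)) W V (- k)"
proof -
  let ?\<psi> = "\<lambda>v. inv_into (space V v) (\<psi> v)"
  note inv = linear_bij_inverse[OF ext_isoD(1)[OF e] ext_isoD(2)[OF e] subsp[OF V]]
  show ?thesis
    unfolding ext_iso_def
  proof (intro conjI ballI impI)
    fix a x
    assume a: "a \<in> arcs (double Q)" "tail (double Q) a \<noteq> i \<and> head (double Q) a \<noteq> i"
      and x: "x \<in> space W (tail (double Q) a)"
    let ?x = "?\<psi> (tail (double Q) a) x"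
    have 1: "?x \<in> space V (tail (double Q) a)" "\<psi> (tail (double Q) a) ?x = x"
      using inv(1,4)[of "tail (double Q) a"] a x e_arc[of a] by (auto simp: linear_between_def)
    show "?\<psi> (head (double Q) a) (amap W a x) = amap V a ?x"
      using ext_isoD(3)[OF e a(1) _ _ 1(1)] 1 a inv(3)[of "head (double Q) a" "amap V a ?x"] e_arc[of a]
        arrow_in[OF V a(1) 1(1)] by simp
  next
    fix b c x
    assume b: "b \<in> arcs (double Q)" "tail (double Q) b = i" and c: "c \<in> C"
      and x: "x \<in> space W (tail (double Q) c)"
    let ?x = "?\<psi> (tail (double Q) c) x" and ?h = "head (double Q) b"
    have h: "?h \<in> verts Q" "?h \<noteq> i" using e_arc[OF b(1)] tail_i_head[OF b] by auto
    have 1: "?x \<in> space V (tail (double Q) c)" "\<psi> (tail (double Q) c) ?x = x"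
      using inv(1,4)[of "tail (double Q) c"] x C_tail[OF c] C_tail_in[OF c] by (auto simp: linear_between_def)
    let ?d = "if star b = c then cscale (k * arrow_sign b) ?x else 0"
    have i1: "amap V b (amap V c ?x) \<in> space V ?h" using out_in[OF V b C_in[OF V c 1(1)]] .
    have hc: "star b = c \<Longrightarrow> tail (double Q) c = ?h" by auto
    then have i2: "?d \<in> space V ?h"
      using 1(1) h subsp[OF V, of ?h] by (auto simp: cvec.subspace_scale cvec.subspace_0)
    have "amap W b (amap W c x) + (if star b = c then cscale (- k * arrow_sign b) x else 0) =
        \<psi> ?h (amap V b (amap V c ?x) + ?d) + (if star b = c then cscale (- k * arrow_sign b) x else 0)"
      using ext_isoD(4)[OF e b c 1(1)] by (simp add: 1(2))
    also have "\<dots> = \<psi> ?h (amap V b (amap V c ?x))"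
      using lin_add[OF ext_isoD(1)[OF e h] subsp[OF V h(1)] i1 i2]
        lin_scale[OF ext_isoD(1)[OF e h] subsp[OF V h(1)], of ?x "k * arrow_sign b"] hc 1
        lin_zero[OF ext_isoD(1)[OF e h] subsp[OF V h(1)]]
      by auto
    finally show "amap V b (amap V c ?x) = ?\<psi> ?h (amap W b (amap W c x) +
        (if star b = c then cscale (- k * arrow_sign b) x else 0))"
      using inv(3)[OF h h h(1) i1] by simp
  qed (use inv(1,2) in auto)
qed

text \<open>Shifts add under composition and change sign under inversion, so two modules that differ
  from a third one by the same k are related with shift 0.\<close>

lemma ext_iso_trans:
  assumes V: "is_rep (double Q) V" and e: "ext_iso \<psi> V W k" and f: "ext_iso \<phi> W X l"
  shows "ext_iso (\<lambda>v. \<phi> v \<circ> \<psi> v) V X (k + l)"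
  unfolding ext_iso_def
proof (intro conjI ballI impI)
  fix v assume v: "v \<in> verts Q - {i}"
  show "linear_between (space V v) (space X v) (\<phi> v \<circ> \<psi> v)"
    using linear_between_comp ext_isoD(1)[OF e] ext_isoD(1)[OF f] v by blast
  show "bij_betw (\<phi> v \<circ> \<psi> v) (space V v) (space X v)"
    using bij_betw_trans ext_isoD(2)[OF e] ext_isoD(2)[OF f] v by blast
next
  fix a x
  assume a: "a \<in> arcs (double Q)" "tail (double Q) a \<noteq> i \<and> head (double Q) a \<noteq> i"
    and x: "x \<in> space V (tail (double Q) a)"
  have "\<psi> (tail (double Q) a) x \<in> space W (tail (double Q) a)"
    using ext_isoD(1)[OF e, of "tail (double Q) a"] a x e_arc[of a] by (auto simp: linear_between_def)
  then show "(\<phi> (head (double Q) a) \<circ> \<psi> (head (double Q) a)) (amap V a x) =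
      amap X a ((\<phi> (tail (double Q) a) \<circ> \<psi> (tail (double Q) a)) x)"
    using ext_isoD(3)[OF e a(1) _ _ x] ext_isoD(3)[OF f a(1)] a by simp
next
  fix b c x
  assume b: "b \<in> arcs (double Q)" "tail (double Q) b = i" and c: "c \<in> C"
    and x: "x \<in> space V (tail (double Q) c)"
  let ?h = "head (double Q) b"
  have h: "?h \<in> verts Q" "?h \<noteq> i" using e_arc[OF b(1)] tail_i_head[OF b] by auto
  have x': "\<psi> (tail (double Q) c) x \<in> space W (tail (double Q) c)"
    using ext_isoD(1)[OF e C_tail_in[OF c] C_tail[OF c]] x by (auto simp: linear_between_def)
  have hc: "star b = c \<Longrightarrow> tail (double Q) c = ?h" by auto
  note s = subsp[OF V h(1)]
  note i1 = shifted_in[OF V b c x, of "k * arrow_sign b"]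
  show "amap X b (amap X c ((\<phi> (tail (double Q) c) \<circ> \<psi> (tail (double Q) c)) x)) =
      (\<phi> ?h \<circ> \<psi> ?h) (amap V b (amap V c x) + (if star b = c then cscale ((k + l) * arrow_sign b) x else 0))"
  proof (cases "star b = c")
    case True
    have xh: "x \<in> space V ?h" "cscale (l * arrow_sign b) x \<in> space V ?h"
      using x hc[OF True] cvec.subspace_scale[OF s] by auto
    have "\<psi> ?h (amap V b (amap V c x) + cscale ((k + l) * arrow_sign b) x) =
        \<psi> ?h (amap V b (amap V c x) + cscale (k * arrow_sign b) x) + cscale (l * arrow_sign b) (\<psi> ?h x)"
      using lin_add[OF ext_isoD(1)[OF e h] s i1 xh(2)] lin_scale[OF ext_isoD(1)[OF e h] s xh(1)] True
      by (simp add: distrib_right cscale_add_left add.assoc)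
    then show ?thesis
      using ext_isoD(4)[OF f b c x'] ext_isoD(4)[OF e b c x] True hc by simp
  next
    case False
    then show ?thesis
      using ext_isoD(4)[OF f b c x'] ext_isoD(4)[OF e b c x] by simp
  qed
qed

lemma rep_iso_ext:
  assumes "rep_iso (double Q) V W" and V: "is_rep (double Q) V"
  obtains \<psi> where "ext_iso \<psi> V W 0" "\<And>v. v \<in> verts Q \<Longrightarrow> linear_between (space V v) (space W v) (\<psi> v)"
proof -
  from assms obtain \<phi> where \<phi>: "\<And>v. v \<in> verts Q \<Longrightarrow> linear_between (space V v) (space W v) (\<phi> v)"
      "\<And>v. v \<in> verts Q \<Longrightarrow> bij_betw (\<phi> v) (space V v) (space W v)"
    and nat: "\<And>a x. a \<in> arcs (double Q) \<Longrightarrow> x \<in> space V (tail (double Q) a) \<Longrightarrow>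
        \<phi> (head (double Q) a) (amap V a x) = amap W a (\<phi> (tail (double Q) a) x)"
    unfolding rep_iso_def by auto
  have "ext_iso \<phi> V W 0"
    unfolding ext_iso_def
  proof (intro conjI ballI impI)
    fix b c x
    assume b: "b \<in> arcs (double Q)" "tail (double Q) b = i" and c: "c \<in> C"
      and x: "x \<in> space V (tail (double Q) c)"
    show "amap W b (amap W c (\<phi> (tail (double Q) c) x)) =
        \<phi> (head (double Q) b) (amap V b (amap V c x) + (if star b = c then cscale (0 * arrow_sign b) x else 0))"
      using nat[OF C_arc[OF c] x] nat[OF b(1), of "amap V c x"] C_in[OF V c x] b(2) C_head[OF c] by simp
  qed (use \<phi> nat in auto)
  then show ?thesis using that \<phi>(1) by blast
qed

text \<open>For nonzero \<tau> i the relation writes each vector at i in terms of its outgoing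
  components, sent back along the incoming arrows. All reconstruction at i rests on this
  formula.\<close>

lemma moment_recover:
  assumes "moment Q \<tau> V i" "\<tau> i \<noteq> 0" "x \<in> space V i"
  shows "x = cscale (inverse (\<tau> i)) (\<Sum>c\<in>C. cscale (arrow_sign c) (amap V c (amap V (star c) x)))"
  using assms by (simp add: moment_def)

text \<open>Each arrow from i to v adds k to the left side, since its sign occurs once in the
  relation and once in the shift. With k = \<tau> i the total is the dual reflection of the
  parameter at v.\<close>

lemma moment_transfer:
  assumes V: "is_rep (double Q) V" and e: "ext_iso \<psi> V W k" and m: "moment Q \<tau> V v"
    and W: "is_rep (double Q) W" and v: "v \<in> verts Q" "v \<noteq> i"
    and \<tau>': "\<tau>' v = \<tau> v + of_nat (card {a \<in> in_arrows Q v. tail (double Q) a = i}) * k"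
  shows "moment Q \<tau>' W v"
  unfolding moment_def
proof
  fix y assume y: "y \<in> space W v"
  note s = subsp[OF V v(1)] and l = ext_isoD(1)[OF e v]
  obtain x where x: "x \<in> space V v" "y = \<psi> v x"
    using ext_isoD(2)[OF e v] y by (auto simp: bij_betw_def)
  have fin: "finite (in_arrows Q v)" by (simp add: in_arrows_def double_def)
  have 1: "amap W a (amap W (star a) y) = \<psi> v (amap V a (amap V (star a) x) +
      (if tail (double Q) a = i then cscale (k * arrow_sign a) x else 0))" if a: "a \<in> in_arrows Q v" for a
  proof -
    have aa: "a \<in> arcs (double Q)" "head (double Q) a = v" using a by (auto simp: in_arrows_def)
    show ?thesis
    proof (cases "tail (double Q) a = i")
      case True
      then show ?thesis
        using ext_isoD(4)[OF e aa(1) True star_in_C[OF aa(1) True], of x] aa x by simp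
    next
      case False
      have "amap V (star a) x \<in> space V (tail (double Q) a)"
        using arrow_in[OF V, of "star a" x] aa x by simp
      then show ?thesis
        using ext_isoD(3)[OF e, of "star a" x] ext_isoD(3)[OF e, of a "amap V (star a) x"] aa x v False by simp
    qed
  qed
  have in1: "amap V a (amap V (star a) x) \<in> space V v" if "a \<in> in_arrows Q v" for a
    using arrow_in[OF V, of "star a" x] arrow_in[OF V, of a] that x by (auto simp: in_arrows_def)
  then have in2: "amap V a (amap V (star a) x) + (if tail (double Q) a = i then cscale (k * arrow_sign a) x else 0) \<in> space V v"
    if "a \<in> in_arrows Q v" for a
    using that x by (auto intro: cvec.subspace_add[OF s] cvec.subspace_scale[OF s])
  have "(\<Sum>a\<in>in_arrows Q v. cscale (arrow_sign a) (amap W a (amap W (star a) y))) =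
      (\<Sum>a\<in>in_arrows Q v. \<psi> v (cscale (arrow_sign a) (amap V a (amap V (star a) x) +
        (if tail (double Q) a = i then cscale (k * arrow_sign a) x else 0))))"
    by (intro sum.cong) (simp_all add: 1 lin_scale[OF l s in2])
  also have "\<dots> = \<psi> v (\<Sum>a\<in>in_arrows Q v. cscale (arrow_sign a) (amap V a (amap V (star a) x) +
        (if tail (double Q) a = i then cscale (k * arrow_sign a) x else 0)))"
    by (rule lin_sum[OF l s, symmetric]) (intro cvec.subspace_scale[OF s] in2)
  also have "(\<Sum>a\<in>in_arrows Q v. cscale (arrow_sign a) (amap V a (amap V (star a) x) +
        (if tail (double Q) a = i then cscale (k * arrow_sign a) x else 0))) =
      cscale (\<tau> v) x + (\<Sum>a\<in>in_arrows Q v. if tail (double Q) a = i then cscale k x else 0)"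
  proof -
    have "cscale (arrow_sign a) (if P then cscale (k * arrow_sign a) x else 0) = (if P then cscale k x else 0)"
      for a :: "'a darrow" and P
      by (cases a) auto
    then show ?thesis
      using m x(1) by (simp add: cscale_add_right sum.distrib moment_def)
  qed
  also have "(\<Sum>a\<in>in_arrows Q v. if tail (double Q) a = i then cscale k x else 0) =
      cscale (of_nat (card {a \<in> in_arrows Q v. tail (double Q) a = i}) * k) x"
  proof -
    have "(\<Sum>a\<in>in_arrows Q v. if tail (double Q) a = i then cscale k x else 0) =
        (\<Sum>a\<in>{a \<in> in_arrows Q v. tail (double Q) a = i}. cscale k x)"
      by (rule sum.inter_filter[OF fin, symmetric])
    also have "\<dots> = cscale (of_nat (card {a \<in> in_arrows Q v. tail (double Q) a = i}) * k) x"
      unfolding cscale_sum_left[symmetric] by simp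
    finally show ?thesis .
  qed
  also have "cscale (\<tau> v) x + \<dots> = cscale (\<tau>' v) x"
    by (simp add: \<tau>' cscale_add_left)
  finally show "(\<Sum>a\<in>in_arrows Q v. cscale (arrow_sign a) (amap W a (amap W (star a) y))) = cscale (\<tau>' v) y"
    using lin_scale[OF l s x(1)] x(2) by simp
qed

text \<open>The only possible value at i of a morphism extending \<psi>: expand x by
  \<open>moment_recover\<close> and carry its outgoing components over to W before they return to
  i.\<close>

definition glue :: "('v \<Rightarrow> complex) \<Rightarrow> ('v \<Rightarrow> ('b \<Rightarrow> complex) \<Rightarrow> 'c \<Rightarrow> complex) \<Rightarrow>
    ('v, 'a darrow, 'b) quiver_rep \<Rightarrow> ('v, 'a darrow, 'c) quiver_rep \<Rightarrow> ('b \<Rightarrow> complex) \<Rightarrow> 'c \<Rightarrow> complex" where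
  "glue \<tau> \<psi> V W x = cscale (inverse (\<tau> i))
     (\<Sum>c\<in>C. cscale (arrow_sign c) (amap W c (\<psi> (tail (double Q) c) (amap V (star c) x))))"

lemma glue_linear:
  assumes V: "is_rep (double Q) V" and W: "is_rep (double Q) W" and e: "ext_iso \<psi> V W k"
  shows "linear_between (space V i) (space W i) (glue \<tau> \<psi> V W)"
  unfolding glue_def
proof (intro linear_between_scale linear_between_sum subsp[OF W i_in])
  fix c assume c: "c \<in> C"
  note ca = C_arc[OF c]
  have "linear_between (space V i) (space W i) (amap W c \<circ> (\<psi> (tail (double Q) c) \<circ> amap V (star c)))"
    using linear_between_comp[OF linear_between_comp[OF D.rep_arrow[OF V, of "star c"]
          ext_isoD(1)[OF e C_tail_in[OF c] C_tail[OF c], folded double_simps(5)[of Q c]]]]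
      D.rep_arrow[OF W ca] C_head[OF c] ca by simp
  then show "linear_between (space V i) (space W i) (\<lambda>x. amap W c (\<psi> (tail (double Q) c) (amap V (star c) x)))"
    by (simp add: comp_def)
qed

text \<open>Composing with an outgoing arrow leaves only products through i, on which V and W agree
  when the shift is 0; the relation at i for V then collapses the sum.\<close>

lemma glue_out:
  assumes V: "is_rep (double Q) V" and W: "is_rep (double Q) W" and e: "ext_iso \<psi> V W 0"
    and m: "moment Q \<tau> V i" "\<tau> i \<noteq> 0" and b: "b \<in> arcs (double Q)" "tail (double Q) b = i" and x: "x \<in> space V i"
  shows "amap W b (glue \<tau> \<psi> V W x) = \<psi> (head (double Q) b) (amap V b x)"
proof -
  let ?h = "head (double Q) b"
  have h: "?h \<in> verts Q" "?h \<noteq> i" using e_arc[OF b(1)] tail_i_head[OF b] by auto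
  note lW = D.rep_arrow[OF W b(1), unfolded b(2)] and lV = D.rep_arrow[OF V b(1), unfolded b(2)]
  note sW = subsp[OF W i_in] and sV = subsp[OF V i_in] and l = ext_isoD(1)[OF e h] and s = subsp[OF V h(1)]
  have y: "amap V (star c) x \<in> space V (tail (double Q) c)" if "c \<in> C" for c
    using star_in[OF V that x] .
  have wi: "amap W c (\<psi> (tail (double Q) c) (amap V (star c) x)) \<in> space W i" if "c \<in> C" for c
    using C_in[OF W that] lin_in[OF ext_isoD(1)[OF e C_tail_in[OF that] C_tail[OF that]] subsp[OF V C_tail_in[OF that]] y[OF that]]
    by blast
  have vi: "amap V c (amap V (star c) x) \<in> space V i" if "c \<in> C" for c
    using C_in[OF V that y[OF that]] .
  have vh: "amap V b (amap V c (amap V (star c) x)) \<in> space V ?h" if "c \<in> C" for c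
    using out_in[OF V b vi[OF that]] .
  have "amap W b (glue \<tau> \<psi> V W x) = cscale (inverse (\<tau> i)) (\<Sum>c\<in>C. cscale (arrow_sign c)
      (amap W b (amap W c (\<psi> (tail (double Q) c) (amap V (star c) x)))))"
    unfolding glue_def
    by (simp add: lin_scale[OF lW sW] lin_sum[OF lW sW] wi cvec.subspace_scale[OF sW] cvec.subspace_sum[OF sW])
  also have "\<dots> = cscale (inverse (\<tau> i)) (\<Sum>c\<in>C. cscale (arrow_sign c)
      (\<psi> ?h (amap V b (amap V c (amap V (star c) x)))))"
    using ext_isoD(4)[OF e b _ y] by (intro arg_cong[of _ _ "cscale _"] sum.cong) simp_all
  also have "\<dots> = \<psi> ?h (cscale (inverse (\<tau> i)) (\<Sum>c\<in>C. cscale (arrow_sign c) (amap V b (amap V c (amap V (star c) x)))))"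
    by (simp add: lin_scale[OF l s] lin_sum[OF l s] vh cvec.subspace_scale[OF s] cvec.subspace_sum[OF s])
  also have "cscale (inverse (\<tau> i)) (\<Sum>c\<in>C. cscale (arrow_sign c) (amap V b (amap V c (amap V (star c) x)))) =
      amap V b (cscale (inverse (\<tau> i)) (\<Sum>c\<in>C. cscale (arrow_sign c) (amap V c (amap V (star c) x))))"
    by (simp add: lin_scale[OF lV sV] lin_sum[OF lV sV] vi cvec.subspace_scale[OF sV] cvec.subspace_sum[OF sV])
  finally show ?thesis
    by (simp flip: moment_recover[OF m x])
qed

lemma glue_inverse:
  assumes V: "is_rep (double Q) V" and W: "is_rep (double Q) W" and e: "ext_iso \<psi> V W 0"
    and m: "moment Q \<tau> V i" "\<tau> i \<noteq> 0" and x: "x \<in> space V i"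
    and inv: "\<And>v y. v \<in> verts Q \<Longrightarrow> v \<noteq> i \<Longrightarrow> y \<in> space V v \<Longrightarrow> \<phi> v (\<psi> v y) = y"
  shows "glue \<tau> \<phi> W V (glue \<tau> \<psi> V W x) = x"
proof -
  have "amap V c (\<phi> (tail (double Q) c) (amap W (star c) (glue \<tau> \<psi> V W x))) = amap V c (amap V (star c) x)"
    if c: "c \<in> C" for c
    using glue_out[OF V W e m, of "star c" x] c C_arc[OF c] C_head[OF c] x inv[OF C_tail_in[OF c] C_tail[OF c] star_in[OF V c x]]
    by simp
  then have "glue \<tau> \<phi> W V (glue \<tau> \<psi> V W x) =
      cscale (inverse (\<tau> i)) (\<Sum>c\<in>C. cscale (arrow_sign c) (amap V c (amap V (star c) x)))"
    by (simp add: glue_def)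
  then show ?thesis by (simp flip: moment_recover[OF m x])
qed

text \<open>For nonzero \<tau> i a module is determined by its restriction away from i:
  \<open>glue\<close> supplies the missing component, and glueing the inverse of \<psi> provides its
  inverse.\<close>

theorem rep_iso_if_ext_iso:
  assumes V: "is_rep (double Q) V" and W: "is_rep (double Q) W" and e: "ext_iso \<psi> V W 0"
    and mV: "moment Q \<tau> V i" and mW: "moment Q \<tau> W i" and \<tau>: "\<tau> i \<noteq> 0"
  shows "rep_iso (double Q) V W"
proof -
  let ?\<psi>' = "\<lambda>v. inv_into (space V v) (\<psi> v)"
  let ?\<phi> = "\<lambda>v. if v = i then glue \<tau> \<psi> V W else \<psi> v"
  have e': "ext_iso ?\<psi>' W V 0" using ext_iso_sym[OF V W e] by simp
  note inv = linear_bij_inverse[OF ext_isoD(1)[OF e] ext_isoD(2)[OF e] subsp[OF V]]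
  have bij: "bij_betw (glue \<tau> \<psi> V W) (space V i) (space W i)"
  proof (rule bij_betw_byWitness[of _ "glue \<tau> ?\<psi>' W V"])
    show "\<forall>x\<in>space V i. glue \<tau> ?\<psi>' W V (glue \<tau> \<psi> V W x) = x"
      using glue_inverse[OF V W e mV \<tau>, of _ ?\<psi>'] inv(3) by blast
    show "\<forall>y\<in>space W i. glue \<tau> \<psi> V W (glue \<tau> ?\<psi>' W V y) = y"
      using glue_inverse[OF W V e' mW \<tau>, of _ \<psi>] inv(4) by blast
  qed (use glue_linear[OF V W e, of \<tau>] glue_linear[OF W V e', of \<tau>] in \<open>auto simp: linear_between_def\<close>)
  have "?\<phi> (head (double Q) a) (amap V a x) = amap W a (?\<phi> (tail (double Q) a) x)"
    if a: "a \<in> arcs (double Q)" and x: "x \<in> space V (tail (double Q) a)" for a x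
  proof (cases "head (double Q) a = i")
    case True
    then have c: "a \<in> C" using a by (simp add: in_arrows_def)
    have y: "\<psi> (tail (double Q) a) x \<in> space W (tail (double Q) a)"
      using lin_in[OF ext_isoD(1)[OF e C_tail_in[OF c] C_tail[OF c]] subsp[OF V C_tail_in[OF c]] x] .
    \<comment> \<open>An incoming arrow followed by an outgoing one is a product through i and can
      be rewritten in W; the relation of W at i then contracts the sum.\<close>
    have "glue \<tau> \<psi> V W (amap V a x) = cscale (inverse (\<tau> i)) (\<Sum>c\<in>C. cscale (arrow_sign c)
        (amap W c (amap W (star c) (amap W a (\<psi> (tail (double Q) a) x)))))"
      unfolding glue_def
    proof (intro arg_cong[of _ _ "cscale _"] sum.cong refl)
      fix c' assume c': "c' \<in> C"
      show "amap W c' (\<psi> (tail (double Q) c') (amap V (star c') (amap V a x))) =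
          amap W c' (amap W (star c') (amap W a (\<psi> (tail (double Q) a) x)))"
        using ext_isoD(4)[OF e _ _ c x, of "star c'"] C_arc[OF c'] C_head[OF c'] by simp
    qed
    also have "\<dots> = amap W a (\<psi> (tail (double Q) a) x)"
      by (rule moment_recover[OF mW \<tau> C_in[OF W c y], symmetric])
    finally show ?thesis using True C_tail[OF c] by simp
  next
    case False
    then show ?thesis
      using ext_isoD(3)[OF e a _ False x] glue_out[OF V W e mV \<tau> a _] x by auto
  qed
  then show ?thesis
    unfolding rep_iso_def using ext_isoD(1,2)[OF e] bij glue_linear[OF V W e, of \<tau>]
    by (intro exI[of _ ?\<phi>]) auto
qed

section \<open>Transfer of semisimplicity\<close>

text \<open>Since \<psi> gives no map at i, the subspace there is the one generated by incoming
  arrows; by \<open>subrep_at_i\<close> a submodule leaves no other choice when the relation holds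
  with nonzero parameter.\<close>

definition push :: "('v \<Rightarrow> ('b \<Rightarrow> complex) \<Rightarrow> 'c \<Rightarrow> complex) \<Rightarrow> ('v, 'a darrow, 'c) quiver_rep \<Rightarrow>
    ('v \<Rightarrow> ('b \<Rightarrow> complex) set) \<Rightarrow> 'v \<Rightarrow> ('c \<Rightarrow> complex) set" where
  "push \<psi> W U v = (if v = i then cvec.span (\<Union>c\<in>C. amap W c ` \<psi> (tail (double Q) c) ` U (tail (double Q) c))
     else \<psi> v ` U v)"

lemma push_mono:
  assumes "\<And>v. v \<in> verts Q \<Longrightarrow> U v \<subseteq> U' v" "v \<in> verts Q"
  shows "push \<psi> W U v \<subseteq> push \<psi> W U' v"
proof (cases "v = i")
  case True
  have "(\<Union>c\<in>C. amap W c ` \<psi> (tail (double Q) c) ` U (tail (double Q) c)) \<subseteq>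
      (\<Union>c\<in>C. amap W c ` \<psi> (tail (double Q) c) ` U' (tail (double Q) c))"
    using assms(1)[OF C_tail_in] by blast
  then show ?thesis unfolding push_def using True by (simp add: cvec.span_mono)
qed (use assms in \<open>auto simp: push_def\<close>)

lemma push_cong:
  assumes "\<And>v. v \<in> verts Q \<Longrightarrow> U v = U' v" "v \<in> verts Q"
  shows "push \<psi> W U v = push \<psi> W U' v"
  by (intro subset_antisym push_mono) (use assms in auto)

lemma subrepD:
  assumes "is_subrep (double Q) V U"
  shows "v \<in> verts Q \<Longrightarrow> cvec.subspace (U v)" "v \<in> verts Q \<Longrightarrow> U v \<subseteq> space V v"
    "a \<in> arcs (double Q) \<Longrightarrow> x \<in> U (tail (double Q) a) \<Longrightarrow> amap V a x \<in> U (head (double Q) a)"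
  using assms by (auto simp: is_subrep_def image_subset_iff)

lemma subrep_at_i:
  assumes m: "moment Q \<tau> V i" "\<tau> i \<noteq> 0" and U: "is_subrep (double Q) V U"
  shows "U i = cvec.span (\<Union>c\<in>C. amap V c ` U (tail (double Q) c))"
proof
  show "cvec.span (\<Union>c\<in>C. amap V c ` U (tail (double Q) c)) \<subseteq> U i"
    using subrepD(3)[OF U C_arc] C_head by (intro cvec.span_minimal subrepD(1)[OF U i_in]) fastforce
  show "U i \<subseteq> cvec.span (\<Union>c\<in>C. amap V c ` U (tail (double Q) c))"
  proof
    fix x assume x: "x \<in> U i"
    then have "x \<in> space V i" using subrepD(2)[OF U i_in] by auto
    from moment_recover[OF m this]
    have eq: "x = cscale (inverse (\<tau> i)) (\<Sum>c\<in>C. cscale (arrow_sign c) (amap V c (amap V (star c) x)))" .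
    have "amap V (star c) x \<in> U (tail (double Q) c)" if "c \<in> C" for c
      using subrepD(3)[OF U, of "star c" x] x C_arc[OF that] C_head[OF that] by simp
    then have "(\<Sum>c\<in>C. cscale (arrow_sign c) (amap V c (amap V (star c) x))) \<in>
        cvec.span (\<Union>c\<in>C. amap V c ` U (tail (double Q) c))"
      by (intro cvec.span_sum cvec.span_scale cvec.span_base) blast
    then show "x \<in> cvec.span (\<Union>c\<in>C. amap V c ` U (tail (double Q) c))"
      by (subst eq) (rule cvec.span_scale)
  qed
qed

context
  fixes V :: "('v, 'a darrow, 'b) quiver_rep" and W :: "('v, 'a darrow, 'c) quiver_rep" and \<psi> k
  assumes V: "is_rep (double Q) V" and W: "is_rep (double Q) W" and e: "ext_iso \<psi> V W k"
begin

text \<open>The shift adds a scalar multiple of x itself, which stays in every subspace containing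
  x; so the products through i respect the pushed subspaces for every k.\<close>

lemma push_subrep:
  assumes U: "is_subrep (double Q) V U"
  shows "is_subrep (double Q) W (push \<psi> W U)"
proof -
  note lin = ext_isoD(1)[OF e]
  have sub: "linear_between (U v) (space W v) (\<psi> v)" if "v \<in> verts Q" "v \<noteq> i" for v
    using lin[OF that] subrepD(2)[OF U that(1)] by (auto simp: linear_between_def subset_iff)
  have gen: "amap W c (\<psi> (tail (double Q) c) x) \<in> space W i" if "c \<in> C" "x \<in> U (tail (double Q) c)" for c x
    using C_in[OF W that(1)] sub[OF C_tail_in[OF that(1)] C_tail[OF that(1)]] that(2)
    by (auto simp: linear_between_def)
  show ?thesis
    unfolding is_subrep_def
  proof (intro conjI ballI)
    fix v assume "v \<in> verts (double Q)"
    then have v: "v \<in> verts Q" by simp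
    show "cvec.subspace (push \<psi> W U v)"
      using subspace_image[OF sub[OF v] subrepD(1)[OF U v]] by (auto simp: push_def)
    show "push \<psi> W U v \<subseteq> space W v"
    proof (cases "v = i")
      case True
      have "cvec.span (\<Union>c\<in>C. amap W c ` \<psi> (tail (double Q) c) ` U (tail (double Q) c)) \<subseteq> space W i"
        by (rule cvec.span_minimal[OF _ subsp[OF W i_in]]) (use gen in blast)
      then show ?thesis using True by (simp add: push_def)
    next
      case False
      then show ?thesis using sub[OF v False] by (auto simp: push_def linear_between_def)
    qed
  next
    fix a assume a: "a \<in> arcs (double Q)"
    let ?t = "tail (double Q) a" and ?h = "head (double Q) a"
    show "amap W a ` push \<psi> W U ?t \<subseteq> push \<psi> W U ?h"
    proof (cases "?h = i")
      case True
      then have "a \<in> C" using a by (simp add: in_arrows_def)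
      then show ?thesis
        using True C_tail[of a] by (auto simp: push_def intro!: cvec.span_base)
    next
      case h: False
      show ?thesis
      proof (cases "?t = i")
        case True
        have hv: "?h \<in> verts Q" using e_arc[OF a] by simp
        have lW: "linear_between (space W i) (space W ?h) (amap W a)"
          using D.rep_arrow[OF W a] True by simp
        have sU: "cvec.subspace (\<psi> ?h ` U ?h)"
          using subspace_image[OF sub[OF hv h] subrepD(1)[OF U hv]] .
        have g: "amap W a (amap W c (\<psi> (tail (double Q) c) x)) \<in> \<psi> ?h ` U ?h"
          if c: "c \<in> C" and x: "x \<in> U (tail (double Q) c)" for c x
        proof -
          have "x \<in> space V (tail (double Q) c)" using subrepD(2)[OF U C_tail_in[OF c]] x by auto
          moreover have "amap V a (amap V c x) \<in> U ?h"
            using subrepD(3)[OF U C_arc[OF c] x] subrepD(3)[OF U a, of "amap V c x"] True C_head[OF c] by simp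
          then have "amap V a (amap V c x) + (if star a = c then cscale (k * arrow_sign a) x else 0) \<in> U ?h"
            using x subrepD(1)[OF U hv]
            by (cases "star a = c") (auto simp: cvec.subspace_add cvec.subspace_scale)
          ultimately show ?thesis using ext_isoD(4)[OF e a True c] by auto
        qed
        have "y \<in> space W i \<and> amap W a y \<in> \<psi> ?h ` U ?h"
          if "y \<in> cvec.span (\<Union>c\<in>C. amap W c ` \<psi> (tail (double Q) c) ` U (tail (double Q) c))" for y
          using that
        proof (induction rule: cvec.span_induct_alt)
          case base
          show ?case
            using lin_zero[OF lW subsp[OF W i_in]] cvec.subspace_0[OF sU] cvec.subspace_0[OF subsp[OF W i_in]] by simp
        next
          case (step d b y)
          then have b: "b \<in> space W i" "amap W a b \<in> \<psi> ?h ` U ?h" using gen g by blast+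
          have y: "y \<in> space W i" "amap W a y \<in> \<psi> ?h ` U ?h" using step(2) by blast+
          note sc = cvec.subspace_scale[OF subsp[OF W i_in] b(1), of d]
          have "amap W a (cscale d b + y) = cscale d (amap W a b) + amap W a y"
            by (simp only: lin_add[OF lW subsp[OF W i_in] sc y(1)] lin_scale[OF lW subsp[OF W i_in] b(1)])
          then show ?case
            using cvec.subspace_add[OF subsp[OF W i_in] sc y(1)]
              cvec.subspace_add[OF sU cvec.subspace_scale[OF sU b(2)] y(2)] by simp
        qed
        then show ?thesis using True h by (simp add: push_def) blast
      next
        case False
        have "amap W a (\<psi> ?t x) \<in> \<psi> ?h ` U ?h" if "x \<in> U ?t" for x
        proof -
          have "x \<in> space V ?t" using subrepD(2)[OF U e_arc(2)[OF a]] that by auto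
          from ext_isoD(3)[OF e a False h this] show ?thesis
            using subrepD(3)[OF U a that] by (metis imageI)
        qed
        then show ?thesis using False h by (auto simp: push_def)
      qed
    qed
  qed
qed

lemma push_inverse:
  assumes U: "is_subrep (double Q) V U" and m: "moment Q \<tau> V i" "\<tau> i \<noteq> 0" and v: "v \<in> verts Q"
    and inv: "\<And>v y. v \<in> verts Q \<Longrightarrow> v \<noteq> i \<Longrightarrow> y \<in> space V v \<Longrightarrow> \<phi> v (\<psi> v y) = y"
  shows "push \<phi> V (push \<psi> W U) v = U v"
proof -
  have 1: "\<phi> v ` \<psi> v ` U v = U v" if "v \<in> verts Q" "v \<noteq> i" for v
    using inv[OF that] subrepD(2)[OF U that(1)] by (force simp: image_image)
  have "(\<Union>c\<in>C. amap V c ` \<phi> (tail (double Q) c) ` push \<psi> W U (tail (double Q) c)) =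
      (\<Union>c\<in>C. amap V c ` U (tail (double Q) c))"
    using 1[OF C_tail_in C_tail] C_tail by (intro SUP_cong refl) (auto simp: push_def)
  then have "push \<phi> V (push \<psi> W U) i = U i"
    unfolding push_def[of \<phi>] by (simp add: subrep_at_i[OF m U])
  then show ?thesis
    using 1[OF v] by (cases "v = i") (simp_all add: push_def)
qed

end

lemma push_zero:
  assumes V: "is_rep (double Q) V" and W: "is_rep (double Q) W" and e: "ext_iso \<psi> V W k" and v: "v \<in> verts Q"
  shows "push \<psi> W (\<lambda>_. {0}) v = {0}"
proof -
  have z: "\<psi> v 0 = 0" if "v \<in> verts Q" "v \<noteq> i" for v
    using lin_zero[OF ext_isoD(1)[OF e that] subsp[OF V that(1)]] .
  have "amap W c (\<psi> (tail (double Q) c) 0) = 0" if "c \<in> C" for c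
    using z[OF C_tail_in[OF that] C_tail[OF that]] lin_zero[OF D.rep_arrow[OF W C_arc[OF that]] subsp[OF W C_tail_in[OF that]]]
    by simp
  then have "(\<Union>c\<in>C. amap W c ` \<psi> (tail (double Q) c) ` {0}) \<subseteq> {0}" by auto
  then have "cvec.span (\<Union>c\<in>C. amap W c ` \<psi> (tail (double Q) c) ` {0}) \<subseteq> {0}"
    by (intro cvec.span_minimal) auto
  then show ?thesis
    using z v cvec.span_zero by (auto simp: push_def)
qed

text \<open>Pushing along \<psi> and along its inverse are monotone and mutually inverse on
  submodules, so minimal submodules correspond. Each round trip uses the relation at i of the module
  in which it starts.\<close>

lemma push_simple:
  assumes V: "is_rep (double Q) V" and W: "is_rep (double Q) W" and e: "ext_iso \<psi> V W k"
    and mV: "moment Q \<tau> V i" "\<tau> i \<noteq> 0" and mW: "moment Q \<tau>' W i" "\<tau>' i \<noteq> 0"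
    and U: "is_simple_subrep (double Q) V U"
  shows "is_simple_subrep (double Q) W (push \<psi> W U)"
proof -
  define \<phi> where "\<phi> = (\<lambda>v. inv_into (space V v) (\<psi> v))"
  have e': "ext_iso \<phi> W V (- k)" using ext_iso_sym[OF V W e] by (simp add: \<phi>_def)
  note inv = linear_bij_inverse[OF ext_isoD(1)[OF e] ext_isoD(2)[OF e] subsp[OF V], folded \<phi>_def]
  have Us: "is_subrep (double Q) V U" and Un: "\<exists>v\<in>verts Q. U v \<noteq> {0}"
    and Umin: "\<And>U'. is_subrep (double Q) V U' \<Longrightarrow> \<forall>v\<in>verts Q. U' v \<subseteq> U v \<Longrightarrow>
      (\<forall>v\<in>verts Q. U' v = {0}) \<or> (\<forall>v\<in>verts Q. U' v = U v)"
    using U by (auto simp: is_simple_subrep_def)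
  have VW: "push \<phi> V (push \<psi> W U') v = U' v" if "is_subrep (double Q) V U'" "v \<in> verts Q" for U' v
    using push_inverse[OF V W e that(1) mV that(2)] inv(3) by (simp add: \<phi>_def)
  have WV: "push \<psi> W (push \<phi> V U') v = U' v" if "is_subrep (double Q) W U'" "v \<in> verts Q" for U' v
    using push_inverse[OF W V e' that(1) mW that(2)] inv(4) by (simp add: \<phi>_def)
  show ?thesis
    unfolding is_simple_subrep_def
  proof (intro conjI allI impI)
    show "is_subrep (double Q) W (push \<psi> W U)" by (rule push_subrep[OF V W e Us])
    show "\<exists>v\<in>verts (double Q). push \<psi> W U v \<noteq> {0}"
    proof (rule ccontr)
      assume "\<not> ?thesis"
      then have "push \<phi> V (push \<psi> W U) v = {0}" if "v \<in> verts Q" for v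
        using push_cong[of "push \<psi> W U" "\<lambda>_. {0}" v \<phi> V] push_zero[OF W V e' that] that by simp
      then show False using VW[OF Us] Un by auto
    qed
    fix U' assume U': "is_subrep (double Q) W U' \<and> (\<forall>v\<in>verts (double Q). U' v \<subseteq> push \<psi> W U v)"
    have s: "is_subrep (double Q) V (push \<phi> V U')" by (rule push_subrep[OF W V e']) (use U' in simp)
    have "push \<phi> V U' v \<subseteq> U v" if "v \<in> verts Q" for v
      using push_mono[of U' "push \<psi> W U" v \<phi> V] U' that VW[OF Us that] by simp
    then have "(\<forall>v\<in>verts Q. push \<phi> V U' v = {0}) \<or> (\<forall>v\<in>verts Q. push \<phi> V U' v = U v)"
      using Umin[OF s] by blast
    then show "(\<forall>v\<in>verts (double Q). U' v = {0}) \<or> (\<forall>v\<in>verts (double Q). U' v = push \<psi> W U v)"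
    proof
      assume "\<forall>v\<in>verts Q. push \<phi> V U' v = {0}"
      then have "U' v = {0}" if "v \<in> verts Q" for v
        using push_cong[of "push \<phi> V U'" "\<lambda>_. {0}" v \<psi> W] push_zero[OF V W e that] WV[of U' v] U' that by simp
      then show ?thesis by simp
    next
      assume "\<forall>v\<in>verts Q. push \<phi> V U' v = U v"
      then have "U' v = push \<psi> W U v" if "v \<in> verts Q" for v
        using push_cong[of "push \<phi> V U'" U v \<psi> W] WV[of U' v] U' that by simp
      then show ?thesis by simp
    qed
  qed
qed

text \<open>Away from i the decomposition is carried by the bijections \<psi>. At i it has to be
  rebuilt from the neighbouring vertices by means of the relation.\<close>

theorem semisimple_transfer:
  assumes V: "is_rep (double Q) V" and W: "is_rep (double Q) W" and e: "ext_iso \<psi> V W k"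
    and mV: "moment Q \<tau> V i" "\<tau> i \<noteq> 0" and mW: "moment Q \<tau>' W i" "\<tau>' i \<noteq> 0"
    and ss: "is_semisimple (double Q) V"
  shows "is_semisimple (double Q) W"
proof -
  obtain n U where nU: "(\<forall>k<n. is_simple_subrep (double Q) V (U k)) \<and> (\<forall>v\<in>verts (double Q). \<forall>x\<in>space V v.
      \<exists>!u. u \<in> (\<Pi>\<^sub>E k\<in>{..<n::nat}. U k v) \<and> x = (\<Sum>k<n. u k))"
    using ss unfolding is_semisimple_def by blast
  then have U: "is_simple_subrep (double Q) V (U k)" if "k < n" for k
    using that by blast
  then have Us: "is_subrep (double Q) V (U k)" if "k < n" for k
    using that by (simp add: is_simple_subrep_def)
  have dec: "(\<forall>x\<in>space V v. \<exists>u. (\<forall>k<n. u k \<in> U k v) \<and> x = (\<Sum>k<n. u k)) \<and>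
      (\<forall>u. (\<forall>k<n. u k \<in> U k v) \<and> (\<Sum>k<n. u k) = 0 \<longrightarrow> (\<forall>k<n. u k = 0))" if v: "v \<in> verts Q" for v
  proof (rule iffD1[OF direct_sum_iff])
    show "cvec.subspace (U k v)" if "k < n" for k by (rule subrepD(1)[OF Us[OF that] v])
    show "0 \<in> space V v" by (rule cvec.subspace_0[OF subsp[OF V v]])
    show "\<forall>x\<in>space V v. \<exists>!u. u \<in> (\<Pi>\<^sub>E k\<in>{..<n}. U k v) \<and> x = (\<Sum>k<n. u k)"
      using nU v by simp
  qed
  have dec1: "\<exists>u. (\<forall>k<n. u k \<in> U k v) \<and> x = (\<Sum>k<n. u k)" if "v \<in> verts Q" "x \<in> space V v" for v x
    using conjunct1[OF dec[OF that(1)]] that(2) by (rule bspec)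
  have dec2: "\<forall>k<n. u k = 0" if "v \<in> verts Q" "\<And>k. k < n \<Longrightarrow> u k \<in> U k v" "(\<Sum>k<n. u k) = 0" for v u
    using conjunct2[OF dec[OF that(1)], THEN spec, of u] that(2,3) by simp
  let ?P = "\<lambda>k. push \<psi> W (U k)"
  have Ps: "is_subrep (double Q) W (?P k)" if "k < n" for k
    using push_subrep[OF V W e Us[OF that]] .
  have ex: "\<exists>u. (\<forall>k<n. u k \<in> ?P k v) \<and> y = (\<Sum>k<n. u k)"
    if v: "v \<in> verts Q" "v \<noteq> i" and y: "y \<in> space W v" for v y
  proof -
    obtain x where x: "x \<in> space V v" "y = \<psi> v x"
      using ext_isoD(2)[OF e v] y by (auto simp: bij_betw_def)
    obtain u where u: "\<forall>k<n. u k \<in> U k v" "x = (\<Sum>k<n. u k)" using dec1[OF v(1) x(1)] by blast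
    have "y = (\<Sum>k<n. \<psi> v (u k))"
      using lin_sum[OF ext_isoD(1)[OF e v] subsp[OF V v(1)], of "{..<n}" u] u subrepD(2)[OF Us v(1)] x(2) by auto
    then show ?thesis using u v by (intro exI[of _ "\<lambda>k. \<psi> v (u k)"]) (auto simp: push_def)
  qed
  have un: "\<forall>k<n. u k = 0"
    if v: "v \<in> verts Q" "v \<noteq> i" and u: "\<And>k. k < n \<Longrightarrow> u k \<in> ?P k v" "(\<Sum>k<n. u k) = 0" for v u
  proof -
    let ?f = "inv_into (space V v) (\<psi> v)"
    note inv = linear_bij_inverse[OF ext_isoD(1)[OF e v] ext_isoD(2)[OF e v] subsp[OF V v(1)]]
    have f: "?f (u k) \<in> U k v \<and> \<psi> v (?f (u k)) = u k \<and> u k \<in> space W v" if k: "k < n" for k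
    proof -
      obtain x where "x \<in> U k v" "u k = \<psi> v x" using u(1)[OF k] v by (auto simp: push_def)
      moreover from this have "x \<in> space V v" using subrepD(2)[OF Us[OF k] v(1)] by auto
      ultimately show ?thesis using inv(3)[of x] lin_in[OF ext_isoD(1)[OF e v] subsp[OF V v(1)], of x] by simp
    qed
    have "(\<Sum>k<n. ?f (u k)) = 0"
      using lin_sum[OF inv(1) subsp[OF W v(1)], of "{..<n}" u] u(2) lin_zero[OF inv(1) subsp[OF W v(1)]] f by simp
    then have f0: "\<forall>k<n. ?f (u k) = 0"
      using f by (intro dec2[OF v(1)]) blast+
    show ?thesis
    proof (intro allI impI)
      fix k assume k: "k < n"
      have "\<psi> v (?f (u k)) = u k" using f[OF k] by blast
      moreover have "?f (u k) = 0" using f0 k by blast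
      moreover have "\<psi> v 0 = 0" by (rule lin_zero[OF ext_isoD(1)[OF e v] subsp[OF V v(1)]])
      ultimately show "u k = 0" by metis
    qed
  qed
  have star_lin: "linear_between (space W i) (space W (tail (double Q) c)) (amap W (star c))" if "c \<in> C" for c
    using D.rep_arrow[OF W, of "star c"] C_arc[OF that] C_head[OF that] by simp
  \<comment> \<open>Decompose the outgoing components of y and send the summands back along the
    incoming arrows; the relation at i makes the results add up to y.\<close>
  have ex_i: "\<exists>u. (\<forall>k<n. u k \<in> ?P k i) \<and> y = (\<Sum>k<n. u k)" if y: "y \<in> space W i" for y
  proof -
    have "\<forall>c. \<exists>u. c \<in> C \<longrightarrow> (\<forall>k<n. u k \<in> ?P k (tail (double Q) c)) \<and> amap W (star c) y = (\<Sum>k<n. u k)"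
      using ex[OF C_tail_in C_tail] star_in[OF W _ y] by blast
    then obtain u where "\<forall>c. c \<in> C \<longrightarrow> (\<forall>k<n. u c k \<in> ?P k (tail (double Q) c)) \<and>
        amap W (star c) y = (\<Sum>k<n. u c k)"
      unfolding choice_iff by blast
    then have u: "\<And>c k. c \<in> C \<Longrightarrow> k < n \<Longrightarrow> u c k \<in> ?P k (tail (double Q) c)"
      "\<And>c. c \<in> C \<Longrightarrow> amap W (star c) y = (\<Sum>k<n. u c k)" by blast+
    let ?u = "\<lambda>k. cscale (inverse (\<tau>' i)) (\<Sum>c\<in>C. cscale (arrow_sign c) (amap W c (u c k)))"
    have "amap W c (u c k) \<in> ?P k i" if "c \<in> C" "k < n" for c k
      using subrepD(3)[OF Ps[OF that(2)] C_arc[OF that(1)] u(1)[OF that]] C_head[OF that(1)] by simp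
    then have "?u k \<in> ?P k i" if "k < n" for k
      using that subrepD(1)[OF Ps[OF that] i_in] by (intro cvec.subspace_scale cvec.subspace_sum) auto
    moreover have "y = (\<Sum>k<n. ?u k)"
    proof -
      have "amap W c (amap W (star c) y) = (\<Sum>k<n. amap W c (u c k))" if c: "c \<in> C" for c
        using lin_sum[OF D.rep_arrow[OF W C_arc[OF c]] subsp[OF W C_tail_in[OF c]], of "{..<n}" "u c"]
          u(1)[OF c] subrepD(2)[OF Ps C_tail_in[OF c]] u(2)[OF c] by auto
      then have "y = cscale (inverse (\<tau>' i)) (\<Sum>c\<in>C. \<Sum>k<n. cscale (arrow_sign c) (amap W c (u c k)))"
        using moment_recover[OF mW y] by (simp add: cscale_sum_right)
      also have "\<dots> = (\<Sum>k<n. ?u k)"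
        by (subst sum.swap) (simp only: cscale_sum_right)
      finally show ?thesis .
    qed
    ultimately show ?thesis by (intro exI[of _ ?u]) blast
  qed
  \<comment> \<open>The outgoing components of the summands vanish by the case of the other
    vertices, and a vector at i with zero outgoing components is zero.\<close>
  have un_i: "\<forall>k<n. u k = 0" if u: "\<And>k. k < n \<Longrightarrow> u k \<in> ?P k i" "(\<Sum>k<n. u k) = 0" for u
  proof (intro allI impI)
    fix k assume k: "k < n"
    have ui: "u k \<in> space W i" if "k < n" for k using u(1)[OF that] subrepD(2)[OF Ps[OF that] i_in] by auto
    have "amap W (star c) (u k) = 0" if c: "c \<in> C" for c
    proof -
      have "amap W (star c) (u k) \<in> ?P k (tail (double Q) c)" if "k < n" for k
        using subrepD(3)[OF Ps[OF that], of "star c" "u k"] u(1)[OF that] C_arc[OF c] C_head[OF c] by simp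
      moreover have "(\<Sum>k<n. amap W (star c) (u k)) = 0"
        using lin_sum[OF star_lin[OF c] subsp[OF W i_in], of "{..<n}" u] ui u(2)
          lin_zero[OF star_lin[OF c] subsp[OF W i_in]] by simp
      ultimately show ?thesis using un[OF C_tail_in[OF c] C_tail[OF c], of "\<lambda>k. amap W (star c) (u k)"] k by blast
    qed
    moreover have "amap W c 0 = 0" if "c \<in> C" for c
      using lin_zero[OF D.rep_arrow[OF W C_arc[OF that]] subsp[OF W C_tail_in[OF that]]] .
    ultimately show "u k = 0"
      using moment_recover[OF mW ui[OF k]] by simp
  qed
  have "\<forall>x\<in>space W v. \<exists>!u. u \<in> (\<Pi>\<^sub>E k\<in>{..<n}. ?P k v) \<and> x = (\<Sum>k<n. u k)" if v: "v \<in> verts Q" for v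
  proof (rule iffD2[OF direct_sum_iff])
    show "cvec.subspace (?P k v)" if "k < n" for k by (rule subrepD(1)[OF Ps[OF that] v])
    show "0 \<in> space W v" by (rule cvec.subspace_0[OF subsp[OF W v]])
    show "(\<forall>x\<in>space W v. \<exists>u. (\<forall>k<n. u k \<in> ?P k v) \<and> x = (\<Sum>k<n. u k)) \<and>
        (\<forall>u. (\<forall>k<n. u k \<in> ?P k v) \<and> (\<Sum>k<n. u k) = 0 \<longrightarrow> (\<forall>k<n. u k = 0))"
    proof (cases "v = i")
      case True
      show ?thesis unfolding True using ex_i un_i by blast
    next
      case False
      show ?thesis using ex[OF v False] un[OF v False] by blast
    qed
  qed
  then have 2: "\<forall>v\<in>verts (double Q). \<forall>x\<in>space W v. \<exists>!u. u \<in> (\<Pi>\<^sub>E k\<in>{..<n}. ?P k v) \<and> x = (\<Sum>k<n. u k)"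
    unfolding double_simps(1) by (rule ballI)
  have 1: "\<forall>k<n. is_simple_subrep (double Q) W (?P k)"
    using push_simple[OF V W e mV mW U] by blast
  show ?thesis
    unfolding is_semisimple_def by (rule exI[of _ n], rule exI[of _ ?P], rule conjI[OF 1 2])
qed

end

section \<open>Dimensions\<close>

lemma cscale_apply: "cscale c x b = c * x b"
  by (simp add: cscale_def)

lemma independent_iff:
  "finite B \<Longrightarrow> cvec.independent B \<longleftrightarrow> (\<forall>u. (\<Sum>b\<in>B. cscale (u b) b) = 0 \<longrightarrow> (\<forall>b\<in>B. u b = 0))"
  by (auto simp: cvec.dependent_finite)

lemma dim_image:
  assumes f: "linear_between U W f" and inj: "inj_on f U" and U: "fin_dim_space U"
  shows "cvec.dim (f ` U) = cvec.dim U"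
proof -
  obtain B where B: "finite B" "B \<subseteq> U" "cvec.independent B" "cvec.span B = U"
    using fin_dim_basis[OF U] by metis
  note s = fin_dim_subspace[OF U]
  have injB: "inj_on f B" using inj B(2) by (rule inj_on_subset)
  have "cvec.span (f ` B) \<subseteq> f ` U"
    using B by (intro cvec.span_minimal subspace_image[OF f s]) auto
  moreover have "f ` U \<subseteq> cvec.span (f ` B)"
  proof clarify
    fix x assume "x \<in> U"
    then have "x \<in> cvec.span B" using B by simp
    then obtain u where x: "x = (\<Sum>b\<in>B. cscale (u b) b)"
      using cvec.span_finite[OF B(1)] by auto
    have "f x = (\<Sum>b\<in>B. cscale (u b) (f b))"
      unfolding x using B(2) by (subst lin_sum[OF f s]) (auto simp: lin_scale[OF f s] cvec.subspace_scale[OF s] intro!: sum.cong)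
    then show "f x \<in> cvec.span (f ` B)"
      by (simp add: cvec.span_sum cvec.span_scale cvec.span_base)
  qed
  ultimately have span: "cvec.span (f ` B) = cvec.span (f ` U)"
    using cvec.span_span by (metis cvec.span_mono subset_antisym)
  have "cvec.independent (f ` B)"
    unfolding independent_iff[OF finite_imageI[OF B(1)]]
  proof (intro allI impI ballI)
    fix u y assume u: "(\<Sum>b\<in>f ` B. cscale (u b) b) = 0" and y: "y \<in> f ` B"
    have "f (\<Sum>b\<in>B. cscale (u (f b)) b) = (\<Sum>b\<in>B. cscale (u (f b)) (f b))"
      using B(2) by (subst lin_sum[OF f s]) (auto simp: lin_scale[OF f s] cvec.subspace_scale[OF s] intro!: sum.cong)
    also have "\<dots> = f 0"
      using u by (simp add: sum.reindex[OF injB] lin_zero[OF f s])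
    finally have "(\<Sum>b\<in>B. cscale (u (f b)) b) = 0"
      by (rule inj_onD[OF inj])
        (use B(2) in \<open>auto intro!: cvec.subspace_sum[OF s] cvec.subspace_scale[OF s] cvec.subspace_0[OF s]\<close>)
    then show "u y = 0"
      using B(3) y unfolding independent_iff[OF B(1)] by (auto dest: spec[of _ "\<lambda>b. u (f b)"])
  qed
  then have "cvec.dim (f ` U) = card (f ` B)"
    using span by (intro cvec.dim_eq_card)
  also have "\<dots> = cvec.dim U"
    using B by (metis card_image[OF injB] cvec.dim_eq_card cvec.span_span)
  finally show ?thesis .
qed

lemma dim_direct_sum:
  assumes S: "fin_dim_space S" and T: "fin_dim_space T" and ST: "S \<inter> T = {0}"
    and U: "U = {x + y | x y. x \<in> S \<and> y \<in> T}"
  shows "fin_dim_space U" "cvec.dim U = cvec.dim S + cvec.dim T"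
proof -
  obtain B where B: "finite B" "B \<subseteq> S" "cvec.independent B" "cvec.span B = S"
    using fin_dim_basis[OF S] by metis
  obtain D where D: "finite D" "D \<subseteq> T" "cvec.independent D" "cvec.span D = T"
    using fin_dim_basis[OF T] by metis
  note sS = fin_dim_subspace[OF S] and sT = fin_dim_subspace[OF T]
  have disj: "B \<inter> D = {}"
  proof -
    have "B \<inter> D \<subseteq> {0}" using B(2) D(2) ST by blast
    moreover have "0 \<notin> B" using B(3) cvec.dependent_zero by blast
    ultimately show ?thesis by blast
  qed
  have span: "cvec.span (B \<union> D) = U"
    unfolding cvec.span_Un B(4) D(4) U by auto
  then show "fin_dim_space U" using B(1) D(1) unfolding fin_dim_space_def by blast
  have "cvec.independent (B \<union> D)"
    unfolding independent_iff[OF finite_UnI[OF B(1) D(1)]]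
  proof (intro allI impI)
    fix u assume "(\<Sum>b\<in>B \<union> D. cscale (u b) b) = 0"
    then have 0: "(\<Sum>b\<in>B. cscale (u b) b) = - (\<Sum>b\<in>D. cscale (u b) b)"
      using B(1) D(1) disj by (simp add: sum.union_disjoint eq_neg_iff_add_eq_0)
    have "(\<Sum>b\<in>B. cscale (u b) b) \<in> S"
      using B(2) by (auto intro!: cvec.subspace_sum[OF sS] cvec.subspace_scale[OF sS])
    moreover have "(\<Sum>b\<in>B. cscale (u b) b) \<in> T"
      unfolding 0 using D(2)
      by (auto intro!: cvec.subspace_neg[OF sT] cvec.subspace_sum[OF sT] cvec.subspace_scale[OF sT])
    ultimately have B0: "(\<Sum>b\<in>B. cscale (u b) b) = 0" using ST by blast
    moreover have "(\<Sum>b\<in>D. cscale (u b) b) = 0"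
      using 0 unfolding B0 by simp
    ultimately show "\<forall>b\<in>B \<union> D. u b = 0"
      using B(3) D(3) unfolding independent_iff[OF B(1)] independent_iff[OF D(1)] by blast
  qed
  then have "cvec.dim U = card (B \<union> D)"
    using span by (metis cvec.dim_span_eq_card_independent)
  also have "\<dots> = cvec.dim S + cvec.dim T"
    using B D disj by (metis card_Un_disjoint cvec.dim_span_eq_card_independent)
  finally show "cvec.dim U = cvec.dim S + cvec.dim T" .
qed

lemma vec_simps [simp]:
  "vec_outl (vec_inl x) = x" "vec_outr (vec_inr w) = w"
  by (auto simp: vec_outl_def vec_inl_def vec_outr_def vec_inr_def)

lemma vec_inl_linear [simp]:
  "vec_inl (x + y) = vec_inl x + vec_inl y" "vec_inl (cscale c x) = cscale c (vec_inl x)" "vec_inl 0 = 0"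
  by (auto simp: vec_inl_def fun_eq_iff fun_arith cscale_def split: sum.splits)

lemma vec_inr_linear:
  "vec_inr (\<lambda>a. w a + w' a) = vec_inr w + vec_inr w'" "vec_inr (\<lambda>a. cscale c (w a)) = cscale c (vec_inr w)"
  "vec_inr (\<lambda>_. 0) = 0"
  by (auto simp: vec_inr_def fun_eq_iff fun_arith cscale_def split: sum.splits)

lemma vec_inl_between: "linear_between U (vec_inl ` U) vec_inl"
  and bij_vec_inl: "bij_betw vec_inl U (vec_inl ` U)"
proof -
  show "linear_between U (vec_inl ` U) vec_inl" by (simp add: linear_between_def)
  show "bij_betw vec_inl U (vec_inl ` U)"
    by (rule inj_on_imp_bij_betw, rule inj_on_inverseI[of _ vec_outl]) simp
qed

lemma vec_out_linear:
  "vec_outl (vec_inl x + vec_inl y) = x + y" "vec_outl (cscale c (vec_inl x)) = cscale c x"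
  "vec_outr (vec_inr w + vec_inr w') = (\<lambda>a. w a + w' a)" "vec_outr (cscale c (vec_inr w)) = (\<lambda>a. cscale c (w a))"
  by (simp_all flip: vec_inl_linear vec_inr_linear)

lemma linear_between_outl:
  assumes "linear_between U W g"
  shows "linear_between (vec_inl ` U) W (\<lambda>y. g (vec_outl y))"
  using assms by (auto simp: linear_between_def vec_out_linear simp del: vec_inl_linear)

text \<open>The external direct sum realised inside one function space, indexed by summand and
  coordinate. Requiring zero outside D gives each tuple exactly one representative.\<close>

definition sum_space :: "'a set \<Rightarrow> ('a \<Rightarrow> ('b \<Rightarrow> complex) set) \<Rightarrow> ('b + 'a \<times> 'b \<Rightarrow> complex) set" where
  "sum_space D U = vec_inr ` {w. (\<forall>a\<in>D. w a \<in> U a) \<and> (\<forall>a. a \<notin> D \<longrightarrow> w a = 0)}"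

lemma sum_space_dim:
  assumes "finite D" "\<And>a. a \<in> D \<Longrightarrow> fin_dim_space (U a)"
  shows "fin_dim_space (sum_space D U) \<and> cvec.dim (sum_space D U) = (\<Sum>a\<in>D. cvec.dim (U a))"
  using assms
proof (induction D rule: finite_induct)
  case empty
  have "sum_space {} U = {0}"
    by (auto simp: sum_space_def vec_inr_linear(3)[symmetric] intro!: arg_cong[of _ _ vec_inr])
  moreover have "fin_dim_space ({0} :: ('b + 'a \<times> 'b \<Rightarrow> complex) set)"
    unfolding fin_dim_space_def by (rule exI[of _ "{}"]) simp
  moreover have "cvec.dim ({0} :: ('b + 'a \<times> 'b \<Rightarrow> complex) set) = 0"
    by (metis card.empty cvec.dim_span_eq_card_independent cvec.independent_empty cvec.span_empty)
  ultimately show ?case by simp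
next
  case (insert c D)
  let ?f = "\<lambda>x. vec_inr (point_fam c x)"
  note s = fin_dim_subspace[OF insert.prems]
  have f: "linear_between (U c) (?f ` U c) ?f"
  proof -
    have "point_fam c (x + y) = (\<lambda>a. point_fam c x a + point_fam c y a)"
      "point_fam c (cscale d x) = (\<lambda>a. cscale d (point_fam c x a))" for x y :: "'b \<Rightarrow> complex" and d
      by (auto simp: point_fam_def)
    then show ?thesis by (simp add: linear_between_def vec_inr_linear)
  qed
  have inj: "inj_on ?f (U c)"
    by (rule inj_onI) (metis point_fam_simps(1) vec_simps(2))
  have IH: "fin_dim_space (sum_space D U)" "cvec.dim (sum_space D U) = (\<Sum>a\<in>D. cvec.dim (U a))"
    using insert by auto
  have fc: "fin_dim_space (?f ` U c)" "cvec.dim (?f ` U c) = cvec.dim (U c)"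
    using fin_dim_image[OF f] dim_image[OF f inj] insert.prems by auto
  have int: "?f ` U c \<inter> sum_space D U = {0}"
  proof
    show "?f ` U c \<inter> sum_space D U \<subseteq> {0}"
    proof
      fix y assume "y \<in> ?f ` U c \<inter> sum_space D U"
      then obtain x w where "y = vec_inr (point_fam c x)" "y = vec_inr w" "\<forall>a. a \<notin> D \<longrightarrow> w a = 0"
        unfolding sum_space_def by blast
      then have "x = 0" by (metis insert.hyps(2) point_fam_simps(1) vec_simps(2))
      then have "point_fam c x = (\<lambda>_. 0)" by (auto simp: point_fam_def)
      then show "y \<in> {0}" using \<open>y = vec_inr (point_fam c x)\<close> by (simp add: vec_inr_linear)
    qed
    show "{0} \<subseteq> ?f ` U c \<inter> sum_space D U"
      using cvec.subspace_0[OF fin_dim_subspace[OF IH(1)]] cvec.subspace_0[OF fin_dim_subspace[OF fc(1)]] by simp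
  qed
  have sum: "sum_space (insert c D) U = {x + y | x y. x \<in> ?f ` U c \<and> y \<in> sum_space D U}"
  proof (intro subset_antisym subsetI)
    fix y assume "y \<in> sum_space (insert c D) U"
    then obtain w where w: "y = vec_inr w" "\<forall>a\<in>insert c D. w a \<in> U a" "\<forall>a. a \<notin> insert c D \<longrightarrow> w a = 0"
      by (auto simp: sum_space_def)
    have "w = (\<lambda>a. point_fam c (w c) a + (w(c := 0)) a)"
      by (auto simp: point_fam_def)
    then have "y = ?f (w c) + vec_inr (w(c := 0))"
      using w(1) vec_inr_linear(1)[of "point_fam c (w c)" "w(c := 0)"] by simp
    moreover have "vec_inr (w(c := 0)) \<in> sum_space D U"
      unfolding sum_space_def using w insert.hyps(2) by (intro imageI) auto
    ultimately show "y \<in> {x + y | x y. x \<in> ?f ` U c \<and> y \<in> sum_space D U}"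
      using w(2) by blast
  next
    fix z assume "z \<in> {x + y | x y. x \<in> ?f ` U c \<and> y \<in> sum_space D U}"
    then obtain x w where z: "z = ?f x + vec_inr w" "x \<in> U c" "\<forall>a\<in>D. w a \<in> U a" "\<forall>a. a \<notin> D \<longrightarrow> w a = 0"
      by (auto simp: sum_space_def)
    moreover have "(\<lambda>a. point_fam c x a + w a) = w(c := x)"
      using z(4) insert.hyps(2) by (intro ext) (simp add: point_fam_def)
    ultimately have "z = vec_inr (w(c := x))"
      using vec_inr_linear(1)[of "point_fam c x" w] by simp
    then show "z \<in> sum_space (insert c D) U"
      unfolding sum_space_def using z by auto
  qed
  show ?case
    using dim_direct_sum[OF fc(1) IH(1) int sum] fc(2) IH(2) insert.hyps by simp
qed

section \<open>Isomorphism of representations\<close>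

lemma (in wf_digraph) rep_iso_trans: "rep_iso G U V \<Longrightarrow> rep_iso G V W \<Longrightarrow> rep_iso G U W"
proof -
  assume "rep_iso G U V" "rep_iso G V W"
  then obtain f g where
    f: "\<And>v. v \<in> verts G \<Longrightarrow> linear_between (space U v) (space V v) (f v) \<and> bij_betw (f v) (space U v) (space V v)"
      "\<And>a x. a \<in> arcs G \<Longrightarrow> x \<in> space U (tail G a) \<Longrightarrow> f (head G a) (amap U a x) = amap V a (f (tail G a) x)" and
    g: "\<And>v. v \<in> verts G \<Longrightarrow> linear_between (space V v) (space W v) (g v) \<and> bij_betw (g v) (space V v) (space W v)"
      "\<And>a x. a \<in> arcs G \<Longrightarrow> x \<in> space V (tail G a) \<Longrightarrow> g (head G a) (amap V a x) = amap W a (g (tail G a) x)"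
    unfolding rep_iso_def by metis
  have "f (tail G a) x \<in> space V (tail G a)" if "a \<in> arcs G" "x \<in> space U (tail G a)" for a x
    using f(1)[of "tail G a"] that by (auto simp: linear_between_def)
  moreover have "linear_between (space U v) (space W v) (g v \<circ> f v) \<and>
      bij_betw (g v \<circ> f v) (space U v) (space W v)" if "v \<in> verts G" for v
    using f(1)[OF that] g(1)[OF that] linear_between_comp bij_betw_trans by blast
  ultimately show "rep_iso G U W"
    unfolding rep_iso_def using f(2) g(2) by (intro exI[of _ "\<lambda>v. g v \<circ> f v"]) simp
qed

lemma (in wf_digraph) rep_iso_sym:
  assumes V: "is_rep G V" and iso: "rep_iso G V W"
  shows "rep_iso G W V"
proof -
  from iso obtain f where
    f: "\<And>v. v \<in> verts G \<Longrightarrow> linear_between (space V v) (space W v) (f v)"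
      "\<And>v. v \<in> verts G \<Longrightarrow> bij_betw (f v) (space V v) (space W v)"
      "\<And>a x. a \<in> arcs G \<Longrightarrow> x \<in> space V (tail G a) \<Longrightarrow> f (head G a) (amap V a x) = amap W a (f (tail G a) x)"
    unfolding rep_iso_def by metis
  note inv = linear_bij_inverse[OF f(1) f(2) rep_subspace[OF V]]
  let ?g = "\<lambda>v. inv_into (space V v) (f v)"
  have "?g (head G a) (amap W a y) = amap V a (?g (tail G a) y)" if a: "a \<in> arcs G" and y: "y \<in> space W (tail G a)" for a y
  proof -
    have t: "tail G a \<in> verts G" and h: "head G a \<in> verts G" using a by auto
    have x: "?g (tail G a) y \<in> space V (tail G a)" using inv(1)[OF t t t] y by (auto simp: linear_between_def)
    have "amap W a y = f (head G a) (amap V a (?g (tail G a) y))"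
      using f(3)[OF a x] inv(4)[OF t t t y] by simp
    then show ?thesis
      using inv(3)[OF h h h, of "amap V a (?g (tail G a) y)"] lin_in[OF rep_arrow[OF V a] rep_subspace[OF V t] x] by simp
  qed
  then show ?thesis
    unfolding rep_iso_def using inv(1,2) by (intro exI[of _ ?g]) auto
qed

lemma rep_iso_dimension:
  assumes V: "is_rep G V" and iso: "rep_iso G V W" and d: "has_dimension G V \<beta>"
  shows "has_dimension G W \<beta>"
  unfolding has_dimension_def
proof
  fix v assume v: "v \<in> verts G"
  obtain f where f: "linear_between (space V v) (space W v) f" "bij_betw f (space V v) (space W v)"
    using iso v unfolding rep_iso_def by blast
  then have "cvec.dim (space W v) = cvec.dim (space V v)"
    using dim_image[OF f(1)] V v by (metis bij_betw_def is_rep_def)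
  then show "int (cvec.dim (space W v)) = \<beta> v" using d v by (simp add: has_dimension_def)
qed

text \<open>Coordinates with respect to a basis, padded by zeros. Reflection enlarges the index
  type, while points of the varieties are classes of representations over \<open>nat\<close>, so the
  reflected module has to be moved back.\<close>

lemma embed_nat:
  fixes U :: "('b \<Rightarrow> complex) set"
  assumes U: "fin_dim_space U"
  shows "\<exists>f :: ('b \<Rightarrow> complex) \<Rightarrow> nat \<Rightarrow> complex. linear_between U (f ` U) f \<and> inj_on f U"
proof -
  obtain B where B: "finite B" "B \<subseteq> U" "cvec.independent B" "cvec.span B = U"
    using fin_dim_basis[OF U] by metis
  obtain g where g: "bij_betw g B {..<card B}"
    using ex_bij_betw_finite_nat[OF B(1)] by (auto simp: atLeast0LessThan)
  let ?f = "\<lambda>x k. if k < card B then cvec.representation B x (inv_into B g k) else 0"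
  have "?f (x + y) = ?f x + ?f y" "?f (cscale c x) = cscale c (?f x)" if "x \<in> U" "y \<in> U" for x y c
    using that B
    by (auto simp: fun_eq_iff fun_arith cscale_apply cvec.representation_add cvec.representation_scale)
  then have "linear_between U (?f ` U) ?f" by (auto simp: linear_between_def)
  moreover have "inj_on ?f U"
  proof (rule inj_onI)
    fix x y assume xy: "x \<in> U" "y \<in> U" "?f x = ?f y"
    have "cvec.representation B x b = cvec.representation B y b" if "b \<in> B" for b
    proof -
      have "g b < card B" "inv_into B g (g b) = b"
        using g that by (auto simp: bij_betw_def)
      then show ?thesis using fun_cong[OF xy(3), of "g b"] by simp
    qed
    then have "(\<Sum>b\<in>B. cscale (cvec.representation B x b) b) = (\<Sum>b\<in>B. cscale (cvec.representation B y b) b)"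
      by simp
    then show "x = y"
      using cvec.sum_representation_eq[OF B(3) _ B(1) subset_refl] B(4) xy by simp
  qed
  ultimately show ?thesis by blast
qed

lemma (in wf_digraph) std_rep_exists:
  fixes V :: "('a, 'b, 'c) quiver_rep"
  assumes V: "is_rep G V"
  shows "\<exists>W :: ('a, 'b, nat) quiver_rep. is_rep G W \<and> rep_iso G V W"
proof -
  have fd: "fin_dim_space (space V v)" if "v \<in> verts G" for v using V that by (simp add: is_rep_def)
  then have "\<forall>v\<in>verts G. \<exists>f :: ('c \<Rightarrow> complex) \<Rightarrow> nat \<Rightarrow> complex.
      linear_between (space V v) (f ` space V v) f \<and> inj_on f (space V v)"
    by (intro ballI embed_nat)
  from bchoice[OF this] obtain f :: "'a \<Rightarrow> ('c \<Rightarrow> complex) \<Rightarrow> nat \<Rightarrow> complex" where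
    f: "\<And>v. v \<in> verts G \<Longrightarrow> linear_between (space V v) (f v ` space V v) (f v)"
      "\<And>v. v \<in> verts G \<Longrightarrow> inj_on (f v) (space V v)"
    by blast
  have bij: "bij_betw (f v) (space V v) (f v ` space V v)" if "v \<in> verts G" for v
    using f(2)[OF that] by (simp add: bij_betw_def)
  note inv = linear_bij_inverse[OF f(1) bij rep_subspace[OF V]]
  define W where "W = \<lparr>space = (\<lambda>v. f v ` space V v),
    amap = (\<lambda>a y. f (head G a) (amap V a (inv_into (space V (tail G a)) (f (tail G a)) y)))\<rparr>"
  have "is_rep G W"
    unfolding is_rep_def
  proof (intro conjI ballI)
    show "fin_dim_space (space W v)" if "v \<in> verts G" for v
      using fin_dim_image[OF f(1)[OF that] fd[OF that]] by (simp add: W_def)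
    show "linear_between (space W (tail G a)) (space W (head G a)) (amap W a)" if a: "a \<in> arcs G" for a
    proof -
      have t: "tail G a \<in> verts G" and h: "head G a \<in> verts G" using a by auto
      show ?thesis
        using linear_between_comp[OF linear_between_comp[OF inv(1)[OF t t t] rep_arrow[OF V a]] f(1)[OF h]]
        by (simp add: W_def comp_def)
    qed
  qed
  moreover have "rep_iso G V W"
    unfolding rep_iso_def using f(1) bij inv(3) by (intro exI[of _ f]) (auto simp: W_def)
  ultimately show ?thesis by blast
qed

section \<open>The reflected module\<close>

text \<open>Both Ringel terms are collected into one sum over the arrows of the double quiver that
  enter j, the same index set as in the direct sum of the reflection functor.\<close>

lemma sym_form_unit:
  assumes "fin_digraph Q" "j \<in> verts Q"
  shows "sym_form Q \<beta> (Defs.unit_vec j) = 2 * \<beta> j - (\<Sum>a\<in>in_arrows Q j. \<beta> (tail (double Q) a))"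
proof -
  interpret fin_digraph Q by fact
  have "(\<Sum>a\<in>in_arrows Q j. \<beta> (tail (double Q) a)) =
      (\<Sum>a\<in>arcs Q. (if head Q a = j then \<beta> (tail Q a) else 0) + (if tail Q a = j then \<beta> (head Q a) else 0))"
    by (subst sum_in_arrows[OF finite_arcs], subst sum_double[OF finite_arcs]) (simp add: double_def cong: if_cong)
  moreover have "(\<Sum>v\<in>verts Q. \<beta> v * Defs.unit_vec j v) = \<beta> j" "(\<Sum>v\<in>verts Q. Defs.unit_vec j v * \<beta> v) = \<beta> j"
    using assms(2) by (simp_all add: Defs.unit_vec_def if_distrib if_distribR cong: if_cong)
  moreover have "(\<Sum>a\<in>arcs Q. \<beta> (tail Q a) * Defs.unit_vec j (head Q a)) = (\<Sum>a\<in>arcs Q. if head Q a = j then \<beta> (tail Q a) else 0)"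
    "(\<Sum>a\<in>arcs Q. Defs.unit_vec j (tail Q a) * \<beta> (head Q a)) = (\<Sum>a\<in>arcs Q. if tail Q a = j then \<beta> (head Q a) else 0)"
    by (auto simp: Defs.unit_vec_def intro!: sum.cong)
  ultimately show ?thesis
    by (simp add: sym_form_def ringel_form_def sum.distrib)
qed

locale reflectable = loop_free_vertex Q i for Q :: "('v, 'a) pre_digraph" and i +
  fixes V :: "('v, 'a darrow, 'b) quiver_rep" and \<tau> :: "'v \<Rightarrow> complex"
  assumes V: "is_rep (double Q) V" and m: "moment Q \<tau> V i" and \<tau>: "\<tau> i \<noteq> 0"
begin

abbreviation "V' \<equiv> reflect_rep Q \<tau> i V"
abbreviation "rpi \<equiv> refl_pi Q \<tau> i V"
abbreviation "rmu \<equiv> refl_mu Q i V"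
abbreviation "rpr \<equiv> refl_proj Q \<tau> i V"
abbreviation "S \<equiv> refl_sum Q i V"

lemma S_iff: "w \<in> S \<longleftrightarrow> (\<forall>a\<in>C. w a \<in> space V (tail (double Q) a)) \<and> (\<forall>a. a \<notin> C \<longrightarrow> w a = 0)"
  by (simp add: refl_sum_def)

lemma S_add: "w \<in> S \<Longrightarrow> w' \<in> S \<Longrightarrow> (\<lambda>a. w a + w' a) \<in> S"
  using subsp[OF V C_tail_in] by (auto simp: S_iff cvec.subspace_add)

lemma lin_C: "c \<in> C \<Longrightarrow> linear_between (space V (tail (double Q) c)) (space V i) (amap V c)"
  and lin_star: "c \<in> C \<Longrightarrow> linear_between (space V i) (space V (tail (double Q) c)) (amap V (star c))"
  using D.rep_arrow[OF V, of c] D.rep_arrow[OF V, of "star c"] C_arc[of c] C_head[of c] by auto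

lemma pi_in: "w \<in> S \<Longrightarrow> rpi w \<in> space V i"
  unfolding refl_pi_def S_iff
  by (intro cvec.subspace_sum cvec.subspace_scale subsp[OF V i_in]) (auto intro: C_in[OF V])

lemma pi_add: "w \<in> S \<Longrightarrow> w' \<in> S \<Longrightarrow> rpi (\<lambda>a. w a + w' a) = rpi w + rpi w'"
  unfolding refl_pi_def S_iff
  by (subst sum.distrib[symmetric], rule sum.cong)
    (auto simp: lin_add[OF lin_C subsp[OF V C_tail_in]] cscale_add_right)

lemma pi_scale: "w \<in> S \<Longrightarrow> rpi (\<lambda>a. cscale c (w a)) = cscale c (rpi w)"
  unfolding refl_pi_def S_iff cscale_sum_right
  by (rule sum.cong) (auto simp: lin_scale[OF lin_C subsp[OF V C_tail_in]] mult.commute)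

lemma mu_in: "x \<in> space V i \<Longrightarrow> rmu x \<in> S"
  using subsp[OF V C_tail_in] star_in[OF V] by (auto simp: S_iff refl_mu_def intro: cvec.subspace_scale)

lemma mu_add: "x \<in> space V i \<Longrightarrow> y \<in> space V i \<Longrightarrow> rmu (x + y) = (\<lambda>a. rmu x a + rmu y a)"
proof
  fix a assume "x \<in> space V i" "y \<in> space V i"
  then show "rmu (x + y) a = rmu x a + rmu y a"
    by (cases "a \<in> C") (simp_all add: refl_mu_def lin_add[OF lin_star subsp[OF V i_in]] cscale_add_right)
qed

lemma mu_scale: "x \<in> space V i \<Longrightarrow> rmu (cscale c x) = (\<lambda>a. cscale c (rmu x a))"
proof
  fix a assume "x \<in> space V i"
  then show "rmu (cscale c x) a = cscale c (rmu x a)"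
    by (cases "a \<in> C") (simp_all add: refl_mu_def lin_scale[OF lin_star subsp[OF V i_in]] mult.commute)
qed

lemma pi_mu: "x \<in> space V i \<Longrightarrow> rpi (rmu x) = x"
proof -
  assume x: "x \<in> space V i"
  have "rpi (rmu x) = cscale (inverse (\<tau> i)) (\<Sum>c\<in>C. cscale (arrow_sign c) (amap V c (amap V (star c) x)))"
    unfolding refl_pi_def cscale_sum_right refl_mu_def using star_in[OF V _ x]
    by (intro sum.cong) (simp_all add: lin_scale[OF lin_C subsp[OF V C_tail_in]])
  then show ?thesis using moment_recover[OF m \<tau> x] by simp
qed

lemma pr_eq: "rpr w = (\<lambda>a. w a - rmu (rpi w) a)"
  by (rule ext) (simp add: refl_proj_def fun_arith)

lemma pr_eq_add:
  assumes "w \<in> S"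
  shows "rpr w = (\<lambda>a. w a + rmu (cscale (- 1) (rpi w)) a)"
proof
  fix a
  have "rmu (cscale (- 1) (rpi w)) a = cscale (- 1) (rmu (rpi w) a)"
    using fun_cong[OF mu_scale[OF pi_in[OF assms], of "- 1"]] .
  then show "rpr w a = w a + rmu (cscale (- 1) (rpi w)) a"
    by (simp only: pr_eq) simp
qed

lemma
  assumes w: "w \<in> S"
  shows pr_in: "rpr w \<in> S" and pi_pr: "rpi (rpr w) = 0"
proof -
  have x: "cscale (- 1) (rpi w) \<in> space V i"
    by (rule cvec.subspace_scale[OF subsp[OF V i_in] pi_in[OF w]])
  show "rpr w \<in> S"
    unfolding pr_eq_add[OF w] by (rule S_add[OF w mu_in[OF x]])
  have "rpi (rpr w) = rpi w + cscale (- 1) (rpi w)"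
    unfolding pr_eq_add[OF w] pi_add[OF w mu_in[OF x]] pi_mu[OF x] ..
  then show "rpi (rpr w) = 0" by simp
qed

lemma pr_fix: "rpi w = 0 \<Longrightarrow> rpr w = w"
proof -
  assume 0: "rpi w = 0"
  have "rmu 0 a = 0" for a
    using lin_zero[OF lin_star subsp[OF V i_in]] by (auto simp: refl_mu_def)
  then show ?thesis by (simp add: pr_eq 0)
qed

text \<open>Since \<pi> \<mu> = 1, the operator 1 - \<mu> \<pi> projects the direct sum onto the
  kernel of \<pi>, so the new space at i is that kernel.\<close>

lemma pr_image: "rpr ` S = {w \<in> S. rpi w = 0}"
proof
  show "rpr ` S \<subseteq> {w \<in> S. rpi w = 0}" using pr_in pi_pr by auto
  show "{w \<in> S. rpi w = 0} \<subseteq> rpr ` S" using pr_fix by force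
qed

lemma pr_add: "w \<in> S \<Longrightarrow> w' \<in> S \<Longrightarrow> rpr (\<lambda>a. w a + w' a) = (\<lambda>a. rpr w a + rpr w' a)"
  unfolding pr_eq by (rule ext) (simp add: pi_add mu_add pi_in)

lemma pr_scale: "w \<in> S \<Longrightarrow> rpr (\<lambda>a. cscale c (w a)) = (\<lambda>a. cscale c (rpr w a))"
  unfolding pr_eq by (rule ext) (simp add: pi_scale mu_scale pi_in cscale_diff_right)

lemma point_in_S: "c \<in> C \<Longrightarrow> x \<in> space V (tail (double Q) c) \<Longrightarrow> point_fam c x \<in> S"
  using cvec.subspace_0[OF subsp[OF V C_tail_in]] by (auto simp: S_iff point_fam_def)

lemma pi_point: "c \<in> C \<Longrightarrow> x \<in> space V (tail (double Q) c) \<Longrightarrow> rpi (point_fam c x) = cscale (inverse (\<tau> i)) (amap V c x)"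
proof -
  assume c: "c \<in> C" and x: "x \<in> space V (tail (double Q) c)"
  have "rpi (point_fam c x) = (\<Sum>a\<in>C. if a = c then cscale (inverse (\<tau> i)) (amap V c x) else 0)"
    unfolding refl_pi_def
    by (rule sum.cong) (auto simp: point_fam_def lin_zero[OF lin_C subsp[OF V C_tail_in]])
  then show ?thesis using c finite_C by simp
qed

lemma space_V'_i: "space V' i = vec_inr ` rpr ` S"
  and space_V': "v \<noteq> i \<Longrightarrow> space V' v = vec_inl ` space V v"
  by (simp_all add: reflect_rep_def)

lemma amap_V'_in: "c \<in> C \<Longrightarrow> amap V' c y = cscale (- \<tau> i) (vec_inr (rpr (point_fam c (vec_outl y))))"
  and amap_V'_out: "b \<in> arcs (double Q) \<Longrightarrow> tail (double Q) b = i \<Longrightarrow>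
    amap V' b y = vec_inl (cscale (arrow_sign (star b)) (vec_outr y (star b)))"
  and amap_V'_rest: "head (double Q) a \<noteq> i \<Longrightarrow> tail (double Q) a \<noteq> i \<Longrightarrow> amap V' a y = vec_inl (amap V a (vec_outl y))"
  using tail_i_head by (auto simp: reflect_rep_def point_fam_def C_head simp del: double_simps(6))

lemma S_sum_space: "vec_inr ` S = sum_space C (\<lambda>c. space V (tail (double Q) c))"
  by (simp only: sum_space_def refl_sum_def)

lemma fin_dim_S: "fin_dim_space (vec_inr ` S)" "cvec.dim (vec_inr ` S) = (\<Sum>c\<in>C. cvec.dim (space V (tail (double Q) c)))"
proof -
  have "fin_dim_space (space V (tail (double Q) c))" if "c \<in> C" for c
    using V C_tail_in[OF that] by (simp add: is_rep_def)
  from sum_space_dim[OF finite_C this]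
  show "fin_dim_space (vec_inr ` S)" "cvec.dim (vec_inr ` S) = (\<Sum>c\<in>C. cvec.dim (space V (tail (double Q) c)))"
    by (simp_all add: S_sum_space)
qed

lemma pr_linear: "linear_between (vec_inr ` S) (space V' i) (\<lambda>y. vec_inr (rpr (vec_outr y)))"
proof -
  have "vec_outr (vec_inr w + vec_inr w') = (\<lambda>a. w a + w' a)" for w w' :: "'a darrow \<Rightarrow> 'b \<Rightarrow> complex"
    by (simp flip: vec_inr_linear)
  moreover have "vec_outr (cscale c (vec_inr w)) = (\<lambda>a. cscale c (w a))" for w :: "'a darrow \<Rightarrow> 'b \<Rightarrow> complex" and c
    by (simp flip: vec_inr_linear)
  ultimately show ?thesis
    by (auto simp: linear_between_def space_V'_i pr_add pr_scale vec_inr_linear)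
qed

lemma fin_dim_V'_i: "fin_dim_space (space V' i)"
proof -
  have "space V' i = (\<lambda>y. vec_inr (rpr (vec_outr y))) ` vec_inr ` S"
    by (simp add: space_V'_i image_image)
  then show ?thesis using fin_dim_image[OF pr_linear fin_dim_S(1)] by simp
qed

theorem is_rep_reflect: "is_rep (double Q) V'"
  unfolding is_rep_def
proof (intro conjI ballI)
  fix v assume v: "v \<in> verts (double Q)"
  have "fin_dim_space (vec_inl ` space V v)"
    using fin_dim_image[OF vec_inl_between] V v by (auto simp: is_rep_def)
  then show "fin_dim_space (space V' v)"
    using fin_dim_V'_i space_V'[of v] by (cases "v = i") auto
next
  fix a assume a: "a \<in> arcs (double Q)"
  let ?t = "tail (double Q) a" and ?h = "head (double Q) a"
  note lV = D.rep_arrow[OF V a]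
  show "linear_between (space V' ?t) (space V' ?h) (amap V' a)"
  proof (cases "?h = i")
    case True
    then have c: "a \<in> C" using a by (simp add: in_arrows_def)
    have p: "point_fam a (x + y) = (\<lambda>b. point_fam a x b + point_fam a y b)"
      "point_fam a (cscale d x) = (\<lambda>b. cscale d (point_fam a x b))" for x y :: "'b \<Rightarrow> complex" and d
      by (auto simp: point_fam_def)
    have l: "linear_between (space V ?t) (space V' i) (\<lambda>x. vec_inr (rpr (point_fam a x)))"
      using point_in_S[OF c]
      by (auto simp: linear_between_def space_V'_i p pr_add pr_scale vec_inr_linear)
    have "linear_between (space V ?t) (space V' i) (\<lambda>x. cscale (- \<tau> i) (vec_inr (rpr (point_fam a x))))"
      by (rule linear_between_scale[OF fin_dim_subspace[OF fin_dim_V'_i] l])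
    from linear_between_outl[OF this] show ?thesis
      unfolding amap_V'_in[OF c, THEN ext[of "amap V' a"]] True space_V'[OF C_tail[OF c]] .
  next
    case h: False
    show ?thesis
    proof (cases "?t = i")
      case True
      have "star a \<in> C" by (rule star_in_C[OF a True])
      then have "w (star a) \<in> space V ?h" if "w \<in> S" for w using that a by (auto simp: S_iff)
      then have in1: "cscale c (w (star a)) \<in> space V ?h" if "w \<in> S" for w c
        using that cvec.subspace_scale[OF subsp[OF V e_arc(1)[OF a]]] by blast
      have "vec_outr (vec_inr w + vec_inr w') b = w b + w' b" "vec_outr (cscale d (vec_inr w)) b = cscale d (w b)"
        for w w' :: "'a darrow \<Rightarrow> 'b \<Rightarrow> complex" and d b
        by (simp_all flip: vec_inr_linear)
      then show ?thesis
        unfolding linear_between_def True space_V'_i space_V'[OF h]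
        using in1[OF pr_in] by (auto simp: amap_V'_out[OF a True] cscale_add_right mult.commute simp flip: vec_inl_linear
            simp del: double_simps(6))
    next
      case False
      have "linear_between (space V ?t) (vec_inl ` space V ?h) (vec_inl \<circ> amap V a)"
        by (rule linear_between_comp[OF lV vec_inl_between])
      from linear_between_outl[OF this] show ?thesis
        unfolding amap_V'_rest[OF h False, THEN ext[of "amap V' a"]] space_V'[OF h] space_V'[OF False] o_apply .
    qed
  qed
qed

text \<open>In a product of new maps through i, the identity in 1 - \<mu> \<pi> contributes the
  scalar \<plusminus>\<tau> i on matching arrows, and \<mu> \<pi> reproduces the old product, with
  \<tau> i cancelling its inverse.\<close>

theorem ext_iso_reflect: "ext_iso (\<lambda>_. vec_inl) V V' (\<tau> i)"
  unfolding ext_iso_def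
proof (intro conjI ballI impI)
  fix v assume "v \<in> verts Q - {i}"
  then show "linear_between (space V v) (space V' v) vec_inl" "bij_betw vec_inl (space V v) (space V' v)"
    by (simp_all add: space_V' vec_inl_between bij_vec_inl)
next
  fix a x assume "tail (double Q) a \<noteq> i \<and> head (double Q) a \<noteq> i"
  then show "vec_inl (amap V a x) = amap V' a (vec_inl x)" by (simp add: amap_V'_rest)
next
  fix b c x assume b: "b \<in> arcs (double Q)" "tail (double Q) b = i" and c: "c \<in> C"
    and x: "x \<in> space V (tail (double Q) c)"
  have out: "vec_outr (cscale d (vec_inr w)) a = cscale d (w a)" for w :: "'a darrow \<Rightarrow> 'b \<Rightarrow> complex" and d a
    by (simp flip: vec_inr_linear)
  have lb: "linear_between (space V i) (space V (head (double Q) b)) (amap V b)"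
    using D.rep_arrow[OF V b(1)] b(2) by simp
  have "rpr (point_fam c x) (star b) =
      point_fam c x (star b) - rmu (cscale (inverse (\<tau> i)) (amap V c x)) (star b)"
    by (simp only: pr_eq pi_point[OF c x])
  also have "rmu (cscale (inverse (\<tau> i)) (amap V c x)) (star b) =
      cscale (- arrow_sign b) (cscale (inverse (\<tau> i)) (amap V b (amap V c x)))"
    using star_in_C[OF b] lin_scale[OF lb subsp[OF V i_in] C_in[OF V c x]] by (simp add: refl_mu_def)
  also have "point_fam c x (star b) = (if star b = c then x else 0)"
    by (simp add: point_fam_def)
  finally have p: "rpr (point_fam c x) (star b) = (if star b = c then x else 0) -
      cscale (- arrow_sign b) (cscale (inverse (\<tau> i)) (amap V b (amap V c x)))" .
  have "amap V' b (amap V' c (vec_inl x)) = vec_inl (cscale (arrow_sign b * \<tau> i)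
      ((if star b = c then x else 0) - cscale (- arrow_sign b) (cscale (inverse (\<tau> i)) (amap V b (amap V c x)))))"
  proof -
    have "arrow_sign (star b) * - \<tau> i = arrow_sign b * \<tau> i" by simp
    then show ?thesis
      unfolding p[symmetric] by (simp only: amap_V'_in[OF c] amap_V'_out[OF b] out vec_simps cscale_simps(4))
  qed
  also have "cscale (arrow_sign b * \<tau> i)
      ((if star b = c then x else 0) - cscale (- arrow_sign b) (cscale (inverse (\<tau> i)) (amap V b (amap V c x)))) =
      amap V b (amap V c x) + (if star b = c then cscale (\<tau> i * arrow_sign b) x else 0)"
  proof -
    have "arrow_sign b * \<tau> i * (arrow_sign b * inverse (\<tau> i)) = 1"
      using \<tau> by (cases b) auto
    then show ?thesis
      by (simp add: cscale_diff_right cscale_add_right add.commute mult.commute)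
  qed
  finally show "amap V' b (amap V' c (vec_inl x)) =
      vec_inl (amap V b (amap V c x) + (if star b = c then cscale (\<tau> i * arrow_sign b) x else 0))" .
qed

text \<open>Following the outgoing maps by the incoming ones reassembles w from its components, so
  the sum is -\<tau> i times (1 - \<mu> \<pi>) w, and w lies in the kernel of \<pi>.\<close>

lemma moment_reflect_i:
  assumes "\<tau>' i = - \<tau> i"
  shows "moment Q \<tau>' V' i"
  unfolding moment_def
proof
  fix y assume "y \<in> space V' i"
  then obtain w where w: "y = vec_inr w" "w \<in> S" "rpi w = 0" by (auto simp: space_V'_i pr_image)
  have s: "amap V' c (amap V' (star c) y) = cscale (- \<tau> i) (vec_inr (rpr (\<lambda>b. cscale (arrow_sign c) (point_fam c (w c) b))))"
    if c: "c \<in> C" for c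
  proof -
    have "amap V' (star c) y = vec_inl (cscale (arrow_sign c) (w c))"
      using amap_V'_out[of "star c" y] C_arc[OF c] C_head[OF c] by (simp add: w(1) del: vec_inl_linear)
    moreover have "point_fam c (cscale (arrow_sign c) (w c)) = (\<lambda>b. cscale (arrow_sign c) (point_fam c (w c) b))"
      by (auto simp: point_fam_def)
    ultimately show ?thesis by (simp add: amap_V'_in[OF c] del: vec_inl_linear)
  qed
  have wc: "point_fam c (w c) \<in> S" if "c \<in> C" for c
    using that w(2) by (intro point_in_S) (auto simp: S_iff)
  have sum: "vec_inr (\<lambda>b. \<Sum>c\<in>D. f c b) = (\<Sum>c\<in>D. vec_inr (f c :: 'a darrow \<Rightarrow> 'b \<Rightarrow> complex))" for D and f :: "'a darrow \<Rightarrow> _"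
    by (induction D rule: infinite_finite_induct) (simp_all add: vec_inr_linear)
  have prsum: "rpr (\<lambda>b. \<Sum>c\<in>D. f c b) = (\<lambda>b. \<Sum>c\<in>D. rpr (f c) b) \<and> (\<lambda>b. \<Sum>c\<in>D. f c b) \<in> S"
    if "\<And>c. c \<in> D \<Longrightarrow> f c \<in> S" for D and f :: "'a darrow \<Rightarrow> 'a darrow \<Rightarrow> 'b \<Rightarrow> complex"
  proof -
    have z: "(\<lambda>_. 0) \<in> S" using cvec.subspace_0[OF subsp[OF V C_tail_in]] by (simp add: S_iff)
    have "rpr (\<lambda>_. 0) = (\<lambda>_. 0)"
      using pr_scale[OF z, of 0] by simp
    then show ?thesis
      using that z by (induction D rule: infinite_finite_induct) (simp_all add: pr_add S_add)
  qed
  have "(\<Sum>c\<in>C. cscale (arrow_sign c) (amap V' c (amap V' (star c) y))) =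
      (\<Sum>c\<in>C. cscale (- \<tau> i) (vec_inr (rpr (point_fam c (w c)))))"
  proof (rule sum.cong[OF refl])
    fix c assume c: "c \<in> C"
    have sgn: "arrow_sign c * (- \<tau> i * arrow_sign c) = - \<tau> i" by (cases c) auto
    show "cscale (arrow_sign c) (amap V' c (amap V' (star c) y)) = cscale (- \<tau> i) (vec_inr (rpr (point_fam c (w c))))"
      unfolding s[OF c] pr_scale[OF wc[OF c]] vec_inr_linear by (simp only: cscale_simps(4) sgn)
  qed
  also have "\<dots> = cscale (- \<tau> i) (vec_inr (rpr (\<lambda>b. \<Sum>c\<in>C. point_fam c (w c) b)))"
    using prsum[of C "\<lambda>c. point_fam c (w c)"] wc by (simp add: sum cscale_sum_right)
  also have "(\<lambda>b. \<Sum>c\<in>C. point_fam c (w c) b) = w"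
  proof
    fix b
    have "(\<Sum>c\<in>C. point_fam c (w c) b) = (\<Sum>c\<in>C. if c = b then w b else 0)"
      by (rule sum.cong) (auto simp: point_fam_def)
    then show "(\<Sum>c\<in>C. point_fam c (w c) b) = w b"
      using w(2) finite_C by (auto simp: S_iff)
  qed
  finally show "(\<Sum>c\<in>C. cscale (arrow_sign c) (amap V' c (amap V' (star c) y))) = cscale (\<tau>' i) y"
    using assms w pr_fix by simp
qed

text \<open>The direct sum splits into the kernel of \<pi> and the image of \<mu>, and \<mu> is
  injective.\<close>

lemma dim_reflect_i: "cvec.dim (space V' i) + cvec.dim (space V i) = (\<Sum>c\<in>C. cvec.dim (space V (tail (double Q) c)))"
proof -
  let ?f = "\<lambda>x. vec_inr (rmu x)"
  have f: "linear_between (space V i) (?f ` space V i) ?f"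
    by (simp add: linear_between_def mu_add mu_scale vec_inr_linear)
  have inj: "inj_on ?f (space V i)"
    by (rule inj_onI) (metis pi_mu vec_simps(2))
  have fd: "fin_dim_space (space V i)" using V i_in by (simp add: is_rep_def)
  have int: "space V' i \<inter> ?f ` space V i = {0}"
  proof
    show "space V' i \<inter> ?f ` space V i \<subseteq> {0}"
    proof
      fix y assume "y \<in> space V' i \<inter> ?f ` space V i"
      then obtain w x where w: "y = vec_inr w" "rpi w = 0" and x: "y = vec_inr (rmu x)" "x \<in> space V i"
        unfolding space_V'_i pr_image by blast
      then have "x = 0" by (metis pi_mu vec_simps(2))
      then show "y \<in> {0}" using x lin_zero[OF f subsp[OF V i_in]] by simp
    qed
    show "{0} \<subseteq> space V' i \<inter> ?f ` space V i"
      using cvec.subspace_0[OF fin_dim_subspace[OF fin_dim_V'_i]]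
        cvec.subspace_0[OF subspace_image[OF f subsp[OF V i_in]]] by simp
  qed
  have sum: "vec_inr ` S = {x + y | x y. x \<in> space V' i \<and> y \<in> ?f ` space V i}"
  proof (intro subset_antisym subsetI)
    fix y assume "y \<in> vec_inr ` S"
    then obtain w where w: "y = vec_inr w" "w \<in> S" by auto
    have "w = (\<lambda>a. rpr w a + rmu (rpi w) a)" by (simp add: pr_eq)
    then have "y = vec_inr (rpr w) + ?f (rpi w)"
      using w(1) vec_inr_linear(1)[of "rpr w" "rmu (rpi w)"] by simp
    then show "y \<in> {x + y | x y. x \<in> space V' i \<and> y \<in> ?f ` space V i}"
      using w(2) pi_in[OF w(2)] by (auto simp: space_V'_i)
  next
    fix z assume "z \<in> {x + y | x y. x \<in> space V' i \<and> y \<in> ?f ` space V i}"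
    then obtain w x where "z = vec_inr (rpr w) + vec_inr (rmu x)" "w \<in> S" "x \<in> space V i"
      by (auto simp: space_V'_i)
    then show "z \<in> vec_inr ` S"
      using S_add[OF pr_in mu_in] by (auto simp flip: vec_inr_linear)
  qed
  show ?thesis
    using dim_direct_sum(2)[OF fin_dim_V'_i fin_dim_image[OF f fd] int sum] dim_image[OF f inj fd] fin_dim_S(2)
    by simp
qed

theorem reflect_dimension:
  assumes "has_dimension (double Q) V \<beta>"
  shows "has_dimension (double Q) V' (simple_reflection Q i \<beta>)"
  unfolding has_dimension_def
proof
  fix v assume "v \<in> verts (double Q)"
  then have v: "v \<in> verts Q" by simp
  have d: "int (cvec.dim (space V v)) = \<beta> v" if "v \<in> verts Q" for v
    using assms that by (simp add: has_dimension_def)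
  show "int (cvec.dim (space V' v)) = simple_reflection Q i \<beta> v"
  proof (cases "v = i")
    case True
    have "int (cvec.dim (space V' i)) = (\<Sum>c\<in>C. \<beta> (tail (double Q) c)) - \<beta> i"
      using arg_cong[OF dim_reflect_i, of int] d[OF i_in] d[OF C_tail_in] by simp
    then show ?thesis
      using sym_form_unit[OF fin_digraph_axioms i_in, of \<beta>] True by (simp add: simple_reflection_def Defs.unit_vec_def)
  next
    case False
    have "fin_dim_space (space V v)" using V v by (simp add: is_rep_def)
    then have "cvec.dim (vec_inl ` space V v :: ('b + 'a darrow \<times> 'b \<Rightarrow> complex) set) = cvec.dim (space V v)"
      using dim_image[OF vec_inl_between] bij_vec_inl[of "space V v"] by (auto simp: bij_betw_def)
    then show ?thesis
      using False d[OF v] by (simp add: space_V' simple_reflection_def Defs.unit_vec_def)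
  qed
qed

end

section \<open>The parameter and the relations of the reflected module\<close>

context loop_free_vertex
begin

lemma dual_reflection_i: "dual_reflection Q i \<tau> i = - \<tau> i"
proof -
  have "(\<Sum>a\<in>C. Defs.unit_vec i (tail (double Q) a)) = 0"
    using C_tail by (intro sum.neutral) (auto simp: Defs.unit_vec_def)
  then show ?thesis
    using sym_form_unit[OF fin_digraph_axioms i_in, of "Defs.unit_vec i"] by (simp add: dual_reflection_def Defs.unit_vec_def)
qed

lemma dual_reflection_other:
  assumes "v \<in> verts Q" "v \<noteq> i"
  shows "dual_reflection Q i \<tau> v = \<tau> v + of_nat (card {a \<in> in_arrows Q v. tail (double Q) a = i}) * \<tau> i"
proof -
  have fin: "finite (in_arrows Q v)" by (simp add: in_arrows_def double_def)
  have "(\<Sum>a\<in>in_arrows Q v. Defs.unit_vec i (tail (double Q) a)) = int (card {a \<in> in_arrows Q v. tail (double Q) a = i})"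
    using sum.inter_filter[OF fin, of "\<lambda>_. 1 :: int" "\<lambda>a. tail (double Q) a = i"] by (simp add: Defs.unit_vec_def)
  then show ?thesis
    using sym_form_unit[OF fin_digraph_axioms assms(1), of "Defs.unit_vec i"] assms(2)
    by (simp add: dual_reflection_def Defs.unit_vec_def)
qed

theorem preprojective_reflect:
  assumes "is_preprojective_module Q \<tau> V" "\<tau> i \<noteq> 0"
  shows "is_preprojective_module Q (dual_reflection Q i \<tau>) (reflect_rep Q \<tau> i V)"
proof -
  have V: "is_rep (double Q) V" and mV: "\<And>v. v \<in> verts Q \<Longrightarrow> moment Q \<tau> V v"
    using assms(1) by (auto simp: preprojective_iff)
  interpret reflectable Q i V \<tau>
    by unfold_locales (use V mV[OF i_in] assms(2) in auto)
  have "moment Q (dual_reflection Q i \<tau>) V' v" if v: "v \<in> verts Q" for v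
  proof (cases "v = i")
    case True
    then show ?thesis using moment_reflect_i[of "dual_reflection Q i \<tau>"] dual_reflection_i by simp
  next
    case False
    show ?thesis
      by (rule moment_transfer[OF V ext_iso_reflect mV[OF v] is_rep_reflect v False])
        (rule dual_reflection_other[OF v False])
  qed
  then show ?thesis by (simp add: preprojective_iff is_rep_reflect)
qed

end

section \<open>Integrating the infinitesimal shift\<close>

context ind_matrix
begin

text \<open>The curve X + t \<delta> keeps the incoming arrows fixed, so
  \<open>twist_derivative\<close> applies at every t. The derivative of an outgoing arrow contains
  the unknown \<open>fac \<sigma> (G t)\<close>, but in a product with an incoming arrow this
  cancels against the map at i, and what remains is independent of t.\<close>

theorem twist_shift:
  assumes X: "arep (double Q) e X" "\<And>c. c \<in> C \<Longrightarrow> X c = inj c"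
    and \<rho>: "D.path_endo \<rho>" "\<rho> (omega_elt Q) = omega_elt Q" and \<sigma>: "D.path_endo \<sigma>"
    and inv: "\<And>x. x \<in> A \<Longrightarrow> \<sigma> (\<rho> x) = x" "\<And>x. x \<in> A \<Longrightarrow> \<rho> (\<sigma> x) = x"
  defines "G \<equiv> \<lambda>t a. ev e (\<lambda>a. X a + csc t (\<delta> a)) (\<rho> (arr a))"
  shows "a \<in> arcs (double Q) \<Longrightarrow> tail (double Q) a \<noteq> i \<Longrightarrow> G t a = G 0 a"
    and "b \<in> arcs (double Q) \<Longrightarrow> tail (double Q) b = i \<Longrightarrow> c \<in> C \<Longrightarrow>
      G t b * G t c = G 0 b * G 0 c +
        csc t (csc (arrow_sign b) (if star b = c then e (tail (double Q) c) else 0))"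
proof -
  define Xt where "Xt = (\<lambda>t a. X a + csc t (\<delta> a))"
  define Xp where "Xp = (\<lambda>a. linear_family (X a) (\<delta> a))"
  define H where "H = (\<lambda>a. ev (cst \<circ> e) Xp (\<rho> (arr a)))"
  have Xt: "arep (double Q) e (Xt t)" for t
  proof (rule arep_change[OF X(1)])
    show "corner (double Q) e (Xt t)"
      using arep_corner[OF X(1)] corner_\<delta>
      by (auto simp: corner_def Xt_def distrib_left distrib_right csc_mult_left csc_mult_right)
  qed
  have XtC: "Xt t c = inj c" if "c \<in> C" for t c
    using X(2)[OF that] C_tail[OF that] by (simp add: Xt_def \<delta>_def)
  have eo: "eval_at t \<circ> (cst \<circ> e) = e" "eval_at t \<circ> Xp = Xt t" for t
    by (auto simp: fun_eq_iff Xp_def Xt_def)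
  have eH: "eval_at t (H a) = G t a" for t a
    by (simp add: H_def hom_ev[OF calg_hom_eval_at] eo) (simp add: G_def Xt_def)
  let ?j = "\<lambda>t M. Tri (eval_at t M) (deriv_at t M) 0 0"
  have je: "?j t \<circ> (cst \<circ> e) = tri0 \<circ> e" "?j t \<circ> Xp = (\<lambda>a. Tri (Xt t a) (\<delta> a) 0 0)" for t
    by (auto simp: fun_eq_iff tri0_def Xp_def Xt_def)
  have dH: "deriv_at t (H a) = t1 (ev (tri0 \<circ> e) (\<lambda>a. Tri (Xt t a) (\<delta> a) 0 0) (\<rho> (arr a)))" for t a
    using arg_cong[OF hom_ev[OF calg_hom_jet_fst, of t "cst \<circ> e" Xp "\<rho> (arr a)"], of t1]
    unfolding je by (simp add: H_def)
  have GXt: "G t = (\<lambda>a. ev e (Xt t) (\<rho> (arr a)))" for t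
    by (simp add: G_def Xt_def)
  have td1: "fac \<sigma> (G t) * (\<Sum>c\<in>C. G t c * proj c) = e i" for t
    unfolding GXt by (rule twist_derivative(1)[OF Xt XtC \<rho> \<sigma> inv])
  have td2: "deriv_at t (H a) = (if tail (double Q) a = i then csc (arrow_sign a) (proj (star a) * fac \<sigma> (G t)) else 0)"
    if "a \<in> arcs (double Q)" for t a
    unfolding GXt dH by (rule twist_derivative(2)[OF Xt XtC \<rho> \<sigma> inv that])
  have G: "arep (double Q) e (G t)" for t
    unfolding GXt by (rule D.arep_endo[OF \<rho>(1) finite_verts_double Xt])
  have dH0: "deriv_at t (H a) = 0" if "a \<in> arcs (double Q)" "tail (double Q) a \<noteq> i" for t a
    using td2[OF that(1)] that(2) by simp
  show "G t a = G 0 a" if "a \<in> arcs (double Q)" "tail (double Q) a \<noteq> i"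
    using eval_at_affine[of "H a" 0 t] dH0[OF that] by (simp add: eH)
  assume b: "b \<in> arcs (double Q)" "tail (double Q) b = i" and c: "c \<in> C"
  have "deriv_at t (H b * H c) = csc (arrow_sign b) (if star b = c then e (tail (double Q) c) else 0)" for t
  proof -
    have "deriv_at t (H b * H c) = csc (arrow_sign b) (proj (star b) * (fac \<sigma> (G t) * G t c))"
      using td2[OF b(1), of t] b(2)
      by (simp add: deriv_at_mult dH0[OF C_arc[OF c] C_tail[OF c]] eH csc_mult_left mult.assoc)
    \<comment> \<open>An incoming arrow is the restriction of the map at i to one summand; written
      this way, the map meets its inverse \<open>fac \<sigma> (G t)\<close>.\<close>
    also have "G t c = (\<Sum>c\<in>C. G t c * proj c) * inj c"
      by (rule sum_proj_inj[OF G c, symmetric])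
    also have "fac \<sigma> (G t) * \<dots> = inj c"
      using td1[of t] inj_corner(1)[OF c] by (simp flip: mult.assoc)
    finally show ?thesis
      using proj_inj[OF star_in_C[OF b] c] by auto
  qed
  from eval_at_affine[of "H b * H c", OF this, of t]
  show "G t b * G t c = G 0 b * G 0 c +
        csc t (csc (arrow_sign b) (if star b = c then e (tail (double Q) c) else 0))"
    by (simp add: hom_mult[OF calg_hom_eval_at] eH)
qed

end

section \<open>Twisting commutes with passing to the complement of a vertex\<close>

definition fmatrix :: "'i set \<Rightarrow> 'i set \<Rightarrow> ('i \<Rightarrow> 'i \<Rightarrow> complex) \<Rightarrow> ('i, complex) fmat" where
  "fmatrix P R f = Fmat (\<lambda>p q. if p \<in> P \<and> q \<in> R then f p q else 0)"

lemma ent_fmatrix: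
  "finite P \<Longrightarrow> finite R \<Longrightarrow> ent (fmatrix P R f) p q = (if p \<in> P \<and> q \<in> R then f p q else 0)"
  unfolding fmatrix_def by (subst ent_Fmat[of "P \<union> R"]) auto

lemma fmatrix_corner:
  assumes "finite P" "finite R"
  shows "funit P * fmatrix P R f = fmatrix P R f" "fmatrix P R f * funit R = fmatrix P R f"
  using assms by (auto intro!: ent_eqI simp: ent_funit_mult ent_mult_funit ent_fmatrix)

lemma ent_mult_cols:
  fixes M N :: "('i, 'k::calg) fmat"
  assumes "finite S" "\<And>x z. z \<notin> S \<Longrightarrow> ent M x z = 0"
  shows "ent (M * N) x y = (\<Sum>z\<in>S. ent M x z * ent N z y)"
proof -
  have "ent (M * N) x y = (\<Sum>z\<in>S \<union> fsupp M. ent M x z * ent N z y)"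
    using assms(1) by (intro ent_mult) auto
  also have "\<dots> = (\<Sum>z\<in>S. ent M x z * ent N z y)"
    using assms by (intro sum.mono_neutral_right) auto
  finally show ?thesis .
qed

text \<open>Bases turn the module induced from the restriction of V into a matrix representation, to
  which the trace and determinant arguments apply.\<close>

locale based = loop_free_vertex Q i for Q :: "('v, 'a) pre_digraph" and i +
  fixes V :: "('v, 'a darrow, 'b) quiver_rep" and B :: "'v \<Rightarrow> ('b \<Rightarrow> complex) set"
  assumes V: "is_rep (double Q) V"
    and fin_B: "v \<in> verts Q \<Longrightarrow> finite (B v)"
    and B_sub: "v \<in> verts Q \<Longrightarrow> B v \<subseteq> space V v"
    and B_indep: "v \<in> verts Q \<Longrightarrow> cvec.independent (B v)"
    and B_span: "v \<in> verts Q \<Longrightarrow> cvec.span (B v) = space V v"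
begin

text \<open>At i the basis is that of the direct sum over the incoming arrows, not one of V itself.
  The vertex tags keep the index sets of different vertices disjoint, which makes the idempotents
  orthogonal.\<close>

definition Ix :: "'v \<Rightarrow> ('v \<times> ('b \<Rightarrow> complex) + 'a darrow \<times> ('b \<Rightarrow> complex)) set" where
  "Ix v = (if v = i then Inr ` (SIGMA c:C. B (tail (double Q) c)) else Inl ` ({v} \<times> B v))"

lemma fin_Ix: "v \<in> verts Q \<Longrightarrow> finite (Ix v)"
  using finite_C fin_B C_tail_in by (auto simp: Ix_def)

lemma Ix_disjoint: "p \<in> Ix u \<Longrightarrow> p \<in> Ix v \<Longrightarrow> u = v"
  by (auto simp: Ix_def split: if_splits)

lemma Ix_i: "p \<in> Ix i \<longleftrightarrow> (\<exists>c\<in>C. \<exists>\<beta>\<in>B (tail (double Q) c). p = Inr (c, \<beta>))"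
  and Ix_other: "v \<noteq> i \<Longrightarrow> p \<in> Ix v \<longleftrightarrow> (\<exists>\<beta>\<in>B v. p = Inl (v, \<beta>))"
  by (auto simp: Ix_def)

definition ee :: "'v \<Rightarrow> ('v \<times> ('b \<Rightarrow> complex) + 'a darrow \<times> ('b \<Rightarrow> complex), complex) fmat" where
  "ee v = funit (Ix v)"

definition ii where
  "ii c = fmatrix (Ix i) (Ix (tail (double Q) c)) (\<lambda>p q. if p = Inr (c, snd (projl q)) then 1 else 0)"

definition pp where
  "pp c = fmatrix (Ix (tail (double Q) c)) (Ix i) (\<lambda>p q. if q = Inr (c, snd (projl p)) then 1 else 0)"

lemma ent_ii: "c \<in> C \<Longrightarrow> ent (ii c) p q =
    (if p \<in> Ix i \<and> q \<in> Ix (tail (double Q) c) \<and> p = Inr (c, snd (projl q)) then 1 else 0)"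
  and ent_pp: "c \<in> C \<Longrightarrow> ent (pp c) p q =
    (if p \<in> Ix (tail (double Q) c) \<and> q \<in> Ix i \<and> q = Inr (c, snd (projl p)) then 1 else 0)"
  by (auto simp: ii_def pp_def ent_fmatrix fin_Ix i_in C_tail_in)

lemma Inr_in: "c \<in> C \<Longrightarrow> p \<in> Ix (tail (double Q) c) \<Longrightarrow> Inr (c, snd (projl p)) \<in> Ix i"
  using C_tail[of c] by (auto simp: Ix_i Ix_other)

sublocale M: ind_matrix Q i ee ii pp Ix
proof unfold_locales
  show "ee u * ee v = (if u = v then ee u else 0)" if "u \<in> verts Q" "v \<in> verts Q" for u v
    using that Ix_disjoint
    by (auto intro!: ent_eqI simp: ee_def ent_funit_mult ent_funit fin_Ix ent_zero)
  show "pp c * ii c' = (if c = c' then ee (tail (double Q) c) else 0)" if c: "c \<in> C" "c' \<in> C" for c c'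
  proof (rule ent_eqI)
    fix p q
    have "ent (pp c * ii c') p q = (\<Sum>z\<in>Ix i. ent (pp c) p z * ent (ii c') z q)"
      by (rule ent_mult_cols) (auto simp: fin_Ix i_in ent_pp c)
    also have "\<dots> = (\<Sum>z\<in>Ix i. if z = Inr (c, snd (projl p)) then (if p \<in> Ix (tail (double Q) c) \<and>
        q \<in> Ix (tail (double Q) c') \<and> c = c' \<and> snd (projl p) = snd (projl q) then 1 else 0) else 0)"
      by (rule sum.cong) (auto simp: ent_pp ent_ii c)
    also have "\<dots> = (if p \<in> Ix (tail (double Q) c) \<and>
        q \<in> Ix (tail (double Q) c') \<and> c = c' \<and> snd (projl p) = snd (projl q) then 1 else 0)"
      using Inr_in[OF c(1), of p] by (auto simp: fin_Ix i_in)
    also have "\<dots> = ent (if c = c' then ee (tail (double Q) c) else 0) p q"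
      using C_tail[OF c(1)] C_tail_in[OF c(1)]
      by (auto simp: ee_def ent_funit fin_Ix ent_zero Ix_other)
    finally show "ent (pp c * ii c') p q = ent (if c = c' then ee (tail (double Q) c) else 0) p q" .
  qed
  show "(\<Sum>c\<in>C. ii c * pp c) = ee i"
  proof (rule ent_eqI)
    fix p q
    have 1: "ent (ii c * pp c) p q = (\<Sum>z\<in>Ix (tail (double Q) c). if p = Inr (c, snd (projl z)) \<and> p = q \<and> p \<in> Ix i then 1 else 0)"
      if c: "c \<in> C" for c
      by (subst ent_mult_cols[of "Ix (tail (double Q) c)"])
        (auto simp: fin_Ix C_tail_in c ent_ii ent_pp intro!: sum.cong)
    show "ent (\<Sum>c\<in>C. ii c * pp c) p q = ent (ee i) p q"
    proof (cases "p \<in> Ix i \<and> p = q")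
      case False
      then have "ent (ii c * pp c) p q = 0" if "c \<in> C" for c
        unfolding 1[OF that] by (intro sum.neutral) auto
      then show ?thesis using False by (auto simp: ent_sum ee_def ent_funit fin_Ix i_in)
    next
      case True
      from iffD1[OF Ix_i conjunct1[OF True]]
      obtain d \<beta> where d: "d \<in> C" "\<beta> \<in> B (tail (double Q) d)" "p = Inr (d, \<beta>)" by blast
      have "ent (ii c * pp c) p q = (if c = d then 1 else 0)" if c: "c \<in> C" for c
      proof -
        have "ent (ii c * pp c) p q = (\<Sum>z\<in>Ix (tail (double Q) c). if z = Inl (tail (double Q) c, \<beta>) then (if c = d then 1 else 0) else 0)"
          unfolding 1[OF c]
        proof (rule sum.cong[OF refl])
          fix z assume "z \<in> Ix (tail (double Q) c)"
          then obtain \<gamma> where "z = Inl (tail (double Q) c, \<gamma>)" unfolding Ix_other[OF C_tail[OF c]] by (elim bexE)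
          moreover have "p = q" "p \<in> Ix i" by (rule conjunct2[OF True], rule conjunct1[OF True])
          ultimately show "(if p = Inr (c, snd (projl z)) \<and> p = q \<and> p \<in> Ix i then 1 else 0) =
              (if z = Inl (tail (double Q) c, \<beta>) then (if c = d then 1 else 0) else (0::complex))"
            by (simp only: d(3) simp_thms prod.inject sum.inject sum.sel snd_conv prod.sel) (simp add: eq_commute conj_commute)
        qed
        also have "\<dots> = (if Inl (tail (double Q) c, \<beta>) \<in> Ix (tail (double Q) c) then (if c = d then 1 else 0) else 0)"
          by (rule sum.delta'[OF fin_Ix[OF C_tail_in[OF c]], of "Inl (tail (double Q) c, \<beta>)" "\<lambda>_. if c = d then 1 else 0", unfolded eq_commute[of "Inl (tail (double Q) c, \<beta>)"]])
        also have "\<dots> = (if c = d then 1 else 0)"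
        proof (cases "c = d")
          case True
          have "Inl (tail (double Q) c, \<beta>) \<in> Ix (tail (double Q) c)"
            unfolding Ix_other[OF C_tail[OF c]] using refl d(2)[folded True] by (rule bexI)
          then show ?thesis by simp
        qed simp
        finally show ?thesis .
      qed
      then have "ent (\<Sum>c\<in>C. ii c * pp c) p q = (\<Sum>c\<in>C. if c = d then 1 else 0)"
        unfolding ent_sum by (rule sum.cong[OF refl])
      also have "\<dots> = ent (ee i) p q"
        using d(1) finite_C conjunct1[OF True] conjunct2[OF True]
        by (simp add: ee_def ent_funit fin_Ix i_in)
      finally show ?thesis .
    qed
  qed
qed (auto simp: ee_def ii_def pp_def fmatrix_corner fin_Ix i_in C_tail_in)

definition rp :: "'v \<Rightarrow> ('b \<Rightarrow> complex) \<Rightarrow> ('b \<Rightarrow> complex) \<Rightarrow> complex" where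
  "rp v = cvec.representation (B v)"

lemma rp_expand: "v \<in> verts Q \<Longrightarrow> x \<in> space V v \<Longrightarrow> x = (\<Sum>\<beta>\<in>B v. cscale (rp v x \<beta>) \<beta>)"
  using cvec.sum_representation_eq[OF B_indep _ fin_B subset_refl, of v x] B_span[of v] by (simp add: rp_def)

text \<open>The canonical morphism from the induced module to V, given on basis vectors. At i it
  need not be injective or surjective.\<close>

fun F :: "'v \<times> ('b \<Rightarrow> complex) + 'a darrow \<times> ('b \<Rightarrow> complex) \<Rightarrow> 'b \<Rightarrow> complex" where
  "F (Inl (v, \<beta>)) = \<beta>"
| "F (Inr (c, \<beta>)) = amap V c \<beta>"

text \<open>The arrows of the induced module. For an outgoing arrow the entries are coordinates of a
  product through i, which is all that the restriction away from i remembers of that arrow.\<close>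

definition X where
  "X a = (if head (double Q) a = i then ii a
    else fmatrix (Ix (head (double Q) a)) (Ix (tail (double Q) a))
      (\<lambda>p q. rp (head (double Q) a) (amap V a (F q)) (snd (projl p))))"

lemma arep_X: "arep (double Q) ee X"
  unfolding arep_def
proof (intro conjI ballI)
  fix u v assume "u \<in> verts (double Q)" "v \<in> verts (double Q)"
  then show "ee u * ee v = (if u = v then ee u else 0)" using M.e_orth by simp
next
  fix a assume a: "a \<in> arcs (double Q)"
  then have "head (double Q) a = i \<Longrightarrow> a \<in> C" by (simp add: in_arrows_def)
  then show "ee (head (double Q) a) * X a = X a" "X a * ee (tail (double Q) a) = X a"
    using M.inj_corner[of a] e_arc[OF a] by (auto simp: X_def ee_def fin_Ix fmatrix_corner)
qed

lemma X_C: "c \<in> C \<Longrightarrow> X c = ii c"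
  by (simp add: X_def C_head)

lemma arep_shift: "arep (double Q) ee (\<lambda>a. X a + csc k (M.\<delta> a))"
proof (rule arep_change[OF arep_X])
  show "corner (double Q) ee (\<lambda>a. X a + csc k (M.\<delta> a))"
    using arep_corner[OF arep_X] M.corner_\<delta>
    by (auto simp: corner_def distrib_left distrib_right csc_mult_left csc_mult_right)
qed

text \<open>The analogous morphism with target W: the basis still comes from V and is carried over
  by \<psi>.\<close>

fun F_ext :: "('v, 'a darrow, 'c) quiver_rep \<Rightarrow> ('v \<Rightarrow> ('b \<Rightarrow> complex) \<Rightarrow> 'c \<Rightarrow> complex) \<Rightarrow>
    'v \<times> ('b \<Rightarrow> complex) + 'a darrow \<times> ('b \<Rightarrow> complex) \<Rightarrow> 'c \<Rightarrow> complex" where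
  "F_ext W \<psi> (Inl (v, \<beta>)) = \<psi> v \<beta>"
| "F_ext W \<psi> (Inr (c, \<beta>)) = amap W c (\<psi> (tail (double Q) c) \<beta>)"

context
  fixes W :: "('v, 'a darrow, 'c) quiver_rep" and \<psi> and k :: complex
  assumes W: "is_rep (double Q) W" and e: "ext_iso \<psi> V W k"
begin

abbreviation "F' \<equiv> F_ext W \<psi>"

lemma sum_Ix_other: "v \<in> verts Q \<Longrightarrow> v \<noteq> i \<Longrightarrow> (\<Sum>p\<in>Ix v. g p) = (\<Sum>\<beta>\<in>B v. g (Inl (v, \<beta>)))"
proof -
  assume "v \<noteq> i"
  then have "Ix v = (\<lambda>\<beta>. Inl (v, \<beta>)) ` B v" by (auto simp: Ix_other)
  then show ?thesis by (simp add: sum.reindex inj_on_def)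
qed

lemma psi_expand:
  assumes "v \<in> verts Q" "v \<noteq> i" "x \<in> space V v"
  shows "\<psi> v x = (\<Sum>p\<in>Ix v. cscale (rp v x (snd (projl p))) (F' p))"
proof -
  note l = ext_isoD(1)[OF e assms(1,2)] and s = subsp[OF V assms(1)]
  have "\<psi> v x = \<psi> v (\<Sum>\<beta>\<in>B v. cscale (rp v x \<beta>) \<beta>)"
    using rp_expand[OF assms(1,3)] by simp
  also have "\<dots> = (\<Sum>\<beta>\<in>B v. \<psi> v (cscale (rp v x \<beta>) \<beta>))"
    using B_sub[OF assms(1)] by (intro lin_sum[OF l s] cvec.subspace_scale[OF s]) auto
  also have "\<dots> = (\<Sum>\<beta>\<in>B v. cscale (rp v x \<beta>) (\<psi> v \<beta>))"
    using B_sub[OF assms(1)] by (intro sum.cong refl lin_scale[OF l s]) auto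
  finally show ?thesis
    by (simp add: sum_Ix_other assms)
qed

lemma F'_in: "q \<in> Ix v \<Longrightarrow> v \<in> verts Q \<Longrightarrow> F' q \<in> space W v"
proof (cases "v = i")
  case True
  assume "q \<in> Ix v"
  then obtain c \<beta> where c: "c \<in> C" "\<beta> \<in> B (tail (double Q) c)" "q = Inr (c, \<beta>)" using True by (auto simp: Ix_i)
  then have "\<psi> (tail (double Q) c) \<beta> \<in> space W (tail (double Q) c)"
    using lin_in[OF ext_isoD(1)[OF e C_tail_in[OF c(1)] C_tail[OF c(1)]] subsp[OF V C_tail_in[OF c(1)]]]
      B_sub[OF C_tail_in[OF c(1)]] by auto
  then show ?thesis using C_in[OF W c(1)] c True by simp
next
  case False
  assume "q \<in> Ix v" "v \<in> verts Q"
  then obtain \<beta> where "\<beta> \<in> space V v" "q = Inl (v, \<beta>)" using False B_sub[of v] by (auto simp: Ix_other)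
  then show ?thesis
    using lin_in[OF ext_isoD(1)[OF e \<open>v \<in> verts Q\<close> False] subsp[OF V \<open>v \<in> verts Q\<close>]] by simp
qed

text \<open>The shift by k between V and W is exactly what k \<delta> adds to the arrows. So one
  induced module, translated along \<delta>, maps to W; with W = V, the identity for \<psi> and k =
  0 it maps to V.\<close>

lemma arrow_expand:
  assumes a: "a \<in> arcs (double Q)" and q: "q \<in> Ix (tail (double Q) a)"
  shows "amap W a (F' q) = (\<Sum>p\<in>Ix (head (double Q) a). cscale (ent (X a + csc k (M.\<delta> a)) p q) (F' p))"
proof (cases "head (double Q) a = i")
  case True
  then have c: "a \<in> C" using a by (simp add: in_arrows_def)
  obtain \<beta> where b: "\<beta> \<in> B (tail (double Q) a)" "q = Inl (tail (double Q) a, \<beta>)"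
    using q C_tail[OF c] by (auto simp: Ix_other)
  have "(\<Sum>p\<in>Ix i. cscale (ent (X a + csc k (M.\<delta> a)) p q) (F' p)) =
      (\<Sum>p\<in>Ix i. if p = Inr (a, \<beta>) then F' p else 0)"
    using q b C_tail[OF c] by (intro sum.cong) (auto simp: X_C[OF c] M.\<delta>_def ent_ii[OF c])
  also have "\<dots> = F' (Inr (a, \<beta>))"
    using Inr_in[OF c q] b by (simp add: fin_Ix i_in)
  finally show ?thesis using b True by simp
next
  case h: False
  let ?h = "head (double Q) a" and ?t = "tail (double Q) a"
  have hv: "?h \<in> verts Q" and tv: "?t \<in> verts Q" using e_arc[OF a] by auto
  have entX: "ent (X a) p q = rp ?h (amap V a (F q)) (snd (projl p))" if "p \<in> Ix ?h" for p
    using that q h hv tv by (simp add: X_def ent_fmatrix fin_Ix)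
  show ?thesis
  proof (cases "?t = i")
    case False
    obtain \<beta> where b: "\<beta> \<in> B ?t" "q = Inl (?t, \<beta>)" using q False by (auto simp: Ix_other)
    then have bV: "\<beta> \<in> space V ?t" using B_sub[OF tv] by auto
    have "amap W a (F' q) = \<psi> ?h (amap V a \<beta>)"
      using ext_isoD(3)[OF e a False h bV] b by simp
    also have "\<dots> = (\<Sum>p\<in>Ix ?h. cscale (rp ?h (amap V a \<beta>) (snd (projl p))) (F' p))"
      by (rule psi_expand[OF hv h arrow_in[OF V a bV]])
    finally show ?thesis
      using b False by (simp add: entX[unfolded b(2)] M.\<delta>_def)
  next
    case True
    have sc: "star a \<in> C" by (rule star_in_C[OF a True])
    obtain c \<beta> where c: "c \<in> C" and b: "\<beta> \<in> B (tail (double Q) c)" "q = Inr (c, \<beta>)"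
      using q True by (auto simp: Ix_i)
    note cv = C_tail_in[OF c]
    have bV: "\<beta> \<in> space V (tail (double Q) c)" using B_sub[OF cv] b(1) by auto
    note l = ext_isoD(1)[OF e hv h] and s = subsp[OF V hv]
    have VV: "amap V a (amap V c \<beta>) \<in> space V ?h" using out_in[OF V a True C_in[OF V c bV]] .
    have "amap W a (F' q) = \<psi> ?h (amap V a (amap V c \<beta>) + (if star a = c then cscale (k * arrow_sign a) \<beta> else 0))"
      using ext_isoD(4)[OF e a True c bV] b by simp
    also have "\<dots> = \<psi> ?h (amap V a (amap V c \<beta>)) + (if star a = c then cscale (k * arrow_sign a) (\<psi> ?h \<beta>) else 0)"
    proof (cases "star a = c")
      case True
      then have "\<beta> \<in> space V ?h" using bV by auto
      then show ?thesis
        using True lin_add[OF l s VV cvec.subspace_scale[OF s]] lin_scale[OF l s] by simp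
    qed simp
    also have "(if star a = c then cscale (k * arrow_sign a) (\<psi> ?h \<beta>) else 0) =
        (\<Sum>p\<in>Ix ?h. cscale (ent (csc k (M.\<delta> a)) p q) (F' p))"
    proof -
      have "(\<Sum>p\<in>Ix ?h. cscale (ent (csc k (M.\<delta> a)) p q) (F' p)) =
          (\<Sum>p\<in>Ix ?h. if p = Inl (?h, \<beta>) then (if star a = c then cscale (k * arrow_sign a) (\<psi> ?h \<beta>) else 0) else 0)"
        using True q b h
        by (intro sum.cong)
          (auto simp: M.\<delta>_def ent_csc csc_complex_def ent_pp[OF sc] Ix_other)
      also have "\<dots> = (if star a = c then cscale (k * arrow_sign a) (\<psi> ?h \<beta>) else 0)"
        using b h by (auto simp: fin_Ix hv Ix_other)
      finally show ?thesis by simp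
    qed
    also have "\<psi> ?h (amap V a (amap V c \<beta>)) = (\<Sum>p\<in>Ix ?h. cscale (ent (X a) p q) (F' p))"
      using psi_expand[OF hv h VV] by (simp add: entX[unfolded b(2)] b(2))
    finally show ?thesis
      by (simp add: ent_add cscale_add_left sum.distrib)
  qed
qed

lemma path_expand:
  assumes p: "p \<in> paths (double Q)" and q: "q \<in> Ix v" and v: "v \<in> verts Q"
  shows "fold (amap W) (snd p) (point_fam v (F' q) (fst p)) =
    (\<Sum>r\<in>Ix (path_end (double Q) p). cscale (ent (path_ev ee (\<lambda>a. X a + csc k (M.\<delta> a)) p) r q) (F' r))"
  using p
proof (induction rule: D.path_induct)
  case (Nil u)
  then have u: "u \<in> verts Q" by simp
  have "(\<Sum>r\<in>Ix u. cscale (ent (ee u) r q) (F' r)) = (\<Sum>r\<in>Ix u. if r = q then F' q else 0)"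
    by (rule sum.cong) (auto simp: ee_def ent_funit fin_Ix u)
  also have "\<dots> = point_fam v (F' q) u"
  proof (cases "u = v")
    case True
    then show ?thesis using q by (simp add: fin_Ix v point_fam_def)
  next
    case False
    then have "q \<notin> Ix u" using Ix_disjoint[OF q] by metis
    then show ?thesis using False by (simp add: fin_Ix u point_fam_def)
  qed
  finally show ?case by simp
next
  case (snoc u p a)
  let ?Y = "\<lambda>a. X a + csc k (M.\<delta> a)" and ?t = "tail (double Q) a" and ?h = "head (double Q) a"
  have hv: "?h \<in> verts Q" and tv: "?t \<in> verts Q" using e_arc[OF snoc(2)] by auto
  note l = D.rep_arrow[OF W snoc(2)] and s = subsp[OF W tv]
  let ?P = "path_ev ee ?Y (u, p)"
  have cols: "ent (?Y a) x z = 0" if "z \<notin> Ix ?t" for x z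
  proof -
    have "ent (?Y a * ee ?t) x z = 0" using that by (simp add: ee_def ent_mult_funit fin_Ix tv)
    then show ?thesis using D.arep_tail[OF arep_shift snoc(2), of k] by simp
  qed
  have mult: "ent (?Y a * ?P) x y = (\<Sum>z\<in>Ix ?t. ent (?Y a) x z * ent ?P z y)" for x y
    by (rule ent_mult_cols[OF fin_Ix[OF tv]]) (rule cols)
  have "amap W a (\<Sum>r\<in>Ix ?t. cscale (ent ?P r q) (F' r)) = (\<Sum>r\<in>Ix ?t. amap W a (cscale (ent ?P r q) (F' r)))"
    by (rule lin_sum[OF l s]) (intro cvec.subspace_scale[OF s] F'_in tv)
  also have "\<dots> = (\<Sum>r\<in>Ix ?t. cscale (ent ?P r q) (\<Sum>r'\<in>Ix ?h. cscale (ent (?Y a) r' r) (F' r')))"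
    by (intro sum.cong refl) (simp only: lin_scale[OF l s F'_in[OF _ tv]] arrow_expand[OF snoc(2)])
  also have "\<dots> = (\<Sum>r'\<in>Ix ?h. \<Sum>r\<in>Ix ?t. cscale (ent (?Y a) r' r * ent ?P r q) (F' r'))"
    unfolding cscale_sum_right by (subst sum.swap) (simp only: cscale_simps(4) mult.commute)
  also have "\<dots> = (\<Sum>r'\<in>Ix ?h. cscale (ent (?Y a * ?P) r' q) (F' r'))"
    by (simp only: mult cscale_sum_left)
  finally show ?case
    using snoc by (simp add: path_ev_snoc)
qed

text \<open>Morphisms respect the whole path algebra, so even an element that is not known
  explicitly, such as the image of an arrow under \<rho>, acts on W through its evaluation on the
  induced module.\<close>

lemma act_expand:
  assumes x: "x \<in> A" and q: "q \<in> Ix v" and v: "v \<in> verts Q" and h: "h \<in> verts Q"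
  shows "rep_act (double Q) W x (point_fam v (F' q)) h =
    (\<Sum>r\<in>Ix h. cscale (ent (ev ee (\<lambda>a. X a + csc k (M.\<delta> a)) x) r q) (F' r))"
  using x
proof (induction rule: D.carrier_induct)
  case (single p c)
  let ?Y = "\<lambda>a. X a + csc k (M.\<delta> a)"
  have pv: "path_end (double Q) p \<in> verts Q" using D.path_end_in_verts[OF single] by simp
  have rows: "ent (path_ev ee ?Y p) r q = 0" if "r \<notin> Ix (path_end (double Q) p)" for r
  proof -
    have "ent (ee (path_end (double Q) p) * path_ev ee ?Y p) r q = 0"
      using that by (simp add: ee_def ent_funit_mult fin_Ix pv)
    then show ?thesis using D.path_ev_end[OF arep_shift single, of k] by simp
  qed
  show ?case
  proof (cases "path_end (double Q) p = h")
    case True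
    then show ?thesis
      by (simp add: rep_act_single path_expand[OF single q v] ev_single ent_csc csc_complex_def cscale_sum_right)
  next
    case False
    then have "ent (path_ev ee ?Y p) r q = 0" if "r \<in> Ix h" for r
      using rows that Ix_disjoint by blast
    then show ?thesis
      using False by (simp add: rep_act_single ev_single ent_csc csc_complex_def)
  qed
qed (simp_all add: rep_act_add ev_add ent_add cscale_add_left sum.distrib ent_zero)

end

end

section \<open>Twisting preserves the shift\<close>

context loop_free_vertex
begin

lemma ext_iso_refl: "is_rep (double Q) V \<Longrightarrow> ext_iso (\<lambda>_ x. x) V V 0"
  unfolding ext_iso_def by (auto simp: linear_between_def bij_betw_def inj_on_def)

text \<open>Reading the composite as the action of a single element avoids expanding the
  intermediate vector at i in coordinates.\<close>

lemma amap_tw_tw: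
  assumes U: "is_rep (double Q) U" and \<rho>: "D.path_endo \<rho>"
    and b: "b \<in> arcs (double Q)" "tail (double Q) b = i" and c: "c \<in> C" and x: "x \<in> space U (tail (double Q) c)"
  shows "amap (tw (double Q) \<rho> U) b (amap (tw (double Q) \<rho> U) c x) =
    rep_act (double Q) U (\<rho> (pa_mult (double Q) (arr b) (arr c))) (point_fam (tail (double Q) c) x) (head (double Q) b)"
proof -
  let ?T = "tw (double Q) \<rho> U"
  note T = D.is_rep_tw[OF \<rho> finite_verts_double U]
  note cA = D.arrow_in_carrier[OF C_arc[OF c]] and bA = D.arrow_in_carrier[OF b(1)]
  have f: "fam (double Q) U (point_fam (tail (double Q) c) x)"
    using D.fam_point[OF U] C_tail_in[OF c] x by simp
  then have f': "fam (double Q) ?T (point_fam (tail (double Q) c) x)" by (simp add: fam_def)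
  have "rep_act (double Q) U (\<rho> (pa_mult (double Q) (arr b) (arr c))) (point_fam (tail (double Q) c) x) (head (double Q) b) =
      rep_act (double Q) ?T (pa_mult (double Q) (arr b) (arr c)) (point_fam (tail (double Q) c) x) (head (double Q) b)"
    using D.rep_act_tw[OF \<rho> finite_verts_double U D.pa_mult_in_carrier[OF bA cA] f] e_arc[OF b(1)] by simp
  also have "\<dots> = amap ?T b (amap ?T c x)"
    unfolding D.rep_act_mult[OF T bA cA f'] using b(2) C_head[OF c] by (simp add: D.rep_act_arrow)
  finally show ?thesis ..
qed

text \<open>V and W receive morphisms from the same induced module at the parameters 0 and k.
  \<open>twist_shift\<close> compares the twisted arrows at these two parameters, and the comparison
  descends to V and W through \<open>act_expand\<close>, basis vector by basis vector.\<close>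

theorem ext_iso_tw:
  assumes V: "is_rep (double Q) V" and W: "is_rep (double Q) W" and e: "ext_iso \<psi> V W k"
    and \<rho>: "D.path_endo \<rho>" "\<rho> (omega_elt Q) = omega_elt Q" and \<sigma>: "D.path_endo \<sigma>"
    and inv: "\<And>x. x \<in> A \<Longrightarrow> \<sigma> (\<rho> x) = x" "\<And>x. x \<in> A \<Longrightarrow> \<rho> (\<sigma> x) = x"
  shows "ext_iso \<psi> (tw (double Q) \<rho> V) (tw (double Q) \<rho> W) k"
proof -
  have "\<forall>v\<in>verts Q. \<exists>B. finite B \<and> B \<subseteq> space V v \<and> cvec.independent B \<and> cvec.span B = space V v"
    using V fin_dim_basis unfolding is_rep_def double_simps(1) by metis
  from bchoice[OF this] obtain B where B: "\<forall>v\<in>verts Q. finite (B v) \<and> B v \<subseteq> space V v \<and>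
      cvec.independent (B v) \<and> cvec.span (B v) = space V v" ..
  interpret based Q i V B
    by unfold_locales (use V B in auto)
  let ?tV = "tw (double Q) \<rho> V" and ?tW = "tw (double Q) \<rho> W"
  note tV = D.is_rep_tw[OF \<rho>(1) finite_verts_double V] and tW = D.is_rep_tw[OF \<rho>(1) finite_verts_double W]
  note e0 = ext_iso_refl[OF V]
  note ts = M.twist_shift[OF arep_X X_C \<rho> \<sigma> inv]
  let ?F = "F_ext V (\<lambda>_ x. x)" and ?F' = "F_ext W \<psi>"
  let ?G = "\<lambda>t a. ev ee (\<lambda>a. X a + csc t (M.\<delta> a)) (\<rho> (arr a))"
  have F_psi: "\<psi> h (?F p) = ?F' p" "?F p \<in> space V h" if "h \<in> verts Q" "h \<noteq> i" "p \<in> Ix h" for h p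
    using that B_sub[OF that(1)] by (auto simp: Ix_other)
  have psi_sum: "\<psi> h (\<Sum>p\<in>Ix h. cscale (g p) (?F p)) = (\<Sum>p\<in>Ix h. cscale (g p) (?F' p))"
    if h: "h \<in> verts Q" "h \<noteq> i" for h g
  proof -
    note l = ext_isoD(1)[OF e h] and s = subsp[OF V h(1)]
    have "\<psi> h (\<Sum>p\<in>Ix h. cscale (g p) (?F p)) = (\<Sum>p\<in>Ix h. \<psi> h (cscale (g p) (?F p)))"
      by (rule lin_sum[OF l s]) (intro cvec.subspace_scale[OF s] F_psi h)
    also have "\<dots> = (\<Sum>p\<in>Ix h. cscale (g p) (?F' p))"
      by (intro sum.cong refl) (simp only: lin_scale[OF l s F_psi(2)[OF h]] F_psi(1)[OF h])
    finally show ?thesis .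
  qed
  have F_Inl: "?F (Inl (v, \<beta>)) = \<beta>" "?F' (Inl (v, \<beta>)) = \<psi> v \<beta>" for v \<beta>
    by simp_all
  show ?thesis
    unfolding ext_iso_def
  proof (intro conjI ballI impI)
    fix v assume "v \<in> verts Q - {i}"
    then show "linear_between (space ?tV v) (space ?tW v) (\<psi> v)" "bij_betw (\<psi> v) (space ?tV v) (space ?tW v)"
      using ext_isoD(1,2)[OF e] by simp_all
  next
    fix a x assume a: "a \<in> arcs (double Q)" "tail (double Q) a \<noteq> i \<and> head (double Q) a \<noteq> i"
      and x: "x \<in> space ?tV (tail (double Q) a)"
    let ?h = "head (double Q) a" and ?t = "tail (double Q) a"
    have h: "?h \<in> verts Q" "?h \<noteq> i" and t: "?t \<in> verts Q" "?t \<noteq> i" using e_arc[OF a(1)] a(2) by auto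
    note ra = D.endo_carrier[OF \<rho>(1) finite_verts_double D.arrow_in_carrier[OF a(1)]]
    have "(\<psi> ?h \<circ> amap ?tV a) x = (amap ?tW a \<circ> \<psi> ?t) x"
    proof (rule lin_span_eq[OF _ subsp[OF V t(1)] _ B_span[OF t(1)]])
      show "linear_between (space V ?t) (space W ?h) (\<psi> ?h \<circ> amap ?tV a)"
        using linear_between_comp[OF D.rep_arrow[OF tV a(1)]] ext_isoD(1)[OF e h] by simp
      show "linear_between (space V ?t) (space W ?h) (amap ?tW a \<circ> \<psi> ?t)"
        using linear_between_comp[OF ext_isoD(1)[OF e t]] D.rep_arrow[OF tW a(1)] by simp
      show "x \<in> space V ?t" using x by simp
      fix \<beta> assume "\<beta> \<in> B ?t"
      then have q: "Inl (?t, \<beta>) \<in> Ix ?t" using t by (simp add: Ix_other)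
      have "amap ?tV a \<beta> = (\<Sum>r\<in>Ix ?h. cscale (ent (?G 0 a) r (Inl (?t, \<beta>))) (?F r))"
        using act_expand[OF V e0 ra q t(1) h(1)] by (simp add: tw_def F_Inl)
      then have "\<psi> ?h (amap ?tV a \<beta>) = (\<Sum>r\<in>Ix ?h. cscale (ent (?G 0 a) r (Inl (?t, \<beta>))) (?F' r))"
        by (simp only: psi_sum[OF h])
      \<comment> \<open>Even after twisting, an arrow that starts away from i does not change along
        the flow.\<close>
      also have "?G 0 a = ?G k a" using ts(1)[OF _ _ _ a(1) t(2), of k] by simp
      also have "(\<Sum>r\<in>Ix ?h. cscale (ent (?G k a) r (Inl (?t, \<beta>))) (?F' r)) = amap ?tW a (\<psi> ?t \<beta>)"
        using act_expand[OF W e ra q t(1) h(1)] by (simp add: tw_def F_Inl)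
      finally show "(\<psi> ?h \<circ> amap ?tV a) \<beta> = (amap ?tW a \<circ> \<psi> ?t) \<beta>" by simp
    qed
    then show "\<psi> ?h (amap ?tV a x) = amap ?tW a (\<psi> ?t x)" by simp
  next
    fix b c x assume b: "b \<in> arcs (double Q)" "tail (double Q) b = i" and c: "c \<in> C"
      and x: "x \<in> space ?tV (tail (double Q) c)"
    let ?h = "head (double Q) b" and ?t = "tail (double Q) c"
    have h: "?h \<in> verts Q" "?h \<noteq> i" using e_arc[OF b(1)] tail_i_head[OF b] by auto
    have t: "?t \<in> verts Q" "?t \<noteq> i" using C_tail_in[OF c] C_tail[OF c] by auto
    note bA = D.arrow_in_carrier[OF b(1)] and cA = D.arrow_in_carrier[OF C_arc[OF c]]
    let ?bc = "pa_mult (double Q) (arr b) (arr c)"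
    note bcA = D.endo_carrier[OF \<rho>(1) finite_verts_double D.pa_mult_in_carrier[OF bA cA]]
    have evbc: "ev ee (\<lambda>a. X a + csc l (M.\<delta> a)) (\<rho> ?bc) = ?G l b * ?G l c" for l
      using D.ev_mult[OF arep_shift D.endo_carrier[OF \<rho>(1) finite_verts_double bA] D.endo_carrier[OF \<rho>(1) finite_verts_double cA]]
      by (simp add: D.endo_mult[OF \<rho>(1) finite_verts_double bA cA])
    let ?d = "\<lambda>x. if star b = c then cscale (k * arrow_sign b) x else 0"
    have htc: "star b = c \<Longrightarrow> ?t = ?h" by auto
    have lin_d: "linear_between (space V ?t) (space V ?h) ?d"
    proof (cases "star b = c")
      case True
      then show ?thesis
        using htc cvec.subspace_scale[OF subsp[OF V h(1)]] by (auto simp: linear_between_def cscale_add_right mult.commute)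
    qed (use cvec.subspace_0[OF subsp[OF V h(1)]] in \<open>auto simp: linear_between_def\<close>)
    have lV: "linear_between (space V ?t) (space V ?h) (amap ?tV b \<circ> amap ?tV c)"
      using linear_between_comp[OF D.rep_arrow[OF tV C_arc[OF c]]] D.rep_arrow[OF tV b(1)] b(2) C_head[OF c] by simp
    have "(amap ?tW b \<circ> amap ?tW c \<circ> \<psi> ?t) x = (\<psi> ?h \<circ> (\<lambda>x. (amap ?tV b \<circ> amap ?tV c) x + ?d x)) x"
    proof (rule lin_span_eq[OF _ subsp[OF V t(1)] _ B_span[OF t(1)]])
      show "linear_between (space V ?t) (space W ?h) (amap ?tW b \<circ> amap ?tW c \<circ> \<psi> ?t)"
        using linear_between_comp[OF ext_isoD(1)[OF e t] linear_between_comp[OF D.rep_arrow[OF tW C_arc[OF c], simplified]]]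
          D.rep_arrow[OF tW b(1)] b(2) C_head[OF c] by (simp add: comp_assoc)
      have "linear_between (space V ?t) (space V ?h) (\<lambda>x. (amap ?tV b \<circ> amap ?tV c) x + ?d x)"
        using lV lin_d cvec.subspace_add[OF subsp[OF V h(1)]] unfolding linear_between_def
        by (auto simp: cscale_add_right Pi_iff)
      then show "linear_between (space V ?t) (space W ?h) (\<psi> ?h \<circ> (\<lambda>x. (amap ?tV b \<circ> amap ?tV c) x + ?d x))"
        by (rule linear_between_comp[OF _ ext_isoD(1)[OF e h]])
      show "x \<in> space V ?t" using x by simp
      fix \<beta> assume \<beta>: "\<beta> \<in> B ?t"
      then have bV: "\<beta> \<in> space V ?t" using B_sub[OF t(1)] by auto
      have bW: "\<psi> ?t \<beta> \<in> space W ?t" using lin_in[OF ext_isoD(1)[OF e t] subsp[OF V t(1)] bV] .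
      let ?q = "Inl (?t, \<beta>)"
      have q: "?q \<in> Ix ?t" using t \<beta> by (simp add: Ix_other)
      have 1: "amap ?tV b (amap ?tV c \<beta>) = (\<Sum>r\<in>Ix ?h. cscale (ent (?G 0 b * ?G 0 c) r ?q) (?F r))"
        unfolding evbc[symmetric] using act_expand[OF V e0 bcA q t(1) h(1)] amap_tw_tw[OF V \<rho>(1) b c bV] by (simp add: F_Inl)
      have 2: "amap ?tW b (amap ?tW c (\<psi> ?t \<beta>)) = (\<Sum>r\<in>Ix ?h. cscale (ent (?G k b * ?G k c) r ?q) (?F' r))"
        unfolding evbc[symmetric] using act_expand[OF W e bcA q t(1) h(1)] amap_tw_tw[OF W \<rho>(1) b c bW] by (simp add: F_Inl)
      \<comment> \<open>The shift is brought into the same expansion, where the idempotent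
        contributes the single basis vector \<beta>.\<close>
      have 3: "?d \<beta> = (\<Sum>r\<in>Ix ?h. cscale (ent (csc k (csc (arrow_sign b) (if star b = c then ee ?t else 0))) r ?q) (?F r))"
      proof (cases "star b = c")
        case True
        have "(\<Sum>r\<in>Ix ?h. cscale (ent (csc k (csc (arrow_sign b) (ee ?t))) r ?q) (?F r)) =
            (\<Sum>r\<in>Ix ?h. if r = ?q then cscale (k * arrow_sign b) \<beta> else 0)"
          using True htc by (intro sum.cong) (auto simp: ent_csc csc_complex_def ee_def ent_funit fin_Ix t h F_Inl)
        also have "\<dots> = cscale (k * arrow_sign b) \<beta>"
          using q htc[OF True] by (simp add: fin_Ix h)
        finally show ?thesis using True by simp
      qed (simp add: ent_zero)
      have "ent (?G k b * ?G k c) r ?q = ent (?G 0 b * ?G 0 c) r ?q +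
          ent (csc k (csc (arrow_sign b) (if star b = c then ee ?t else 0))) r ?q" for r
        using arg_cong[OF ts(2)[OF _ _ _ b c, of k], of "\<lambda>M. ent M r ?q"] by (simp add: ent_add)
      then have "amap ?tW b (amap ?tW c (\<psi> ?t \<beta>)) =
          \<psi> ?h (\<Sum>r\<in>Ix ?h. cscale (ent (?G 0 b * ?G 0 c) r ?q + ent (csc k (csc (arrow_sign b) (if star b = c then ee ?t else 0))) r ?q) (?F r))"
        unfolding psi_sum[OF h] 2 by (simp only:)
      then show "(amap ?tW b \<circ> amap ?tW c \<circ> \<psi> ?t) \<beta> = (\<psi> ?h \<circ> (\<lambda>x. (amap ?tV b \<circ> amap ?tV c) x + ?d x)) \<beta>"
        unfolding o_apply 1 3 cscale_add_left sum.distrib .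
    qed
    then show "amap ?tW b (amap ?tW c (\<psi> ?t x)) = \<psi> ?h (amap ?tV b (amap ?tV c x) + ?d x)" by simp
  qed
qed

end

section \<open>Points of the quiver varieties\<close>

context fin_digraph
begin

lemma iso_class_eq:
  assumes "is_rep (double G) V" "is_rep (double G) W" "rep_iso (double G) V W"
  shows "iso_class G V = iso_class G W"
proof -
  interpret D: wf_digraph "double G" by (rule wf_double)
  show ?thesis
    unfolding iso_class_def
    using D.rep_iso_trans[OF assms(3)] D.rep_iso_trans[OF D.rep_iso_sym[OF assms(1,3)]] by blast
qed

lemma iso_class_std:
  assumes "is_rep (double G) V"
  obtains W :: "('a, 'b) std_rep" where "is_rep (double G) W" "rep_iso (double G) V W" "iso_class G V = iso_class G W"
proof -
  interpret D: wf_digraph "double G" by (rule wf_double)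
  show ?thesis
    using D.std_rep_exists[OF assms] iso_class_eq[OF assms] that by blast
qed

lemma preprojective_iso:
  assumes V: "is_preprojective_module G \<tau> V" and W: "is_rep (double G) W" and iso: "rep_iso (double G) V W"
  shows "is_preprojective_module G \<tau> W"
proof -
  interpret D: wf_digraph "double G" by (rule wf_double)
  have rV: "is_rep (double G) V" and mV: "\<And>v. v \<in> verts G \<Longrightarrow> moment G \<tau> V v"
    using V by (auto simp: preprojective_iff)
  obtain f where f: "\<And>v. v \<in> verts G \<Longrightarrow> linear_between (space V v) (space W v) (f v)"
      "\<And>v. v \<in> verts G \<Longrightarrow> bij_betw (f v) (space V v) (space W v)"
      "\<And>a x. a \<in> arcs (double G) \<Longrightarrow> x \<in> space V (tail (double G) a) \<Longrightarrow>
        f (head (double G) a) (amap V a x) = amap W a (f (tail (double G) a) x)"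
    using iso unfolding rep_iso_def by auto
  have "moment G \<tau> W v" if v: "v \<in> verts G" for v
    unfolding moment_def
  proof
    fix y assume "y \<in> space W v"
    then obtain x where x: "x \<in> space V v" "y = f v x"
      using f(2)[OF v] by (auto simp: bij_betw_def)
    have s: "cvec.subspace (space V v)" using D.rep_subspace[OF rV] v by simp
    have 1: "amap V a (amap V (star a) x) \<in> space V v"
      "amap W a (amap W (star a) y) = f v (amap V a (amap V (star a) x))" if a: "a \<in> in_arrows G v" for a
    proof -
      have a': "a \<in> arcs (double G)" "head (double G) a = v" using a by (auto simp: in_arrows_def)
      have t: "tail (double G) a \<in> verts (double G)" by (rule D.tail_in_verts[OF a'(1)])
      have i: "amap V (star a) x \<in> space V (tail (double G) a)"
        using lin_in[OF D.rep_arrow[OF rV, of "star a"]] D.rep_subspace[OF rV] a' x v by simp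
      then show "amap V a (amap V (star a) x) \<in> space V v"
        using lin_in[OF D.rep_arrow[OF rV a'(1)] D.rep_subspace[OF rV t]] a' by simp
      show "amap W a (amap W (star a) y) = f v (amap V a (amap V (star a) x))"
        using f(3)[of "star a" x] f(3)[OF a'(1) i] a' x by simp
    qed
    have "(\<Sum>a\<in>in_arrows G v. cscale (arrow_sign a) (amap W a (amap W (star a) y))) =
        (\<Sum>a\<in>in_arrows G v. f v (cscale (arrow_sign a) (amap V a (amap V (star a) x))))"
      by (intro sum.cong) (simp_all add: 1 lin_scale[OF f(1)[OF v] s])
    also have "\<dots> = f v (\<Sum>a\<in>in_arrows G v. cscale (arrow_sign a) (amap V a (amap V (star a) x)))"
      by (rule lin_sum[OF f(1)[OF v] s, symmetric]) (intro cvec.subspace_scale[OF s] 1)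
    also have "\<dots> = cscale (\<tau> v) y"
      using mV[OF v] x by (simp add: moment_def lin_scale[OF f(1)[OF v] s])
    finally show "(\<Sum>a\<in>in_arrows G v. cscale (arrow_sign a) (amap W a (amap W (star a) y))) = cscale (\<tau> v) y" .
  qed
  then show ?thesis using W by (simp add: preprojective_iff)
qed

lemma rep_iso_tw:
  assumes V: "is_rep (double G) V" and W: "is_rep (double G) W" and iso: "rep_iso (double G) V W"
    and \<rho>: "wf_digraph.path_endo (double G) \<rho>"
  shows "rep_iso (double G) (tw (double G) \<rho> V) (tw (double G) \<rho> W)"
proof -
  interpret D: wf_digraph "double G" by (rule wf_double)
  have fin: "finite (verts (double G))" by simp
  obtain f where f: "\<And>v. v \<in> verts (double G) \<Longrightarrow> linear_between (space V v) (space W v) (f v)"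
      "\<And>v. v \<in> verts (double G) \<Longrightarrow> bij_betw (f v) (space V v) (space W v)"
      "\<And>a x. a \<in> arcs (double G) \<Longrightarrow> x \<in> space V (tail (double G) a) \<Longrightarrow>
        f (head (double G) a) (amap V a x) = amap W a (f (tail (double G) a) x)"
    using iso unfolding rep_iso_def by blast
  have "f (head (double G) a) (amap (tw (double G) \<rho> V) a x) = amap (tw (double G) \<rho> W) a (f (tail (double G) a) x)"
    if a: "a \<in> arcs (double G)" and x: "x \<in> space V (tail (double G) a)" for a x
  proof -
    let ?t = "tail (double G) a" and ?h = "head (double G) a"
    have t: "?t \<in> verts (double G)" and h: "?h \<in> verts (double G)"
      by (rule D.tail_in_verts[OF a], rule D.head_in_verts[OF a])
    note ra = D.endo_carrier[OF \<rho> fin D.arrow_in_carrier[OF a]]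
    have "f ?h (rep_act (double G) V (\<rho> (arrow_elt (double G) a)) (point_fam ?t x) ?h) =
        rep_act (double G) W (\<rho> (arrow_elt (double G) a)) (\<lambda>v. f v (point_fam ?t x v)) ?h"
      by (rule D.rep_act_morphism[OF V ra D.fam_point[OF V t x] W f(1,3) h])
    also have "rep_act (double G) W (\<rho> (arrow_elt (double G) a)) (\<lambda>v. f v (point_fam ?t x v)) =
        rep_act (double G) W (\<rho> (arrow_elt (double G) a)) (point_fam ?t (f ?t x))"
      using lin_zero[OF f(1) D.rep_subspace[OF V]] by (intro D.rep_act_cong[OF ra]) (auto simp: point_fam_def)
    finally show ?thesis by (simp add: tw_def)
  qed
  then show ?thesis
    unfolding rep_iso_def using f(1,2) by (intro exI[of _ f]) simp
qed

text \<open>Twisting by \<sigma> uses the inverse automorphism \<rho>, which therefore has to be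
  shown to respect sums, products, vertices and \<open>omega_elt\<close> as well.\<close>

lemma symmetry_groupE:
  assumes "\<sigma> \<in> symmetry_group G"
  defines "A \<equiv> carrier (path_algebra (double G))"
  defines "\<rho> \<equiv> inv_into A \<sigma>"
  shows "wf_digraph.path_endo (double G) \<rho>" "wf_digraph.path_endo (double G) \<sigma>" "\<rho> (omega_elt G) = omega_elt G"
    "x \<in> A \<Longrightarrow> \<sigma> (\<rho> x) = x" "x \<in> A \<Longrightarrow> \<rho> (\<sigma> x) = x"
proof -
  interpret D: wf_digraph "double G" by (rule wf_double)
  have hom: "\<sigma> \<in> Ring.ring_hom (path_algebra (double G)) (path_algebra (double G))" and bij: "bij_betw \<sigma> A A"
    and S: "\<And>s. s \<in> vertex_subalgebra (double G) \<Longrightarrow> \<sigma> s = s" and om: "\<sigma> (omega_elt G) = omega_elt G"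
    using assms by (auto simp: symmetry_group_def ring_iso_def)
  have \<sigma>A: "\<sigma> x \<in> A" if "x \<in> A" for x using Ring.ring_hom_closed[OF hom] that by (simp add: A_def)
  have \<sigma>add: "\<sigma> (x + y) = \<sigma> x + \<sigma> y" and \<sigma>mult: "\<sigma> (pa_mult (double G) x y) = pa_mult (double G) (\<sigma> x) (\<sigma> y)"
    if "x \<in> A" "y \<in> A" for x y
    using Ring.ring_hom_add[OF hom, of x y] Ring.ring_hom_mult[OF hom, of x y] that
    by (simp_all add: A_def path_algebra_def)
  have \<sigma>S: "\<sigma> (vertex_comb (double G) c) = vertex_comb (double G) c" for c
    by (rule S) (simp add: vertex_subalgebra_def)
  show \<sigma>\<rho>: "\<sigma> (\<rho> x) = x" if "x \<in> A" for x
    using bij that unfolding \<rho>_def by (auto simp: bij_betw_def f_inv_into_f)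
  show \<rho>\<sigma>: "\<rho> (\<sigma> x) = x" if "x \<in> A" for x
    using bij that unfolding \<rho>_def by (auto simp: bij_betw_def)
  have \<rho>A: "\<rho> x \<in> A" if "x \<in> A" for x
    using bij that unfolding \<rho>_def by (auto simp: bij_betw_def inv_into_into)
  show "D.path_endo \<sigma>"
    using \<sigma>A \<sigma>add \<sigma>mult \<sigma>S by (simp add: D.path_endo_def A_def)
  have "\<rho> (x + y) = \<rho> x + \<rho> y" if "x \<in> A" "y \<in> A" for x y
    using \<rho>\<sigma>[of "\<rho> x + \<rho> y"] \<sigma>add[of "\<rho> x" "\<rho> y"] that \<rho>A \<sigma>\<rho> D.add_in_carrier[folded A_def] by simp
  moreover have "\<rho> (pa_mult (double G) x y) = pa_mult (double G) (\<rho> x) (\<rho> y)" if "x \<in> A" "y \<in> A" for x y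
    using \<rho>\<sigma>[of "pa_mult (double G) (\<rho> x) (\<rho> y)"] \<sigma>mult[of "\<rho> x" "\<rho> y"] that \<rho>A \<sigma>\<rho>
      D.pa_mult_in_carrier[folded A_def] by simp
  moreover have "\<rho> (vertex_comb (double G) c) = vertex_comb (double G) c" for c
    using \<rho>\<sigma>[of "vertex_comb (double G) c"] \<sigma>S D.vertex_comb_in_carrier[folded A_def] by simp
  ultimately show "D.path_endo \<rho>"
    using \<rho>A by (simp add: D.path_endo_def A_def)
  show "\<rho> (omega_elt G) = omega_elt G"
    using \<rho>\<sigma>[of "omega_elt G"] om omega_in_carrier by (simp add: A_def)
qed

text \<open>The union in \<open>twist_point\<close> runs over isomorphic modules, and over at least
  one, so it collapses to a single class.\<close>

lemma twist_point_iso_class: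
  assumes V: "is_rep (double G) V" and \<sigma>: "\<sigma> \<in> symmetry_group G"
  shows "is_rep (double G) (twist_rep G \<sigma> V)"
    and "twist_point G \<sigma> (iso_class G V) = iso_class G (twist_rep G \<sigma> V)"
proof -
  interpret D: wf_digraph "double G" by (rule wf_double)
  have fin: "finite (verts (double G))" by simp
  note \<rho> = symmetry_groupE(1)[OF \<sigma>]
  show r: "is_rep (double G) (twist_rep G \<sigma> V)"
    unfolding twist_rep_eq by (rule D.is_rep_tw[OF \<rho> fin V])
  have eq: "iso_class G (twist_rep G \<sigma> W) = iso_class G (twist_rep G \<sigma> V)" if "W \<in> iso_class G V" for W
    unfolding twist_rep_eq
  proof (rule iso_class_eq[symmetric])
    have W: "is_rep (double G) W" "rep_iso (double G) V W" using that by (auto simp: iso_class_def)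
    show "is_rep (double G) (tw (double G) (inv_into (carrier (path_algebra (double G))) \<sigma>) W)"
      by (rule D.is_rep_tw[OF \<rho> fin W(1)])
    show "rep_iso (double G) (tw (double G) (inv_into (carrier (path_algebra (double G))) \<sigma>) V)
        (tw (double G) (inv_into (carrier (path_algebra (double G))) \<sigma>) W)"
      by (rule rep_iso_tw[OF V W \<rho>])
  qed (use r in \<open>simp add: twist_rep_eq\<close>)
  have "iso_class G V \<noteq> {}"
    using D.std_rep_exists[OF V] by (auto simp: iso_class_def)
  then show "twist_point G \<sigma> (iso_class G V) = iso_class G (twist_rep G \<sigma> V)"
    unfolding twist_point_def using eq by auto
qed

lemma preprojective_twist:
  "is_preprojective_module G \<tau> V \<Longrightarrow> \<sigma> \<in> symmetry_group G \<Longrightarrow> is_preprojective_module G \<tau> (twist_rep G \<sigma> V)"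
  unfolding twist_rep_eq by (rule preprojective_tw[OF _ symmetry_groupE(1,3)])

end

context loop_free_vertex
begin

text \<open>Undo the first reflection, apply the isomorphism, reflect again: the shifts -\<tau> i, 0
  and \<tau> i add up to 0.\<close>

lemma reflect_iso:
  assumes V: "is_preprojective_module Q \<tau> V" and \<tau>: "\<tau> i \<noteq> 0" and W: "is_preprojective_module Q \<tau> W"
    and iso: "rep_iso (double Q) V W"
  shows "rep_iso (double Q) (reflect_rep Q \<tau> i V) (reflect_rep Q \<tau> i W)"
proof -
  interpret V: reflectable Q i V \<tau>
    by unfold_locales (use V \<tau> i_in in \<open>auto simp: preprojective_iff\<close>)
  interpret W: reflectable Q i W \<tau>
    by unfold_locales (use W \<tau> i_in in \<open>auto simp: preprojective_iff\<close>)
  obtain \<psi> where \<psi>: "ext_iso \<psi> V W 0" using rep_iso_ext[OF iso V.V] by metis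
  note s = ext_iso_sym[OF V.V V.is_rep_reflect V.ext_iso_reflect]
  note c = ext_iso_trans[OF V.is_rep_reflect ext_iso_trans[OF V.is_rep_reflect s \<psi>] W.ext_iso_reflect]
  show ?thesis
    by (rule rep_iso_if_ext_iso[OF V.is_rep_reflect W.is_rep_reflect c[simplified]
          V.moment_reflect_i[where \<tau>' = "dual_reflection Q i \<tau>", OF dual_reflection_i] W.moment_reflect_i[where \<tau>' = "dual_reflection Q i \<tau>", OF dual_reflection_i]])
      (simp add: dual_reflection_i \<tau>)
qed

lemma reflect_point_iso_class:
  assumes V: "is_preprojective_module Q \<tau> V" and \<tau>: "\<tau> i \<noteq> 0"
  shows "reflect_point Q \<tau> i (iso_class Q V) = iso_class Q (reflect_rep Q \<tau> i V)"
proof -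
  have r: "is_rep (double Q) V" using V by (simp add: preprojective_iff)
  have eq: "iso_class Q (reflect_rep Q \<tau> i W) = iso_class Q (reflect_rep Q \<tau> i V)" if "W \<in> iso_class Q V" for W
  proof (rule iso_class_eq[symmetric])
    have W: "is_rep (double Q) W" "rep_iso (double Q) V W" using that by (auto simp: iso_class_def)
    note pW = preprojective_iso[OF V W]
    show "is_rep (double Q) (reflect_rep Q \<tau> i V)" "is_rep (double Q) (reflect_rep Q \<tau> i W)"
      using preprojective_reflect[OF V \<tau>] preprojective_reflect[OF pW \<tau>] by (simp_all add: preprojective_iff)
    show "rep_iso (double Q) (reflect_rep Q \<tau> i V) (reflect_rep Q \<tau> i W)"
      by (rule reflect_iso[OF V \<tau> pW W(2)])
  qed
  have "iso_class Q V \<noteq> {}"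
    using D.std_rep_exists[OF r] by (auto simp: iso_class_def)
  then show ?thesis
    unfolding reflect_point_def using eq by auto
qed

text \<open>Both sides differ from the twisted module by the shift \<tau> i, one directly by
  reflection and the other by \<open>ext_iso_tw\<close>. The shifts cancel, and both sides satisfy
  the reflected relation at i, so the comparison away from i extends to i.\<close>

theorem reflect_twist_iso:
  assumes V: "is_preprojective_module Q \<tau> V" and \<tau>: "\<tau> i \<noteq> 0" and \<sigma>: "\<sigma> \<in> symmetry_group Q"
  shows "rep_iso (double Q) (reflect_rep Q \<tau> i (twist_rep Q \<sigma> V)) (twist_rep Q \<sigma> (reflect_rep Q \<tau> i V))"
proof -
  note T = preprojective_twist[OF V \<sigma>] and R = preprojective_reflect[OF V \<tau>]
  note TR = preprojective_twist[OF R \<sigma>]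
  interpret V: reflectable Q i V \<tau>
    by unfold_locales (use V \<tau> i_in in \<open>auto simp: preprojective_iff\<close>)
  interpret T: reflectable Q i "twist_rep Q \<sigma> V" \<tau>
    by unfold_locales (use T \<tau> i_in in \<open>auto simp: preprojective_iff\<close>)
  have e: "ext_iso (\<lambda>_. vec_inl) (twist_rep Q \<sigma> V) (twist_rep Q \<sigma> (reflect_rep Q \<tau> i V)) (\<tau> i)"
    unfolding twist_rep_eq
    by (rule ext_iso_tw[OF V.V V.is_rep_reflect V.ext_iso_reflect symmetry_groupE(1,3,2)[OF \<sigma>]
          symmetry_groupE(4,5)[OF \<sigma>]])
  note s = ext_iso_sym[OF T.V T.is_rep_reflect T.ext_iso_reflect]
  note c = ext_iso_trans[OF T.is_rep_reflect s e]
  have m: "moment Q (dual_reflection Q i \<tau>) (twist_rep Q \<sigma> (reflect_rep Q \<tau> i V)) i"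
    and r: "is_rep (double Q) (twist_rep Q \<sigma> (reflect_rep Q \<tau> i V))"
    using TR i_in by (auto simp: preprojective_iff)
  show ?thesis
    by (rule rep_iso_if_ext_iso[OF T.is_rep_reflect r c[simplified] T.moment_reflect_i[where \<tau>' = "dual_reflection Q i \<tau>", OF dual_reflection_i] m])
      (simp add: dual_reflection_i \<tau>)
qed

lemma reflect_semisimple:
  assumes V: "is_preprojective_module Q \<tau> V" and \<tau>: "\<tau> i \<noteq> 0" and ss: "is_semisimple (double Q) V"
    and W: "is_rep (double Q) W" and iso: "rep_iso (double Q) (reflect_rep Q \<tau> i V) W"
  shows "is_semisimple (double Q) W"
proof -
  interpret V: reflectable Q i V \<tau>
    by unfold_locales (use V \<tau> i_in in \<open>auto simp: preprojective_iff\<close>)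
  note pW = preprojective_iso[OF preprojective_reflect[OF V \<tau>] W iso]
  obtain \<psi> where \<psi>: "ext_iso \<psi> (reflect_rep Q \<tau> i V) W 0" using rep_iso_ext[OF iso V.is_rep_reflect] by metis
  note c = ext_iso_trans[OF V.V V.ext_iso_reflect \<psi>]
  have m: "moment Q (dual_reflection Q i \<tau>) W i" using pW i_in by (simp add: preprojective_iff)
  show ?thesis
    by (rule semisimple_transfer[OF V.V W c V.m \<tau> m _ ss]) (simp add: dual_reflection_i \<tau>)
qed

end

text \<open>All properties are carried along the word at once, since each reflection needs the
  relations established by the ones before it. A representative over \<open>nat\<close> is chosen
  afresh after every reflection.\<close>

lemma reflect_points_iso_class:
  fixes V :: "('v, 'a) std_rep"
  assumes "fin_digraph Q" and "is_preprojective_module Q \<tau> V" and "admissible_word Q \<tau> ws"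
  shows "\<exists>W :: ('v, 'a) std_rep. is_preprojective_module Q (word_dual_reflection Q ws \<tau>) W \<and>
    reflect_points Q \<tau> ws (iso_class Q V) = iso_class Q W \<and>
    (\<forall>\<beta>. has_dimension (double Q) V \<beta> \<longrightarrow> has_dimension (double Q) W (word_reflection Q ws \<beta>)) \<and>
    (is_semisimple (double Q) V \<longrightarrow> is_semisimple (double Q) W) \<and>
    (\<forall>\<sigma>\<in>symmetry_group Q. reflect_points Q \<tau> ws (iso_class Q (twist_rep Q \<sigma> V)) = iso_class Q (twist_rep Q \<sigma> W))"
  using assms(3)
proof (induction ws)
  case Nil
  show ?case
    by (rule exI[of _ V]) (simp add: assms(2) word_dual_reflection_def word_reflection_def)
next
  case (Cons i ws)
  interpret fin_digraph Q by fact
  let ?\<tau> = "word_dual_reflection Q ws \<tau>"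
  from Cons obtain W :: "('v, 'a) std_rep" where W: "is_preprojective_module Q ?\<tau> W"
      "reflect_points Q \<tau> ws (iso_class Q V) = iso_class Q W"
      "\<And>\<beta>. has_dimension (double Q) V \<beta> \<Longrightarrow> has_dimension (double Q) W (word_reflection Q ws \<beta>)"
      "is_semisimple (double Q) V \<Longrightarrow> is_semisimple (double Q) W"
      "\<And>\<sigma>. \<sigma> \<in> symmetry_group Q \<Longrightarrow>
        reflect_points Q \<tau> ws (iso_class Q (twist_rep Q \<sigma> V)) = iso_class Q (twist_rep Q \<sigma> W)"
    by auto
  have i: "i \<in> loop_free Q" and \<tau>: "?\<tau> i \<noteq> 0" using Cons.prems by auto
  interpret loop_free_vertex Q i by unfold_locales (rule i)
  interpret W: reflectable Q i W ?\<tau>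
    by unfold_locales (use W(1) \<tau> i_in in \<open>auto simp: preprojective_iff\<close>)
  have dual: "word_dual_reflection Q (i # ws) \<tau> = dual_reflection Q i ?\<tau>"
    by (simp add: word_dual_reflection_def)
  obtain W' :: "('v, 'a) std_rep" where W': "is_rep (double Q) W'" "rep_iso (double Q) (reflect_rep Q ?\<tau> i W) W'"
    "iso_class Q (reflect_rep Q ?\<tau> i W) = iso_class Q W'"
    using iso_class_std[OF W.is_rep_reflect] by metis
  have "is_preprojective_module Q (word_dual_reflection Q (i # ws) \<tau>) W'"
    unfolding dual by (rule preprojective_iso[OF preprojective_reflect[OF W(1) \<tau>] W'(1,2)])
  moreover have "reflect_points Q \<tau> (i # ws) (iso_class Q V) = iso_class Q W'"
    by (simp add: W(2) reflect_point_iso_class[OF W(1) \<tau>] W'(3))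
  moreover have "has_dimension (double Q) W' (word_reflection Q (i # ws) \<beta>)" if "has_dimension (double Q) V \<beta>" for \<beta>
    using rep_iso_dimension[OF W.is_rep_reflect W'(2) W.reflect_dimension[OF W(3)[OF that]]]
    by (simp add: word_reflection_def)
  moreover have "is_semisimple (double Q) V \<longrightarrow> is_semisimple (double Q) W'"
    using reflect_semisimple[OF W(1) \<tau> W(4) W'(1,2)] by blast
  moreover have "reflect_points Q \<tau> (i # ws) (iso_class Q (twist_rep Q \<sigma> V)) = iso_class Q (twist_rep Q \<sigma> W')"
    if \<sigma>: "\<sigma> \<in> symmetry_group Q" for \<sigma>
  proof -
    note T = preprojective_twist[OF W(1) \<sigma>]
    have "reflect_points Q \<tau> (i # ws) (iso_class Q (twist_rep Q \<sigma> V)) =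
        iso_class Q (reflect_rep Q ?\<tau> i (twist_rep Q \<sigma> W))"
      by (simp add: W(5)[OF \<sigma>] reflect_point_iso_class[OF T \<tau>])
    also have "\<dots> = iso_class Q (twist_rep Q \<sigma> (reflect_rep Q ?\<tau> i W))"
      using preprojective_reflect[OF T \<tau>] twist_point_iso_class(1)[OF W.is_rep_reflect \<sigma>]
      by (intro iso_class_eq reflect_twist_iso[OF W(1) \<tau> \<sigma>]) (auto simp: preprojective_iff)
    also have "\<dots> = iso_class Q (twist_rep Q \<sigma> W')"
      using twist_point_iso_class(2)[OF W.is_rep_reflect \<sigma>] twist_point_iso_class(2)[OF W'(1) \<sigma>] W'(3) by simp
    finally show ?thesis .
  qed
  ultimately show ?case by (intro exI[of _ W']) simp
qed

theorem theorem3: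
  fixes m :: nat and lam :: "nat \<Rightarrow> complex" and \<alpha> :: "nat \<Rightarrow> nat"
    and Q :: "(vertex, vertex) pre_digraph"
    and \<beta> :: "vertex \<Rightarrow> int" and \<tau> :: "vertex \<Rightarrow> complex"
    and s :: "(vertex \<Rightarrow> int) \<Rightarrow> vertex \<Rightarrow> int" and ws :: "vertex list"
  assumes "m \<ge> 1"
    and "generic m lam"
    and "Q = framed_cyclic_quiver m"
    and "\<beta> = framed_dim \<alpha>"
    and "\<tau> = framed_param m lam \<alpha>"
    and "s \<in> weyl_group Q"
    and "set ws \<subseteq> loop_free Q"
    and "s = word_reflection Q ws"
    and "admissible_word Q \<tau> ws"
  shows "reflect_points Q \<tau> ws \<in> quiver_variety Q \<tau> \<beta> \<rightarrow>
           quiver_variety Q (word_dual_reflection Q ws \<tau>) (s \<beta>) \<and>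
         (\<forall>\<sigma>\<in>symmetry_group Q. \<forall>X\<in>quiver_variety Q \<tau> \<beta>.
           reflect_points Q \<tau> ws (twist_point Q \<sigma> X) = twist_point Q \<sigma> (reflect_points Q \<tau> ws X))"
proof -
  have fin: "fin_digraph Q"
    using fin_digraph_framed_cyclic_quiver[OF assms(1)] assms(3) by simp
  then interpret fin_digraph Q .
  have "reflect_points Q \<tau> ws X \<in> quiver_variety Q (word_dual_reflection Q ws \<tau>) (s \<beta>) \<and>
      (\<forall>\<sigma>\<in>symmetry_group Q.
        reflect_points Q \<tau> ws (twist_point Q \<sigma> X) = twist_point Q \<sigma> (reflect_points Q \<tau> ws X))"
    if "X \<in> quiver_variety Q \<tau> \<beta>" for X
  proof -
    from that obtain V :: "(vertex, vertex) std_rep" where X: "X = iso_class Q V"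
      and V: "is_preprojective_module Q \<tau> V" "has_dimension (double Q) V \<beta>" "is_semisimple (double Q) V"
      by (auto simp: quiver_variety_def)
    obtain W :: "(vertex, vertex) std_rep" where W: "is_preprojective_module Q (word_dual_reflection Q ws \<tau>) W"
        "reflect_points Q \<tau> ws (iso_class Q V) = iso_class Q W"
        "has_dimension (double Q) W (word_reflection Q ws \<beta>)" "is_semisimple (double Q) W"
        "\<And>\<sigma>. \<sigma> \<in> symmetry_group Q \<Longrightarrow>
          reflect_points Q \<tau> ws (iso_class Q (twist_rep Q \<sigma> V)) = iso_class Q (twist_rep Q \<sigma> W)"
      using reflect_points_iso_class[OF fin V(1) assms(9)] V(2,3) by blast
    have rV: "is_rep (double Q) V" and rW: "is_rep (double Q) W"
      using V(1) W(1) by (auto simp: preprojective_iff)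
    have "iso_class Q W \<in> quiver_variety Q (word_dual_reflection Q ws \<tau>) (s \<beta>)"
      using W(1,3,4) assms(8) by (auto simp: quiver_variety_def)
    then show ?thesis
      by (simp add: X W(2) twist_point_iso_class(2)[OF rV] twist_point_iso_class(2)[OF rW] W(5))
  qed
  then show ?thesis by blast
qed

end
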